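(* Let $n\ge 2$, $N\ge 1$, $k\ge 2$ be integers, let $\Omega\subset\mathbb{R}^n$ be a Lipschitz domain, and let $W:\Omega\times\mathbb{R}^{N\times n}\to\mathbb{R}$ satisfy: (i) $\mathbf{K}\mapsto W(\mathbf{x},\mathbf{K})$ is in $C^k(\mathbb{R}^{N\times n})$ for a.e. $\mathbf{x}\in\Omega$; (ii) for each $j=0,1,\ldots,k$, the map $(\mathbf{x},\mathbf{K})\mapsto \mathrm{D}^jW(\mathbf{x},\mathbf{K})$ is Lebesgue measurable on $\Omega\times\mathbb{R}^{N\times n}$; (iii) there are constants $c_k>0$ and $r>0$ such that $|\mathrm{D}^kW(\mathbf{x},\mathbf{K})|\le c_k(1+|\mathbf{K}|^r)$ for all $\mathbf{K}\in\mathbb{R}^{N\times n}$ and a.e. $\mathbf{x}\in\Omega$. Fix $M>0$ and $\mathbf{F}\in L^\infty(\Omega;\mathbb{R}^{N\times n})$. Then there exists a constant $c=c(M,\|\mathbf{F}\|_\infty)>0$ such that every $\mathbf{G}\in \mathrm{BMO}(\Omega;\mathbb{R}^{N\times n})$ with $\|\mathbf{G}-\mathbf{F}\|_{\mathrm{BMO}}<M$ satisfies $$\int_\Omega W(\mathbf{x},\mathbf{G}(\mathbf{x}))\,d\mathbf{x}\ \ge\ \int_\Omega W(\mathbf{x},\mathbf{F}(\mathbf{x}))\,d\mathbf{x}+\sum_{j=1}^{k-1}\frac{1}{j!}\int_\Omega \mathrm{D}^jW(\mathbf{x},\mathbf{F}(\mathbf{x}))\big[\mathbf{H}(\mathbf{x}),\mathbf{H}(\mathbf{x}),\ldots,\mathbf{H}(\mathbf{x})\big]\,d\mathbf{x}-c\int_\Omega|\mathbf{H}(\mathbf{x})|^k\,d\mathbf{x},$$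 where $\mathbf{H}=\mathbf{G}-\mathbf{F}$ and, in the $j$-th term, $\mathbf{H}(\mathbf{x})$ appears $j$ times.
   Context: A domain is a nonempty connected open set. A Lipschitz domain is a bounded domain whose boundary is (strongly) Lipschitz: near every boundary point the boundary is the graph of a Lipschitz-continuous function with the domain on one side of this graph. $\mathbb{R}^{N\times n}$ is the space of real $N$ by $n$ matrices with inner product $\mathbf{A}:\mathbf{B}=\mathrm{trace}(\mathbf{A}\mathbf{B}^{\mathrm T})$ and norm $|\mathbf{A}|=\sqrt{\mathbf{A}:\mathbf{A}}$. $\mathrm{D}^0W:=W$ and, for $j\ge1$, $\mathrm{D}^jW(\mathbf{x},\mathbf{K}):=\frac{\partial^j}{\partial\mathbf{K}^j}W(\mathbf{x},\mathbf{K})$ is the $j$-th derivative with respect to the matrix variable only, viewed as a multilinear map from $j$ copies of $\mathbb{R}^{N\times n}$ to $\mathbb{R}$; $|\mathrm{D}^jW|$ is its norm as a multilinear map. For $\mathbf{F}\in L^1_{\mathrm{loc}}(\Omega;\mathbb{R}^{N\times n})$ the BMO-seminorm is $$[\![\mathbf{F}]\!]_{\mathrm{BMO}(\Omega)}:=\sup_{Q}\frac1{|Q|}\int_Q|\mathbf{F}(\mathbf{x})-\langle\mathbf{F}\rangle_Q|\,d\mathbf{x},$$ where the supremum is over all nonempty bounded open $n$-dimensional hypercubes $Q$ with faces parallel to the coordinate hyperplanes that are contained in a compact subset of $\Omega$, and $\langle\mathbf{F}\rangle_U:=\frac1{|U|}\int_U\mathbf{F}\,d\mathbf{x}$ denotes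 the average over $U$. $\mathrm{BMO}(\Omega;\mathbb{R}^{N\times n})$ is the set of $\mathbf{F}\in L^1_{\mathrm{loc}}(\Omega;\mathbb{R}^{N\times n})$ with $[\![\mathbf{F}]\!]_{\mathrm{BMO}(\Omega)}<\infty$. For a Lipschitz domain, $\mathrm{BMO}(\Omega;\mathbb{R}^{N\times n})\subset L^1(\Omega;\mathbb{R}^{N\times n})$, and $$\|\mathbf{F}\|_{\mathrm{BMO}}:=[\![\mathbf{F}]\!]_{\mathrm{BMO}(\Omega)}+|\langle\mathbf{F}\rangle_\Omega|$$ is a norm on $\mathrm{BMO}(\Omega;\mathbb{R}^{N\times n})$. $\|\mathbf{F}\|_\infty$ is the essential supremum of $|\mathbf{F}|$ on $\Omega$.
   Formalization: Since (i)–(iii) do not ensure that the integrals of W(x,F) and D^jW(x,F)[H,…,H] exist, it is assumed for each G that they exist in [−∞,∞] and that +∞ and −∞ do not both occur among them; the integral of W(x,G) is then proved to exist. *)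

theory Defs
  imports "HOL-Analysis.Analysis" "HOL-Probability.Essential_Supremum"
begin

text \<open>
  The space of real \<open>N\<close> by \<open>n\<close> matrices is \<open>real ^ 'n ^ 'N\<close>; its library inner product and norm are
  \<open>trace (A B\<^sup>T)\<close> and the Frobenius norm.
\<close>

section \<open>Lipschitz domains\<close>

definition domain_set :: "'a::euclidean_space set \<Rightarrow> bool" where
  "domain_set \<Omega> \<longleftrightarrow> \<Omega> \<noteq> {} \<and> connected \<Omega> \<and> open \<Omega>"

text \<open>
  Near \<open>p\<close>, in coordinates consisting of the height \<open>x \<bullet> e\<close> along a unit vector \<open>e\<close> and the orthogonal
  projection \<open>x - (x \<bullet> e) *\<^sub>R e\<close> onto the hyperplane \<open>{y. y \<bullet> e = 0}\<close>, the boundary is the graph of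
  \<open>g\<close> and \<open>\<Omega>\<close> lies on one side of it. A Lipschitz function on part of the hyperplane extends to all
  of it, so \<open>g\<close> may be taken on the whole hyperplane.
\<close>

definition lipschitz_boundary_at :: "'a::euclidean_space set \<Rightarrow> 'a \<Rightarrow> bool" where
  "lipschitz_boundary_at \<Omega> p \<longleftrightarrow>
    (\<exists>U e g L. open U \<and> p \<in> U \<and> norm e = 1 \<and> L-lipschitz_on {y. y \<bullet> e = 0} (g :: 'a \<Rightarrow> real) \<and>
       frontier \<Omega> \<inter> U = {x \<in> U. x \<bullet> e = g (x - (x \<bullet> e) *\<^sub>R e)} \<and>
       \<Omega> \<inter> U = {x \<in> U. x \<bullet> e > g (x - (x \<bullet> e) *\<^sub>R e)})"

definition lipschitz_domain :: "'a::euclidean_space set \<Rightarrow> bool" where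
  "lipschitz_domain \<Omega> \<longleftrightarrow>
    domain_set \<Omega> \<and> bounded \<Omega> \<and> (\<forall>p \<in> frontier \<Omega>. lipschitz_boundary_at \<Omega> p)"

section \<open>Higher derivatives\<close>

text \<open>
  \<open>Dn f [H\<^sub>1, \<dots>, H\<^sub>j] K\<close> is \<open>D\<^sup>j f (K) [H\<^sub>1, \<dots>, H\<^sub>j]\<close>, the iterated Frechet derivative
  \<open>D (D\<^sup>j\<^sup>-\<^sup>1 f) (K) [H\<^sub>1]\<close> evaluated at \<open>[H\<^sub>2, \<dots>, H\<^sub>j]\<close>. As the space is finite-dimensional,
  differentiating a map into the \<open>(j-1)\<close>-linear forms is the same as differentiating each of its
  evaluations at fixed arguments, and likewise for continuity (and for measurability, in the theorem).
  \<open>Dn\<close> is meaningful up to order \<open>j\<close> when \<open>C_class j f\<close> holds.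
\<close>

primrec Dn :: "('a::euclidean_space \<Rightarrow> real) \<Rightarrow> 'a list \<Rightarrow> 'a \<Rightarrow> real" where
  "Dn f [] = f"
| "Dn f (H # Hs) = (\<lambda>K. frechet_derivative (Dn f Hs) (at K) H)"

definition C_class :: "nat \<Rightarrow> ('a::euclidean_space \<Rightarrow> real) \<Rightarrow> bool" where
  "C_class k f \<longleftrightarrow>
    (\<forall>Hs. length Hs < k \<longrightarrow> (\<forall>K. Dn f Hs differentiable (at K))) \<and>
    (\<forall>Hs. length Hs \<le> k \<longrightarrow> continuous_on UNIV (Dn f Hs))"

definition multilinear_norm :: "nat \<Rightarrow> ('a::euclidean_space list \<Rightarrow> real) \<Rightarrow> real" where
  "multilinear_norm j T = (SUP Hs \<in> {Hs. length Hs = j \<and> (\<forall>H \<in> set Hs. norm H \<le> 1)}. \<bar>T Hs\<bar>)"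

section \<open>Essentially bounded functions and functions of bounded mean oscillation\<close>

definition linf_norm :: "'a::euclidean_space set \<Rightarrow> ('a \<Rightarrow> 'b::euclidean_space) \<Rightarrow> ereal" where
  "linf_norm \<Omega> F = esssup (lebesgue_on \<Omega>) (\<lambda>x. ereal (norm (F x)))"

definition L_inf :: "'a::euclidean_space set \<Rightarrow> ('a \<Rightarrow> 'b::euclidean_space) set" where
  "L_inf \<Omega> = {F. F \<in> borel_measurable (lebesgue_on \<Omega>) \<and> linf_norm \<Omega> F < \<infinity>}"

definition L1_loc :: "'a::euclidean_space set \<Rightarrow> ('a \<Rightarrow> 'b::euclidean_space) set" where
  "L1_loc \<Omega> = {F. F \<in> borel_measurable (lebesgue_on \<Omega>) \<and>
                  (\<forall>C. compact C \<and> C \<subseteq> \<Omega> \<longrightarrow> integrable (lebesgue_on C) F)}"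

definition average :: "'a::euclidean_space set \<Rightarrow> ('a \<Rightarrow> 'b::euclidean_space) \<Rightarrow> 'b" where
  "average U F = (1 / measure lebesgue U) *\<^sub>R integral\<^sup>L (lebesgue_on U) F"

definition inner_cubes :: "(real ^ 'n) set \<Rightarrow> (real ^ 'n) set set" where
  "inner_cubes \<Omega> = {Q. (\<exists>a s. s > 0 \<and> Q = box a (a + (\<chi> i. s))) \<and>
                       (\<exists>C. compact C \<and> C \<subseteq> \<Omega> \<and> Q \<subseteq> C)}"

definition bmo_seminorm :: "(real ^ 'n) set \<Rightarrow> (real ^ 'n \<Rightarrow> 'b::euclidean_space) \<Rightarrow> ennreal" where
  "bmo_seminorm \<Omega> F =
    (SUP Q \<in> inner_cubes \<Omega>. ennreal (average Q (\<lambda>x. norm (F x - average Q F))))"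

definition BMO :: "(real ^ 'n) set \<Rightarrow> (real ^ 'n \<Rightarrow> 'b::euclidean_space) set" where
  "BMO \<Omega> = {F. F \<in> L1_loc \<Omega> \<and> bmo_seminorm \<Omega> F < \<infinity>}"

definition bmo_norm :: "(real ^ 'n) set \<Rightarrow> (real ^ 'n \<Rightarrow> 'b::euclidean_space) \<Rightarrow> ennreal" where
  "bmo_norm \<Omega> F = bmo_seminorm \<Omega> F + ennreal (norm (average \<Omega> F))"

section \<open>Lebesgue integrals with values in the extended reals\<close>

text \<open>
  The Bochner integral is \<open>0\<close> for every non-integrable function. Here a measurable function whose
  positive or negative part has finite integral has an integral in \<open>[-\<infinity>, \<infinity>]\<close>; for integrable
  functions this is the Bochner integral.
\<close>

definition ext_integrable :: "'a measure \<Rightarrow> ('a \<Rightarrow> real) \<Rightarrow> bool" where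
  "ext_integrable M f \<longleftrightarrow> f \<in> borel_measurable M \<and>
    ((\<integral>\<^sup>+ x. ennreal (f x) \<partial>M) < \<infinity> \<or> (\<integral>\<^sup>+ x. ennreal (- f x) \<partial>M) < \<infinity>)"

definition ext_integral :: "'a measure \<Rightarrow> ('a \<Rightarrow> real) \<Rightarrow> ereal" where
  "ext_integral M f =
    enn2ereal (\<integral>\<^sup>+ x. ennreal (f x) \<partial>M) - enn2ereal (\<integral>\<^sup>+ x. ennreal (- f x) \<partial>M)"

text \<open>
  The integrals of \<open>f\<^sub>0, \<dots>, f\<^sub>k\<^sub>-\<^sub>1\<close> exist and can be added (with positive weights), that is,
  \<open>\<infinity>\<close> and \<open>-\<infinity>\<close> do not both occur. This matters since \<open>\<infinity> + (-\<infinity>) = \<infinity>\<close> in \<^typ>\<open>ereal\<close>.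
\<close>

definition integrals_summable :: "'a measure \<Rightarrow> nat \<Rightarrow> (nat \<Rightarrow> 'a \<Rightarrow> real) \<Rightarrow> bool" where
  "integrals_summable M k f \<longleftrightarrow>
    (\<forall>j<k. ext_integrable M (f j)) \<and>
    ((\<forall>j<k. ext_integral M (f j) \<noteq> \<infinity>) \<or> (\<forall>j<k. ext_integral M (f j) \<noteq> -\<infinity>))"

end

theory Submission
  imports Defs
begin

text \<open>
  Taylor's formula and the growth of the \<open>k\<close>-th derivative bound the remainder by a multiple of
  \<open>|H|\<^sup>k + |H|\<^sup>k\<^sup>+\<^sup>r\<close>, so everything rests on the interpolation inequality
  \<open>\<integral> |H|\<^sup>k\<^sup>+\<^sup>r \<le> C \<integral> |H|\<^sup>k\<close> for functions of BMO norm below \<open>M\<close>, where \<open>C\<close> may depend on \<open>M\<close>.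
  It follows by the layer cake formula from a good-lambda inequality
  \<open>|{|H| > \<theta> + B}| \<le> |{|H| > \<theta>}| / 2\<close> at all levels above a fixed one. Near a boundary point, the
  cubes with centre \<open>y + s e\<close> and side proportional to \<open>s\<close> lie inside the domain, where \<open>e\<close> points upwards
  from the boundary graph. They play the role of the dyadic cubes in the Calderon-Zygmund stopping argument:
  stopping at the first scale at which \<open>{|H| > \<theta>}\<close> fills half of the cube and applying
  Vitali's covering lemma reduces the inequality to the fact that, outside a set of small proportion, \<open>H\<close> is close to its
  average over such a cube in a ball of size \<open>s\<close>. The points at height at least \<open>\<tau> s\<close> above the graph are
  reached by chains of boundedly many cubes, and the remaining layer is thin.
\<close>

section \<open>Covering arguments\<close>

text \<open>The good-lambda form is dictated by the right-hand side of the interpolation inequality.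
  Exponential decay of the superlevel sets relative to |\<Omega>|, in the manner of John and
  Nirenberg, would bound the integral of |H|^(k+r) by a constant only. Decay relative to |{|H| >
  \<theta>}| can be continued by Chebyshev's inequality to a multiple of the integral of |H|^k,
  however small H is. The obstacle is the boundary: oscillation is controlled only over cubes
  compactly inside the domain, and cubes centred at a point must shrink as the point approaches the
  boundary. Shifting the cubes inwards by their own scale restores all scales, at the price that a
  cube no longer contains the point it serves. All constants must be found before H, so each
  estimate has the form "there is B such that for all H". Finally, the integrals of W and of the
  Taylor terms may be infinite, so the pointwise Taylor estimate cannot be integrated term by term
  with signs; it is integrated through positive and negative parts.\<close>

text \<open>Vitali's lemma picks disjoint balls whose fivefold enlargements cover D up to the null
  set N; the local estimates are then summed, and disjointness is used on the side of E.\<close>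

lemma measure_le_by_density_on_balls:
  fixes D E :: "'a::euclidean_space set"
  assumes D: "D \<in> sets lebesgue" and E: "E \<in> lmeasurable" and N: "negligible N" and "\<epsilon> \<ge> 0"
    and ball: "\<And>y. y \<in> D - N \<Longrightarrow> \<exists>r. 0 < r \<and> r \<le> R \<and>
       measure lebesgue (D \<inter> cball y (5 * r)) \<le> \<epsilon> * measure lebesgue (E \<inter> cball y r)"
  shows "measure lebesgue D \<le> \<epsilon> * measure lebesgue E"
proof -
  obtain r where r: "\<And>y. y \<in> D - N \<Longrightarrow> 0 < r y \<and> r y \<le> R \<and>
       measure lebesgue (D \<inter> cball y (5 * r y)) \<le> \<epsilon> * measure lebesgue (E \<inter> cball y (r y))"
    using ball by metis
  have cov: "D - N \<subseteq> (\<Union>y\<in>D - N. cball y (r y))"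
    using r by (force intro: less_imp_le)
  obtain C where C: "countable C" "C \<subseteq> D - N"
    and disj: "pairwise (\<lambda>i j. disjnt (cball i (r i)) (cball j (r j))) C"
    and sub: "D - N \<subseteq> (\<Union>i\<in>C. cball i (5 * r i))"
  proof (rule Vitali_covering_lemma_cballs[OF cov])
    show "0 < r y \<and> r y \<le> R" if "y \<in> D - N" for y
      using r[OF that] by blast
  qed blast
  let ?U = "\<Union>y\<in>C. D \<inter> cball y (5 * r y)"
  have lm: "D \<inter> cball y s \<in> lmeasurable" "E \<inter> cball y s \<in> lmeasurable" for y s
    using fmeasurable_Int_fmeasurable[OF lmeasurable_cball D] fmeasurable_Int_fmeasurable[OF lmeasurable_cball fmeasurableD[OF E]]
    by (simp_all add: Int_commute)
  have fin: "measure lebesgue (\<Union>y\<in>I. D \<inter> cball y (5 * r y)) \<le> \<epsilon> * measure lebesgue E"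
    if I: "I \<subseteq> C" "finite I" for I
  proof -
    have "measure lebesgue (\<Union>y\<in>I. D \<inter> cball y (5 * r y))
        \<le> (\<Sum>y\<in>I. measure lebesgue (D \<inter> cball y (5 * r y)))"
      using lm by (intro measure_UNION_le I) auto
    also have "\<dots> \<le> (\<Sum>y\<in>I. \<epsilon> * measure lebesgue (E \<inter> cball y (r y)))"
      using r I C(2) by (intro sum_mono) blast
    also have "\<dots> = \<epsilon> * measure lebesgue (\<Union>y\<in>I. E \<inter> cball y (r y))"
    proof -
      have "disjoint_family_on (\<lambda>y. E \<inter> cball y (r y)) I"
        using pairwise_subset[OF disj I(1)] unfolding disjoint_family_on_def pairwise_def disjnt_def by blast
      then show ?thesis
        using lm(2) fmeasurableD2[OF lm(2)]
        by (subst measure_finite_Union[OF I(2)]) (auto simp: sum_distrib_left)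
    qed
    also have "\<dots> \<le> \<epsilon> * measure lebesgue E"
      using E lm I \<open>\<epsilon> \<ge> 0\<close>
      by (intro mult_left_mono measure_mono_fmeasurable sets.finite_UN) auto
    finally show ?thesis .
  qed
  have U: "?U \<in> lmeasurable" "measure lebesgue ?U \<le> \<epsilon> * measure lebesgue E"
    using fmeasurable_UN_bound[OF C(1) lm(1) fin] measure_UN_bound[OF C(1) lm(1) fin] by auto
  have "measure lebesgue D = measure lebesgue ?U"
  proof (rule measure_negligible_symdiff[OF U(1), of D])
    show "negligible (?U - D \<union> (D - ?U))"
      using sub by (intro negligible_subset[OF N]) blast
  qed
  then show ?thesis
    using U(2) by simp
qed

text \<open>A quantitative density argument. Z is approached through its measurable covers: each
  cover can be replaced by one that is smaller by almost the factor 1 - \<kappa>, so the infimum of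
  their measures is 0.\<close>

lemma negligible_low_density:
  fixes E Z :: "'a::euclidean_space set"
  assumes E: "E \<in> lmeasurable" and Z: "Z \<subseteq> E" and \<kappa>: "0 < \<kappa>" "\<kappa> \<le> 1"
    and low: "\<And>y d. y \<in> Z \<Longrightarrow> 0 < d \<Longrightarrow> \<exists>\<rho>. 0 < \<rho> \<and> \<rho> < d \<and>
       measure lebesgue (E \<inter> cball y \<rho>) \<le> (1 - \<kappa>) * measure lebesgue (cball y \<rho>)"
  shows "negligible Z"
proof -
  define covers where "covers = {T \<in> lmeasurable. Z \<subseteq> T}"
  have shrink: "\<exists>T'\<in>covers. measure lebesgue T' \<le> (1 - \<kappa>) * (measure lebesgue T + \<delta>)"
    if T: "T \<in> covers" and "\<delta> > 0" for T \<delta>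
  proof -
    \<comment> \<open>The open superset leaves room for small balls around the points of Z, at the
      cost of \<delta> in measure.\<close>
    obtain G where G: "open G" "T \<subseteq> G" "G - T \<in> lmeasurable" "emeasure lebesgue (G - T) < ennreal \<delta>"
    proof (rule sets_lebesgue_outer_open)
      show "T \<in> sets lebesgue" using T by (auto simp: covers_def)
    qed (use \<open>\<delta> > 0\<close> in auto)
    have Glm: "G \<in> lmeasurable"
      using fmeasurable.Un[OF G(3), of T] T G(2) by (auto simp: covers_def Un_absorb2)
    have "measure lebesgue G = measure lebesgue T + measure lebesgue (G - T)"
      using measurable_measure_Diff[OF Glm, of T] T G(2) by (auto simp: covers_def)
    also have "measure lebesgue (G - T) \<le> \<delta>"
      using G(3,4) \<open>\<delta> > 0\<close> by (simp add: emeasure_eq_measure2 ennreal_less_iff)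
    finally have Gm: "measure lebesgue G \<le> measure lebesgue T + \<delta>" by simp
    define K where "K = {i. fst i \<in> Z \<and> 0 < snd i \<and> cball (fst i) (snd i) \<subseteq> G \<and>
       measure lebesgue (E \<inter> cball (fst i) (snd i)) \<le> (1 - \<kappa>) * measure lebesgue (cball (fst i) (snd i))}"
    have fine: "\<exists>i. i \<in> K \<and> x \<in> cball (fst i) (snd i) \<and> snd i < d" if "x \<in> Z" "0 < d" for x d
    proof -
      have "x \<in> G" using that T G(2) by (auto simp: covers_def)
      then obtain d' where d': "d' > 0" "cball x d' \<subseteq> G"
        using G(1) open_contains_cball by blast
      obtain \<rho> where \<rho>: "0 < \<rho>" "\<rho> < min d d'"
        "measure lebesgue (E \<inter> cball x \<rho>) \<le> (1 - \<kappa>) * measure lebesgue (cball x \<rho>)"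
        using low[OF \<open>x \<in> Z\<close>, of "min d d'"] \<open>0 < d\<close> d'(1) by auto
      moreover have "cball x \<rho> \<subseteq> G"
        using \<rho>(2) d'(2) by (meson min_less_iff_conj less_imp_le order_trans subset_cball)
      ultimately have "(x, \<rho>) \<in> K"
        using \<open>x \<in> Z\<close> by (simp add: K_def)
      then show ?thesis using \<rho> by (intro exI[of _ "(x, \<rho>)"]) auto
    qed
    obtain C where C: "countable C" "C \<subseteq> K"
      and disj: "pairwise (\<lambda>i j. disjnt (cball (fst i) (snd i)) (cball (fst j) (snd j))) C"
      and neg: "negligible (Z - (\<Union>i\<in>C. cball (fst i) (snd i)))"
    proof (rule Vitali_covering_theorem_cballs[of K snd Z fst])
      show "0 < snd i" if "i \<in> K" for i
        using that by (auto simp: K_def)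
      show "\<exists>i. i \<in> K \<and> x \<in> cball (fst i) (snd i) \<and> snd i < d" if "x \<in> Z" "0 < d" for x d
        using fine[OF that] .
    qed blast
    let ?A = "\<lambda>i. E \<inter> cball (fst i) (snd i)"
    let ?N = "Z - (\<Union>i\<in>C. cball (fst i) (snd i))"
    have lm: "?A i \<in> lmeasurable" for i
      using E by (auto intro: fmeasurable.Int)
    have fin: "measure lebesgue (\<Union>i\<in>I. ?A i) \<le> (1 - \<kappa>) * measure lebesgue G"
      if I: "I \<subseteq> C" "finite I" for I
    proof -
      have "measure lebesgue (\<Union>i\<in>I. ?A i) \<le> (\<Sum>i\<in>I. measure lebesgue (?A i))"
        using lm by (intro measure_UNION_le I) auto
      also have "\<dots> \<le> (\<Sum>i\<in>I. (1 - \<kappa>) * measure lebesgue (cball (fst i) (snd i)))"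
        using I C(2) by (intro sum_mono) (auto simp: K_def)
      also have "\<dots> = (1 - \<kappa>) * measure lebesgue (\<Union>i\<in>I. cball (fst i) (snd i))"
      proof -
        have "disjoint_family_on (\<lambda>i. cball (fst i) (snd i)) I"
          using pairwise_subset[OF disj I(1)] unfolding disjoint_family_on_def pairwise_def disjnt_def by blast
        then show ?thesis
          using fmeasurableD2[OF lmeasurable_cball]
          by (subst measure_finite_Union[OF I(2)]) (auto simp: sum_distrib_left)
      qed
      also have "\<dots> \<le> (1 - \<kappa>) * measure lebesgue G"
      proof (intro mult_left_mono measure_mono_fmeasurable)
        show "(\<Union>i\<in>I. cball (fst i) (snd i)) \<subseteq> G"
          using I C(2) unfolding K_def by fast
      qed (use Glm I \<kappa> in \<open>auto intro!: sets.finite_UN\<close>)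
      finally show ?thesis .
    qed
    have U: "(\<Union>i\<in>C. ?A i) \<in> lmeasurable" "measure lebesgue (\<Union>i\<in>C. ?A i) \<le> (1 - \<kappa>) * measure lebesgue G"
      using fmeasurable_UN_bound[OF C(1) lm fin] measure_UN_bound[OF C(1) lm fin] by auto
    \<comment> \<open>Since Z \<subseteq> E, the parts of the chosen balls inside E suffice for a
      cover, together with a null set. They make up at most the proportion 1 - \<kappa> of disjoint
      balls contained in G.\<close>
    let ?T' = "(\<Union>i\<in>C. ?A i) \<union> ?N"
    have "?T' \<in> covers"
      unfolding covers_def using fmeasurable.Un[OF U(1) negligible_imp_measurable[OF neg]] Z by fast
    moreover have "measure lebesgue ?T' \<le> (1 - \<kappa>) * measure lebesgue G"
      using measure_Un_le[of "\<Union>i\<in>C. ?A i" lebesgue ?N] U negligible_imp_measure0[OF neg]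
        fmeasurableD[OF negligible_imp_measurable[OF neg]] fmeasurableD[OF U(1)] by linarith
    moreover have "(1 - \<kappa>) * measure lebesgue G \<le> (1 - \<kappa>) * (measure lebesgue T + \<delta>)"
      using Gm \<kappa> by (intro mult_left_mono) auto
    ultimately show ?thesis by (meson order_trans)
  qed
  define m where "m = (INF T\<in>covers. measure lebesgue T)"
  have ne: "covers \<noteq> {}" using E Z by (auto simp: covers_def)
  have bdd: "bdd_below (measure lebesgue ` covers)"
    by (auto intro!: bdd_belowI[of _ 0])
  have m_le: "m \<le> measure lebesgue T" if "T \<in> covers" for T
    unfolding m_def using bdd that by (rule cINF_lower)
  have "m \<le> 0"
  proof (rule ccontr)
    assume "\<not> m \<le> 0"
    \<comment> \<open>Starting from a cover of measure below m + \<delta>, one improvement gives at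
      most (1 - \<kappa>)(m + \<kappa> m / 2) < m, which contradicts the choice of m as
      infimum.\<close>
    define \<delta> where "\<delta> = \<kappa> * m / 4"
    have \<delta>: "\<delta> > 0" using \<kappa> \<open>\<not> m \<le> 0\<close> by (simp add: \<delta>_def)
    obtain T where T: "T \<in> covers" "measure lebesgue T < m + \<delta>"
      using cInf_lessD[of "measure lebesgue ` covers" "m + \<delta>"] ne \<delta> by (auto simp: m_def)
    obtain T' where "T' \<in> covers" "measure lebesgue T' \<le> (1 - \<kappa>) * (measure lebesgue T + \<delta>)"
      using shrink[OF T(1) \<delta>] by blast
    then have "m \<le> (1 - \<kappa>) * (measure lebesgue T + \<delta>)" using m_le by force
    also have "\<dots> \<le> (1 - \<kappa>) * (m + 2 * \<delta>)"
      using T(2) \<kappa> by (intro mult_left_mono) auto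
    also have "\<dots> = m - \<kappa> * m / 2 - \<kappa> * \<kappa> * m / 2"
      by (simp add: \<delta>_def algebra_simps add_divide_distrib diff_divide_distrib)
    also have "\<dots> < m"
    proof -
      have "\<kappa> * m > 0" "\<kappa> * \<kappa> * m > 0" using \<kappa> \<open>\<not> m \<le> 0\<close> by auto
      then show ?thesis by linarith
    qed
    finally show False by simp
  qed
  show ?thesis
    unfolding negligible_outer
  proof (intro allI impI)
    fix e :: real assume "e > 0"
    then have "Inf (measure lebesgue ` covers) < e" using \<open>m \<le> 0\<close> by (simp add: m_def)
    then obtain T where "T \<in> covers" "measure lebesgue T < e"
      using cInf_lessD[of "measure lebesgue ` covers" e] ne by auto
    then show "\<exists>T. Z \<subseteq> T \<and> T \<in> lmeasurable \<and> measure lebesgue T < e"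
      by (auto simp: covers_def)
  qed
qed

section \<open>Cubes and mean oscillation\<close>

text \<open>Centre and half side, that is, a ball of the maximum norm: nesting of cubes becomes an
  inequality between centres and half sides.\<close>

definition cube :: "real ^ 'n \<Rightarrow> real \<Rightarrow> (real ^ 'n) set" where
  "cube w t = box (w - (\<chi> i. t)) (w + (\<chi> i. t))"

lemma mem_cube: "x \<in> cube w t \<longleftrightarrow> (\<forall>i. \<bar>x $ i - w $ i\<bar> < t)"
  unfolding cube_def mem_box_cart by (auto simp: abs_less_iff algebra_simps)

lemma lmeasurable_cube [simp]: "cube w t \<in> lmeasurable"
  by (simp add: cube_def)

lemma open_cube: "open (cube w t)"
  unfolding cube_def by (rule open_box)

lemma measure_cube:
  fixes w :: "real ^ 'n"
  assumes "t \<ge> 0"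
  shows "measure lebesgue (cube w t) = (2 * t) ^ CARD('n)"
proof -
  have "cbox (w - (\<chi> i. t)) (w + (\<chi> i. t)) \<noteq> {}"
    using assms by (auto simp: interval_ne_empty_cart)
  then have "measure lborel (cbox (w - (\<chi> i. t)) (w + (\<chi> i. t))) = (2 * t) ^ CARD('n)"
    by (subst content_cbox_cart) auto
  then show ?thesis
    by (simp add: cube_def measure_lborel_box_eq measure_lborel_cbox_eq)
qed

lemma cube_subset_cball: "cube (w :: real ^ 'n) t \<subseteq> cball w (real CARD('n) * t)"
proof
  fix x assume x: "x \<in> cube w t"
  have "norm (x - w) \<le> (\<Sum>i\<in>UNIV. \<bar>(x - w) $ i\<bar>)"
    by (rule norm_le_l1_cart)
  also have "\<dots> \<le> (\<Sum>i\<in>(UNIV :: 'n set). t)"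
    using x by (intro sum_mono) (auto simp: mem_cube less_imp_le)
  finally show "x \<in> cball w (real CARD('n) * t)"
    by (simp add: dist_norm norm_minus_commute)
qed

lemma cball_subset_cube:
  assumes "s < t"
  shows "cball w s \<subseteq> cube w t"
proof
  fix x assume "x \<in> cball w s"
  then have "norm (x - w) \<le> s" by (simp add: dist_norm norm_minus_commute)
  then have "\<bar>(x - w) $ i\<bar> < t" for i
    using component_le_norm_cart[of "x - w" i] assms by linarith
  then show "x \<in> cube w t" by (simp add: mem_cube)
qed

lemma cube_mono:
  assumes "norm (v - w) + s \<le> t"
  shows "cube v s \<subseteq> cube w t"
proof
  fix x assume x: "x \<in> cube v s"
  have "\<bar>x $ i - w $ i\<bar> < t" for i
  proof -
    have "\<bar>x $ i - v $ i\<bar> < s" using x by (simp add: mem_cube)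
    moreover have "\<bar>v $ i - w $ i\<bar> \<le> norm (v - w)"
      using component_le_norm_cart[of "v - w" i] by simp
    ultimately show ?thesis using assms by linarith
  qed
  then show "x \<in> cube w t" by (simp add: mem_cube)
qed

lemma inner_cube_iff:
  fixes \<Omega> :: "(real ^ 'n) set"
  shows "Q \<in> inner_cubes \<Omega> \<longleftrightarrow> (\<exists>w t. t > 0 \<and> Q = cube w t \<and> (\<exists>C. compact C \<and> C \<subseteq> \<Omega> \<and> Q \<subseteq> C))"
proof -
  have "(\<exists>a s. s > 0 \<and> Q = box a (a + (\<chi> i. s))) \<longleftrightarrow> (\<exists>w t. t > 0 \<and> Q = cube w t)"
  proof safe
    fix a :: "real ^ 'n" and s :: real assume "s > 0" "Q = box a (a + (\<chi> i. s))"
    moreover have "box a (a + (\<chi> i. s)) = cube (a + (\<chi> i. s / 2)) (s / 2)"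
      unfolding cube_def by (rule arg_cong2[of _ _ _ _ box]) (auto simp: vec_eq_iff)
    ultimately show "\<exists>w t. t > 0 \<and> box a (a + (\<chi> i. s)) = cube w t"
      by (intro exI[of _ "a + (\<chi> i. s / 2)"] exI[of _ "s / 2"]) auto
  next
    fix w :: "real ^ 'n" and t :: real assume "t > 0"
    moreover have "cube w t = box (w - (\<chi> i. t)) (w - (\<chi> i. t) + (\<chi> i. 2 * t))"
      unfolding cube_def by (rule arg_cong2[of _ _ _ _ box]) (auto simp: vec_eq_iff)
    ultimately show "\<exists>a s. s > 0 \<and> cube w t = box a (a + (\<chi> i. s))"
      by (intro exI[of _ "w - (\<chi> i. t)"] exI[of _ "2 * t"]) auto
  qed
  then show ?thesis unfolding inner_cubes_def by auto
qed

lemma inner_cubeI: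
  fixes w :: "real ^ 'n"
  assumes "t > 0" "cball w (real CARD('n) * t) \<subseteq> \<Omega>"
  shows "cube w t \<in> inner_cubes \<Omega>"
  unfolding inner_cube_iff
  by (intro exI conjI) (rule assms(1), rule refl, rule compact_cball, rule assms(2), rule cube_subset_cball)

lemma inner_cube_subset:
  assumes "Q \<in> inner_cubes \<Omega>" "cube w t \<subseteq> Q" "t > 0"
  shows "cube w t \<in> inner_cubes \<Omega>"
proof -
  obtain C where "compact C" "C \<subseteq> \<Omega>" "Q \<subseteq> C" using assms(1) by (auto simp: inner_cube_iff)
  then show ?thesis
    unfolding inner_cube_iff using assms(2,3) by (intro exI[of _ w] exI[of _ t] exI[of _ C] conjI) auto
qed

lemma inner_cube_lmeasurable: "Q \<in> inner_cubes \<Omega> \<Longrightarrow> Q \<in> lmeasurable"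
  unfolding inner_cube_iff by auto

lemma inner_cube_measure_pos: "Q \<in> inner_cubes \<Omega> \<Longrightarrow> measure lebesgue Q > 0"
  unfolding inner_cube_iff by (auto simp: measure_cube)

lemma inner_cube_subset_domain: "Q \<in> inner_cubes \<Omega> \<Longrightarrow> Q \<subseteq> \<Omega>"
  unfolding inner_cube_iff by auto

text \<open>Only the seminorm is bounded, so the set is invariant under subtraction of constants.
  The mean over the domain enters only in the final interpolation.\<close>

definition bmo_ball :: "(real ^ 'n) set \<Rightarrow> real \<Rightarrow> (real ^ 'n \<Rightarrow> 'b::euclidean_space) set" where
  "bmo_ball \<Omega> M = {H \<in> L1_loc \<Omega>. bmo_seminorm \<Omega> H \<le> ennreal M}"

lemma integrable_lebesgue_on_subset:
  fixes H :: "'a::euclidean_space \<Rightarrow> 'b::euclidean_space"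
  assumes "integrable (lebesgue_on C) H" "Q \<subseteq> C" "Q \<in> sets lebesgue" "C \<in> sets lebesgue"
  shows "integrable (lebesgue_on Q) H"
  using set_integrable_subset[of lebesgue C H Q] assms
  by (simp add: set_integrable_def integrable_restrict_space)

lemma integral_lebesgue_on_mono_set:
  fixes f :: "'a::euclidean_space \<Rightarrow> real"
  assumes "integrable (lebesgue_on C) f" "Q \<subseteq> C" "Q \<in> sets lebesgue" "C \<in> sets lebesgue" "\<And>x. 0 \<le> f x"
  shows "integral\<^sup>L (lebesgue_on Q) f \<le> integral\<^sup>L (lebesgue_on C) f"
proof -
  have "integrable lebesgue (\<lambda>x. indicat_real Q x *\<^sub>R f x)" "integrable lebesgue (\<lambda>x. indicat_real C x *\<^sub>R f x)"
    using integrable_lebesgue_on_subset[OF assms(1-4)] assms(1,3,4)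
    by (simp_all add: integrable_restrict_space)
  then have "(\<integral>x. indicat_real Q x *\<^sub>R f x \<partial>lebesgue) \<le> (\<integral>x. indicat_real C x *\<^sub>R f x \<partial>lebesgue)"
    using assms(2,5) by (intro integral_mono) (auto simp: indicator_def)
  then show ?thesis
    using assms by (simp add: integral_restrict_space)
qed

lemma lmeasurable_Collect:
  assumes Q: "Q \<in> lmeasurable" and P: "{z \<in> space (lebesgue_on Q). P z} \<in> sets (lebesgue_on Q)"
  shows "{z \<in> Q. P z} \<in> lmeasurable"
proof (rule fmeasurableI2[OF Q])
  show "{z \<in> Q. P z} \<in> sets lebesgue"
    using P Q by (simp add: sets_restrict_space_iff)
qed blast

lemma average_diff_const:
  fixes H :: "'a::euclidean_space \<Rightarrow> 'b::euclidean_space"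
  assumes Q: "Q \<in> lmeasurable" "measure lebesgue Q > 0" and H: "integrable (lebesgue_on Q) H"
  shows "average Q (\<lambda>x. H x - a) = average Q H - a"
proof -
  have fin: "finite_measure (lebesgue_on Q)"
    using Q(1) by (rule finite_measure_lebesgue_on)
  have m: "measure (lebesgue_on Q) (space (lebesgue_on Q)) = measure lebesgue Q"
    using Q(1) by (subst measure_restrict_space) auto
  have "integral\<^sup>L (lebesgue_on Q) (\<lambda>x. H x - a) = integral\<^sup>L (lebesgue_on Q) H - measure lebesgue Q *\<^sub>R a"
    using H finite_measure.integrable_const[OF fin]
    by (subst Bochner_Integration.integral_diff) (auto simp: m[simplified] simp del: measure_completion)
  then show ?thesis
    using Q(2) by (simp add: average_def scaleR_diff_right)
qed

lemma norm_average_diff_le: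
  fixes H :: "'a::euclidean_space \<Rightarrow> 'b::euclidean_space"
  assumes Q: "Q \<in> lmeasurable" "measure lebesgue Q > 0" and H: "integrable (lebesgue_on Q) H"
  shows "norm (average Q H - a) \<le> average Q (\<lambda>x. norm (H x - a))"
proof -
  have "average Q H - a = (1 / measure lebesgue Q) *\<^sub>R integral\<^sup>L (lebesgue_on Q) (\<lambda>x. H x - a)"
    using average_diff_const[OF Q H, of a] by (simp add: average_def)
  also have "norm \<dots> \<le> (1 / measure lebesgue Q) * integral\<^sup>L (lebesgue_on Q) (\<lambda>x. norm (H x - a))"
    using Q(2) integral_norm_bound[of "lebesgue_on Q" "\<lambda>x. H x - a"] by (simp add: divide_right_mono)
  finally show ?thesis by (simp add: average_def)
qed

section \<open>Comparison of averages over inner cubes\<close>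

context
  fixes \<Omega> :: "(real ^ 'n) set" and M :: real and H :: "real ^ 'n \<Rightarrow> 'b::euclidean_space"
  assumes H: "H \<in> bmo_ball \<Omega> M" and M: "M > 0"
begin

lemma bmo_ball_integrable:
  assumes "Q \<in> inner_cubes \<Omega>"
  shows "integrable (lebesgue_on Q) H"
proof -
  obtain C where C: "compact C" "C \<subseteq> \<Omega>" "Q \<subseteq> C" using assms by (auto simp: inner_cube_iff)
  then have "integrable (lebesgue_on C) H" using H by (auto simp: bmo_ball_def L1_loc_def)
  then show ?thesis
    using C assms by (meson fmeasurableD inner_cube_lmeasurable integrable_lebesgue_on_subset lmeasurable_compact)
qed

lemma bmo_ball_integrable_norm_diff:
  assumes "Q \<in> inner_cubes \<Omega>"
  shows "integrable (lebesgue_on Q) (\<lambda>x. norm (H x - a))"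
proof -
  have "finite_measure (lebesgue_on Q)"
    using inner_cube_lmeasurable[OF assms] by (rule finite_measure_lebesgue_on)
  then show ?thesis
    using bmo_ball_integrable[OF assms]
    by (intro integrable_norm Bochner_Integration.integrable_diff finite_measure.integrable_const)
qed

lemma bmo_ball_oscillation:
  assumes "Q \<in> inner_cubes \<Omega>"
  shows "average Q (\<lambda>x. norm (H x - average Q H)) \<le> M"
proof -
  have "ennreal (average Q (\<lambda>x. norm (H x - average Q H))) \<le> bmo_seminorm \<Omega> H"
    unfolding bmo_seminorm_def using assms by (intro SUP_upper)
  also have "\<dots> \<le> ennreal M" using H by (simp add: bmo_ball_def)
  finally show ?thesis using M by (subst (asm) ennreal_le_iff) auto
qed

lemma bmo_ball_oscillation_integral:
  assumes "Q \<in> inner_cubes \<Omega>"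
  shows "integral\<^sup>L (lebesgue_on Q) (\<lambda>x. norm (H x - average Q H)) \<le> M * measure lebesgue Q"
  using bmo_ball_oscillation[OF assms] inner_cube_measure_pos[OF assms]
  unfolding average_def[of Q "\<lambda>x. norm (H x - average Q H)"] by (simp add: field_simps)

text \<open>The mean over Q of the distance of H to its average over Q' is at most the ratio of the
  volumes times the corresponding mean over Q'.\<close>

lemma average_nested:
  assumes Q: "Q \<in> inner_cubes \<Omega>" "Q' \<in> inner_cubes \<Omega>" "Q \<subseteq> Q'"
  shows "norm (average Q H - average Q' H) \<le> M * measure lebesgue Q' / measure lebesgue Q"
proof -
  note lm = inner_cube_lmeasurable[OF Q(1)] inner_cube_lmeasurable[OF Q(2)]
  note pos = inner_cube_measure_pos[OF Q(1)]
  have "norm (average Q H - average Q' H) \<le> average Q (\<lambda>x. norm (H x - average Q' H))"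
    by (intro norm_average_diff_le lm pos bmo_ball_integrable Q)
  also have "\<dots> = integral\<^sup>L (lebesgue_on Q) (\<lambda>x. norm (H x - average Q' H)) / measure lebesgue Q"
    by (simp add: average_def)
  also have "\<dots> \<le> integral\<^sup>L (lebesgue_on Q') (\<lambda>x. norm (H x - average Q' H)) / measure lebesgue Q"
    using lm pos Q by (intro divide_right_mono integral_lebesgue_on_mono_set bmo_ball_integrable_norm_diff) auto
  also have "\<dots> \<le> M * measure lebesgue Q' / measure lebesgue Q"
    using pos by (intro divide_right_mono bmo_ball_oscillation_integral Q) auto
  finally show ?thesis .
qed

lemma oscillation_Chebyshev:
  assumes Q: "Q \<in> inner_cubes \<Omega>" and "\<beta> > 0"
  shows "{z \<in> Q. \<beta> \<le> norm (H z - average Q H)} \<in> lmeasurable"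
    and "measure lebesgue {z \<in> Q. \<beta> \<le> norm (H z - average Q H)} \<le> M / \<beta> * measure lebesgue Q"
proof -
  note lm = inner_cube_lmeasurable[OF Q]
  let ?u = "\<lambda>z. norm (H z - average Q H)"
  have int: "integrable (lebesgue_on Q) ?u" by (rule bmo_ball_integrable_norm_diff[OF Q])
  have "{z \<in> space (lebesgue_on Q). \<beta> \<le> ?u z} \<in> sets (lebesgue_on Q)"
    using borel_measurable_integrable[OF int] by measurable
  then show "{z \<in> Q. \<beta> \<le> ?u z} \<in> lmeasurable"
    by (rule lmeasurable_Collect[OF lm])
  have "measure (lebesgue_on Q) {z \<in> space (lebesgue_on Q). \<beta> \<le> ?u z} \<le> integral\<^sup>L (lebesgue_on Q) ?u / \<beta>"
    using integral_Markov_inequality_measure[OF int sets.empty_sets _ \<open>\<beta> > 0\<close>] by simp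
  also have "\<dots> \<le> M * measure lebesgue Q / \<beta>"
    using \<open>\<beta> > 0\<close> by (intro divide_right_mono bmo_ball_oscillation_integral Q) auto
  finally show "measure lebesgue {z \<in> Q. \<beta> \<le> ?u z} \<le> M / \<beta> * measure lebesgue Q"
    using lm by (simp add: measure_restrict_space)
qed

text \<open>For a larger average, Q would be covered by the superlevel set, at most one half of Q,
  and the set where H deviates from its average by 3 M or more, at most one third of Q.\<close>

lemma average_le_of_small_superlevel:
  assumes Q: "Q \<in> inner_cubes \<Omega>"
    and half: "measure lebesgue {z \<in> Q. \<theta> < norm (H z)} \<le> measure lebesgue Q / 2"
  shows "norm (average Q H) \<le> \<theta> + 3 * M"
proof (rule ccontr)
  assume big: "\<not> norm (average Q H) \<le> \<theta> + 3 * M"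
  note lm = inner_cube_lmeasurable[OF Q]
  let ?A = "{z \<in> Q. \<theta> < norm (H z)}" and ?B = "{z \<in> Q. 3 * M \<le> norm (H z - average Q H)}"
  have Hm: "H \<in> borel_measurable (lebesgue_on Q)"
    using bmo_ball_integrable[OF Q] by auto
  have "{z \<in> space (lebesgue_on Q). \<theta> < norm (H z)} \<in> sets (lebesgue_on Q)"
    using Hm by measurable
  then have A: "?A \<in> lmeasurable"
    by (rule lmeasurable_Collect[OF lm])
  have B: "?B \<in> lmeasurable" "measure lebesgue ?B \<le> 1 / 3 * measure lebesgue Q"
    using oscillation_Chebyshev[OF Q, of "3 * M"] M by auto
  have "Q \<subseteq> ?A \<union> ?B"
  proof
    fix z assume "z \<in> Q"
    have "norm (average Q H) \<le> norm (H z) + norm (H z - average Q H)"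
      by (metis norm_minus_commute norm_triangle_sub add.commute)
    then show "z \<in> ?A \<union> ?B" using \<open>z \<in> Q\<close> big by auto
  qed
  then have "measure lebesgue Q \<le> measure lebesgue (?A \<union> ?B)"
    using A B lm by (intro measure_mono_fmeasurable) auto
  also have "\<dots> \<le> measure lebesgue ?A + measure lebesgue ?B"
    using A B by (intro measure_Un_le) auto
  finally show False using half B(2) inner_cube_measure_pos[OF Q] by linarith
qed

text \<open>A chain of cubes with centres at mutual distance at most t: the cube of half side t / 2
  at the midpoint of two neighbours lies in both, and each of the two comparisons costs 2^n
  M.\<close>

lemma average_segment:
  fixes v w :: "real ^ 'n"
  assumes t: "t > 0" and inner: "\<And>x. x \<in> closed_segment v w \<Longrightarrow> cube x t \<in> inner_cubes \<Omega>"
  shows "norm (average (cube v t) H - average (cube w t) H) \<le> (norm (v - w) / t + 2) * (2 * 2 ^ CARD('n) * M)"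
proof -
  \<comment> \<open>Rounding up makes the spacing at most t, and the summand 1 keeps m positive when
    v = w. Together they account for the 2 in the bound.\<close>
  define m where "m = nat \<lceil>norm (v - w) / t\<rceil> + 1"
  define p where "p j = v + (real j / real m) *\<^sub>R (w - v)" for j
  have m: "real m > 0" "norm (v - w) / t \<le> real m" unfolding m_def by (simp, linarith)
  have seg: "p j \<in> closed_segment v w" if "j \<le> m" for j
    unfolding closed_segment_image_interval using that m
    by (intro image_eqI[of _ _ "real j / real m"]) (auto simp: p_def algebra_simps)
  have step: "norm (average (cube (p j) t) H - average (cube (p (Suc j)) t) H) \<le> 2 * 2 ^ CARD('n) * M"
    if j: "j < m" for j
  proof -
    let ?c = "(1 / 2) *\<^sub>R (p j + p (Suc j))"
    have "norm (p (Suc j) - p j) = norm (v - w) / real m"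
    proof -
      have "p (Suc j) - p j = (1 / real m) *\<^sub>R (w - v)"
        by (simp add: p_def add_divide_distrib algebra_simps)
      then show ?thesis by (simp add: norm_minus_commute)
    qed
    also have "\<dots> \<le> t" using m t by (simp add: field_simps)
    finally have d: "norm (p (Suc j) - p j) \<le> t" .
    have "?c - p j = (1 / 2) *\<^sub>R (p (Suc j) - p j)" "?c - p (Suc j) = - ((1 / 2) *\<^sub>R (p (Suc j) - p j))"
      by (simp_all add: algebra_simps vec_eq_iff)
    then have cn: "norm (?c - p j) \<le> t / 2" "norm (?c - p (Suc j)) \<le> t / 2"
      using d by simp_all
    have sub: "cube ?c (t / 2) \<subseteq> cube (p j) t" "cube ?c (t / 2) \<subseteq> cube (p (Suc j)) t"
      using cn by (auto intro!: cube_mono)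
    have in1: "cube (p j) t \<in> inner_cubes \<Omega>" "cube (p (Suc j)) t \<in> inner_cubes \<Omega>"
      using inner seg j by auto
    have in2: "cube ?c (t / 2) \<in> inner_cubes \<Omega>"
      using inner_cube_subset[OF in1(1) sub(1)] t by simp
    have q: "M * (2 * t) ^ CARD('n) / (2 * (t / 2)) ^ CARD('n) = 2 ^ CARD('n) * M"
      using t by (simp add: power_mult_distrib)
    have "norm (average (cube ?c (t / 2)) H - average (cube (p j) t) H) \<le> 2 ^ CARD('n) * M"
      using average_nested[OF in2 in1(1) sub(1)] t q by (simp only: measure_cube)
    moreover have "norm (average (cube ?c (t / 2)) H - average (cube (p (Suc j)) t) H) \<le> 2 ^ CARD('n) * M"
      using average_nested[OF in2 in1(2) sub(2)] t q by (simp only: measure_cube)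
    ultimately show ?thesis
      using norm_triangle_ineq4[of "average (cube ?c (t / 2)) H - average (cube (p (Suc j)) t) H"
          "average (cube ?c (t / 2)) H - average (cube (p j) t) H"] by simp
  qed
  have "norm (average (cube (p 0) t) H - average (cube (p j) t) H) \<le> real j * (2 * 2 ^ CARD('n) * M)"
    if "j \<le> m" for j
    using that
  proof (induction j)
    case (Suc j)
    have "norm (average (cube (p 0) t) H - average (cube (p (Suc j)) t) H)
       \<le> norm (average (cube (p 0) t) H - average (cube (p j) t) H)
        + norm (average (cube (p j) t) H - average (cube (p (Suc j)) t) H)"
      using norm_triangle_ineq[of "average (cube (p 0) t) H - average (cube (p j) t) H"
          "average (cube (p j) t) H - average (cube (p (Suc j)) t) H"] by simp
    also have "\<dots> \<le> real j * (2 * 2 ^ CARD('n) * M) + 2 * 2 ^ CARD('n) * M"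
      using Suc step[of j] by (intro add_mono) auto
    finally show ?case by (simp add: algebra_simps)
  qed simp
  from this[of m] have "norm (average (cube v t) H - average (cube w t) H) \<le> real m * (2 * 2 ^ CARD('n) * M)"
    using m by (simp add: p_def)
  moreover have "real m \<le> norm (v - w) / t + 2"
  proof -
    have "0 \<le> norm (v - w) / t" using t by simp
    then show ?thesis unfolding m_def by linarith
  qed
  ultimately show ?thesis
    using M by (meson mult_right_mono order_trans mult_nonneg_nonneg zero_le_numeral zero_le_power less_imp_le)
qed

end

section \<open>Oscillation near a Lipschitz graph\<close>

lemma L1_loc_superlevel:
  fixes H :: "'a::euclidean_space \<Rightarrow> 'b::euclidean_space"
  assumes "H \<in> L1_loc \<Omega>" "open \<Omega>"
  shows "{z \<in> \<Omega>. \<theta> < norm (H z - a)} \<in> sets lebesgue"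
proof -
  have "H \<in> borel_measurable (lebesgue_on \<Omega>)" using assms by (simp add: L1_loc_def)
  then have "{z \<in> space (lebesgue_on \<Omega>). \<theta> < norm (H z - a)} \<in> sets (lebesgue_on \<Omega>)"
    by measurable
  then show ?thesis using assms(2) by (simp add: sets_restrict_space_iff)
qed

text \<open>The height h stands for x \<bullet> e minus the boundary function at the projection of
  x; only its Lipschitz bound, its unit growth along e and its sign near p are kept. Interior points
  admit such a chart too, so they need no separate treatment. The normalisation L \<ge> 1 gives s
  \<le> L s.\<close>

locale graph_chart =
  fixes \<Omega> :: "(real ^ 'n) set" and e :: "real ^ 'n" and h :: "real ^ 'n \<Rightarrow> real"
    and L \<rho> :: real and p :: "real ^ 'n"
  assumes open_domain: "open \<Omega>" and unit: "norm e = 1" and L: "L \<ge> 1" and \<rho>: "\<rho> > 0"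
    and lip: "\<bar>h x - h y\<bar> \<le> L * norm (x - y)"
    and height: "h (x + t *\<^sub>R e) = h x + t"
    and above: "x \<in> cball p \<rho> \<Longrightarrow> x \<in> \<Omega> \<longleftrightarrow> h x > 0"
begin

text \<open>The side of \<^term>\<open>cube (y + s *\<^sub>R e) (ratio * s)\<close> is so small that, by the slope bound
  \<^term>\<open>L\<close>, the cube stays above the graph for every \<^term>\<open>y\<close> above the graph.\<close>

definition ratio :: real where "ratio = 1 / (4 * L * real CARD('n))"

definition tower :: "real ^ 'n \<Rightarrow> real \<Rightarrow> (real ^ 'n) set" where
  "tower y s = cube (y + s *\<^sub>R e) (ratio * s)"

lemma ratio_pos: "ratio > 0"
  using L by (simp add: ratio_def)

lemma card_ratio: "real CARD('n) * ratio = 1 / (4 * L)"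
  by (simp add: ratio_def)

lemma ratio_le: "ratio \<le> 1 / 4"
proof -
  have "1 * 1 \<le> L * real CARD('n)" using L by (intro mult_mono) auto
  then show ?thesis by (simp add: ratio_def divide_simps)
qed

lemma continuous_height: "continuous_on A h"
proof -
  have "L-lipschitz_on A h"
    using L lip by (intro lipschitz_onI) (auto simp: dist_norm)
  then show ?thesis by (rule lipschitz_on_continuous_on)
qed

text \<open>The cube lies within distance \<tau> / (4 L) of v, where the height drops by at most
  \<tau> / 4. The closed ball of that radius is the compact set required of an inner cube.\<close>

lemma inner_cube_at_height:
  assumes "h v \<ge> \<tau>" "\<tau> > 0" "cball v \<tau> \<subseteq> cball p \<rho>"
  shows "cube v (ratio * \<tau>) \<in> inner_cubes \<Omega>"
proof (rule inner_cubeI)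
  show "ratio * \<tau> > 0" using ratio_pos assms by simp
  show "cball v (real CARD('n) * (ratio * \<tau>)) \<subseteq> \<Omega>"
  proof
    fix z assume "z \<in> cball v (real CARD('n) * (ratio * \<tau>))"
    moreover have "real CARD('n) * (ratio * \<tau>) = \<tau> / (4 * L)"
      using card_ratio by (metis mult.assoc mult.left_commute mult_1 times_divide_eq_left)
    ultimately have d: "norm (v - z) \<le> \<tau> / (4 * L)" by (simp add: dist_norm)
    also have "\<tau> / (4 * L) \<le> \<tau>" using L assms(2) by (simp add: field_simps)
    finally have zb: "z \<in> cball p \<rho>" using assms(3) by (auto simp: dist_norm)
    have "L * norm (v - z) \<le> \<tau> / 4" using d L by (simp add: field_simps)
    then have "h z > 0" using lip[of v z] assms(1,2) by linarith
    then show "z \<in> \<Omega>" using above[OF zb] by simp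
  qed
qed

lemma height_pos: "y \<in> \<Omega> \<Longrightarrow> y \<in> cball p \<rho> \<Longrightarrow> h y > 0"
  using above by blast

lemma cball_subset_chart:
  assumes "y \<in> ball p (\<rho> / 2)" "norm (v - y) + s \<le> \<rho> / 2"
  shows "cball v s \<subseteq> cball p \<rho>"
proof
  fix z assume "z \<in> cball v s"
  then have "norm (z - v) \<le> s" "norm (y - p) < \<rho> / 2" using assms(1) by (auto simp: dist_norm norm_minus_commute)
  moreover have "norm (z - p) \<le> norm (z - v) + norm (v - y) + norm (y - p)"
    using norm_triangle_ineq[of "z - v" "v - y"] norm_triangle_ineq[of "z - y" "y - p"] by simp
  ultimately show "z \<in> cball p \<rho>" using assms(2) by (simp add: dist_norm norm_minus_commute)
qed

text \<open>The shift by s along e lifts y above height s. The bound on s is generous, because the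
  chains of cubes used later run up to 30 L s away from y and must stay in the chart as
  well.\<close>

lemma tower_inner:
  assumes y: "y \<in> \<Omega>" "y \<in> ball p (\<rho> / 2)" and s: "0 < s" "100 * L * s \<le> \<rho> / 2"
  shows "tower y s \<in> inner_cubes \<Omega>"
  unfolding tower_def
proof (rule inner_cube_at_height)
  have "1 * s \<le> L * s" using L s by (intro mult_right_mono) auto
  then have s2: "2 * s \<le> \<rho> / 2" using s by linarith
  show "cball (y + s *\<^sub>R e) s \<subseteq> cball p \<rho>"
    by (rule cball_subset_chart[OF y(2)]) (use s s2 unit in simp)
  have "y \<in> cball p \<rho>" using y(2) \<rho> by auto
  then show "s \<le> h (y + s *\<^sub>R e)" using height_pos[OF y(1)] by (simp add: height)
qed (use s in auto)

lemma tower_subset_cball: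
  assumes "s > 0"
  shows "tower y s \<subseteq> cball y (2 * s)"
proof
  fix z assume "z \<in> tower y s"
  then have "z \<in> cball (y + s *\<^sub>R e) (real CARD('n) * (ratio * s))"
    unfolding tower_def using cube_subset_cball by blast
  moreover have "real CARD('n) * (ratio * s) = s / (4 * L)"
    using card_ratio by (metis mult.assoc mult.left_commute mult_1 times_divide_eq_left)
  moreover have "s / (4 * L) \<le> s" using L assms by (simp add: field_simps)
  ultimately have "norm (z - (y + s *\<^sub>R e)) \<le> s" by (simp add: dist_norm norm_minus_commute)
  moreover have "norm (z - y) \<le> norm (z - (y + s *\<^sub>R e)) + norm (s *\<^sub>R e)"
    using norm_triangle_ineq[of "z - (y + s *\<^sub>R e)" "s *\<^sub>R e"] by simp
  ultimately show "z \<in> cball y (2 * s)" using assms unit by (simp add: dist_norm norm_minus_commute)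
qed

lemma measure_tower: "s > 0 \<Longrightarrow> measure lebesgue (tower y s) = (2 * ratio * s) ^ CARD('n)"
  unfolding tower_def using ratio_pos by (subst measure_cube) (auto simp: mult.assoc)

text \<open>The translates of the layer by multiples of its thickness in direction \<^term>\<open>e\<close> are disjoint.\<close>

lemma layer_measure:
  assumes y: "y \<in> ball p (\<rho> / 2)" and s: "0 < s" "100 * L * s \<le> \<rho> / 2" and J: "J > 0"
  shows "real J * measure lebesgue {z \<in> \<Omega> \<inter> cball y (10 * s). h z < s / real J}
           \<le> measure lebesgue (cball y (11 * s))"
    and "{z \<in> \<Omega> \<inter> cball y (10 * s). h z < s / real J} \<in> lmeasurable"
proof -
  let ?A = "{z \<in> \<Omega> \<inter> cball y (10 * s). h z < s / real J}"
  define T where "T i = (+) ((real i * (s / real J)) *\<^sub>R e) ` ?A" for i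
  have "{z. h z < s / real J} \<in> sets borel"
    using continuous_height[of UNIV] by (intro borel_open open_Collect_less) (auto intro: continuous_intros)
  then have "\<Omega> \<inter> {z. h z < s / real J} \<in> sets lebesgue"
    using open_domain by auto
  then have "cball y (10 * s) \<inter> (\<Omega> \<inter> {z. h z < s / real J}) \<in> lmeasurable"
    by (intro fmeasurable_Int_fmeasurable) auto
  moreover have "cball y (10 * s) \<inter> (\<Omega> \<inter> {z. h z < s / real J}) = ?A" by auto
  ultimately show A: "?A \<in> lmeasurable" by simp
  have T: "T i \<in> lmeasurable" "measure lebesgue (T i) = measure lebesgue ?A" for i
    unfolding T_def using A by (simp_all only: measurable_translation measure_translation)
  have "1 * s \<le> L * s" using L s by (intro mult_right_mono) auto
  then have s2: "10 * s \<le> \<rho> / 2" using s by linarith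
  \<comment> \<open>The chart gives h > 0 on the layer, and h grows by exactly the length of the
    shift, so each \<open>T i\<close> occupies a height band of its own.\<close>
  have range: "real i * (s / real J) < h z \<and> h z < (real i + 1) * (s / real J)" if zT: "z \<in> T i" for i z
  proof -
    obtain x where x: "x \<in> ?A" "z = x + (real i * (s / real J)) *\<^sub>R e"
      using zT unfolding T_def by (metis (no_types, lifting) add.commute imageE)
    have "cball y (10 * s) \<subseteq> cball p \<rho>"
      by (rule cball_subset_chart[OF y]) (use s2 in simp)
    then have "h x > 0" using x(1) height_pos by blast
    moreover have "h x < s / real J" using x(1) by simp
    ultimately show ?thesis unfolding x(2) height by (simp only: distrib_right) linarith
  qed
  have disj: "disjoint_family_on T {..<J}"
    unfolding disjoint_family_on_def
  proof (intro ballI impI)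
    fix i j :: nat assume "i \<noteq> j"
    have "\<not> (z \<in> T i \<and> z \<in> T j)" for z
    proof
      assume z: "z \<in> T i \<and> z \<in> T j"
      have pos: "s / real J > 0" using s J by simp
      have "real i * (s / real J) < (real j + 1) * (s / real J)" "real j * (s / real J) < (real i + 1) * (s / real J)"
        using range[of z i] range[of z j] z by linarith+
      then have "real i < real j + 1" "real j < real i + 1"
        using pos by (metis mult_right_less_imp_less less_imp_le)+
      then show False using \<open>i \<noteq> j\<close> by linarith
    qed
    then show "T i \<inter> T j = {}" by auto
  qed
  have sub: "T i \<subseteq> cball y (11 * s)" if "i < J" for i
  proof
    fix z assume "z \<in> T i"
    then obtain x where x: "x \<in> ?A" "z = x + (real i * (s / real J)) *\<^sub>R e"
      unfolding T_def by (metis (no_types, lifting) add.commute imageE)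
    have "real i * (s / real J) \<le> s" using that s J by (simp add: field_simps)
    then have "norm (z - x) \<le> s" using x unit s by simp
    moreover have "norm (x - y) \<le> 10 * s" using x by (simp add: dist_norm norm_minus_commute)
    moreover have "norm (z - y) \<le> norm (z - x) + norm (x - y)"
      using norm_triangle_ineq[of "z - x" "x - y"] by simp
    ultimately show "z \<in> cball y (11 * s)" by (simp add: dist_norm norm_minus_commute)
  qed
  have "real J * measure lebesgue ?A = (\<Sum>i<J. measure lebesgue (T i))" by (simp only: T) simp
  also have "\<dots> = measure lebesgue (\<Union>i<J. T i)"
    using T(1) fmeasurableD2[OF T(1)] disj by (subst measure_finite_Union) auto
  also have "\<dots> \<le> measure lebesgue (cball y (11 * s))"
    using sub T(1) by (intro measure_mono_fmeasurable) auto
  finally show "real J * measure lebesgue ?A \<le> measure lebesgue (cball y (11 * s))" .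
qed

text \<open>The small cube at z is moved up by T, across to y + T e and down to y + s e, and is then
  compared with the concentric tower. The three legs have lengths (10 L + 1) s, 10 s and at most (10
  L + 1) s, which yields 20 L + 12; their additive terms 2 yield 6; the last comparison costs the
  volume ratio \<open>real J ^ CARD('n)\<close>.\<close>

lemma average_at_height:
  fixes H :: "real ^ 'n \<Rightarrow> 'b::euclidean_space"
  assumes H: "H \<in> bmo_ball \<Omega> M" "M > 0"
    and y: "y \<in> \<Omega>" "y \<in> ball p (\<rho> / 2)" and s: "0 < s" "100 * L * s \<le> \<rho> / 2" and J: "J > 0"
    and z: "z \<in> cball y (10 * s)" "h z \<ge> s / real J"
  shows "norm (average (cube z (ratio * (s / real J))) H - average (tower y s) H)
     \<le> ((20 * L + 12) * real J / ratio + 6) * (2 * 2 ^ CARD('n) * M) + M * real J ^ CARD('n)"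
    and "cube z (ratio * (s / real J)) \<in> inner_cubes \<Omega>"
proof -
  define \<tau> where "\<tau> = s / real J"
  \<comment> \<open>On the crossing of length at most 10 s the height drops by at most 10 L s; the
    additional s keeps it above s \<ge> \<tau>.\<close>
  define T where "T = (10 * L + 1) * s"
  define D where "D = 2 * 2 ^ CARD('n) * M"
  \<comment> \<open>Converts lengths in units of s into lengths in units of the half side
    \<open>ratio * \<tau>\<close>.\<close>
  define q where "q = real J / ratio"
  let ?t = "ratio * \<tau>"
  have \<tau>: "0 < \<tau>" "\<tau> \<le> s" using s J by (auto simp: \<tau>_def field_simps)
  have sL: "s \<le> L * s" using L s by simp
  have nz: "norm (z - y) \<le> 10 * s" using z by (simp add: dist_norm norm_minus_commute)
  have "T = 10 * (L * s) + s" by (simp add: T_def algebra_simps)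
  then have T: "s \<le> T" "T \<le> 11 * (L * s)" "T > 0" using sL s by linarith+
  have yp: "h y > 0" using y \<rho> by (intro height_pos) auto
  have inner: "cube v ?t \<in> inner_cubes \<Omega>" if "h v \<ge> \<tau>" "norm (v - y) \<le> 30 * (L * s)" for v
    using cball_subset_chart[OF y(2), of v \<tau>] that \<tau> sL s
    by (intro inner_cube_at_height) auto
  show "cube z (ratio * (s / real J)) \<in> inner_cubes \<Omega>"
    using inner[of z] z(2) nz sL s unfolding \<tau>_def by linarith
  have len: "x / ?t = x / s * q" for x using J s ratio_pos by (simp add: \<tau>_def q_def)
  have t: "?t > 0" using ratio_pos \<tau> by simp
  have D0: "D \<ge> 0" using H by (simp add: D_def)
  have q0: "q \<ge> 0" using ratio_pos by (simp add: q_def)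
  have segment: "norm (average (cube u ?t) H - average (cube v ?t) H) \<le> (a * q + 2) * D"
    if "norm (u - v) \<le> a * s"
      and "\<And>x. x \<in> closed_segment u v \<Longrightarrow> h x \<ge> \<tau> \<and> norm (x - y) \<le> 30 * (L * s)" for u v a
  proof -
    have "norm (average (cube u ?t) H - average (cube v ?t) H) \<le> (norm (u - v) / ?t + 2) * D"
      unfolding D_def by (rule average_segment[OF H t]) (use inner that in blast)
    also have "norm (u - v) / ?t \<le> a * q"
      unfolding len using that(1) s q0 by (intro mult_right_mono) (auto simp: field_simps)
    finally show ?thesis using D0 by (simp add: mult_right_mono)
  qed
  have vertical: "\<exists>t. x = w + t *\<^sub>R e \<and> a \<le> t \<and> t \<le> b"
    if seg: "x \<in> closed_segment (w + a *\<^sub>R e) (w + b *\<^sub>R e)" and "a \<le> b" for x w a b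
  proof -
    obtain u where u: "0 \<le> u" "u \<le> 1" "x = (1 - u) *\<^sub>R (w + a *\<^sub>R e) + u *\<^sub>R (w + b *\<^sub>R e)"
      using seg by (auto simp: in_segment)
    have "x = w + (a + u * (b - a)) *\<^sub>R e" using u by (simp add: algebra_simps)
    moreover have "0 \<le> u * (b - a)" "u * (b - a) \<le> 1 * (b - a)"
      using u \<open>a \<le> b\<close> by (simp, intro mult_right_mono) auto
    ultimately show ?thesis by (intro exI[of _ "a + u * (b - a)"]) auto
  qed
  have 1: "norm (average (cube z ?t) H - average (cube (z + T *\<^sub>R e) ?t) H) \<le> ((10 * L + 1) * q + 2) * D"
  proof (rule segment)
    show "norm (z - (z + T *\<^sub>R e)) \<le> (10 * L + 1) * s" using unit T by (simp add: T_def)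
    fix x assume "x \<in> closed_segment z (z + T *\<^sub>R e)"
    then obtain t where t: "x = z + t *\<^sub>R e" "0 \<le> t" "t \<le> T"
      using vertical[of x z 0 T] T by auto
    have "norm (x - y) \<le> norm (z - y) + norm (t *\<^sub>R e)"
      unfolding t(1) using norm_triangle_ineq[of "z - y" "t *\<^sub>R e"] by (simp add: algebra_simps)
    then have "norm (x - y) \<le> 10 * s + t" using nz unit t(2) by simp
    moreover have "\<tau> \<le> h x" using t z by (simp add: height \<tau>_def)
    ultimately show "\<tau> \<le> h x \<and> norm (x - y) \<le> 30 * (L * s)"
      using t(3) T sL s by linarith
  qed
  have 2: "norm (average (cube (z + T *\<^sub>R e) ?t) H - average (cube (y + T *\<^sub>R e) ?t) H) \<le> (10 * q + 2) * D"
  proof (rule segment)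
    show "norm (z + T *\<^sub>R e - (y + T *\<^sub>R e)) \<le> 10 * s" using nz by simp
    fix x assume "x \<in> closed_segment (z + T *\<^sub>R e) (y + T *\<^sub>R e)"
    then obtain u where u: "0 \<le> u" "u \<le> 1" "x = (1 - u) *\<^sub>R (z + T *\<^sub>R e) + u *\<^sub>R (y + T *\<^sub>R e)"
      by (auto simp: in_segment)
    have x: "x - (y + T *\<^sub>R e) = (1 - u) *\<^sub>R (z - y)" unfolding u(3) by (simp add: algebra_simps)
    have "norm (x - (y + T *\<^sub>R e)) = (1 - u) * norm (z - y)" unfolding x using u by simp
    also have "\<dots> \<le> 1 * (10 * s)" using u nz by (intro mult_mono) auto
    finally have nx: "norm (x - (y + T *\<^sub>R e)) \<le> 10 * s" by simp
    have "\<bar>h x - h (y + T *\<^sub>R e)\<bar> \<le> L * norm (x - (y + T *\<^sub>R e))" by (rule lip)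
    also have "\<dots> \<le> L * (10 * s)" using nx L by (intro mult_left_mono) auto
    finally have "h x \<ge> h y + T - 10 * L * s" by (simp add: height)
    then have "h x \<ge> \<tau>" using \<tau> yp by (simp add: T_def distrib_right)
    moreover have "norm (x - y) \<le> norm (x - (y + T *\<^sub>R e)) + norm (T *\<^sub>R e)"
      using norm_triangle_ineq[of "x - (y + T *\<^sub>R e)" "T *\<^sub>R e"] by simp
    moreover have "norm (T *\<^sub>R e) = T" using unit T by simp
    ultimately show "\<tau> \<le> h x \<and> norm (x - y) \<le> 30 * (L * s)"
      using nx T sL s by linarith
  qed
  have 3: "norm (average (cube (y + s *\<^sub>R e) ?t) H - average (cube (y + T *\<^sub>R e) ?t) H) \<le> ((10 * L + 1) * q + 2) * D"
  proof (rule segment)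
    have "y + s *\<^sub>R e - (y + T *\<^sub>R e) = - ((T - s) *\<^sub>R e)" by (simp add: algebra_simps)
    then have "norm (y + s *\<^sub>R e - (y + T *\<^sub>R e)) = T - s" using unit T by simp
    then show "norm (y + s *\<^sub>R e - (y + T *\<^sub>R e)) \<le> (10 * L + 1) * s"
      using s by (simp add: T_def)
    fix x assume "x \<in> closed_segment (y + s *\<^sub>R e) (y + T *\<^sub>R e)"
    then obtain t where t: "x = y + t *\<^sub>R e" "s \<le> t" "t \<le> T"
      using vertical[of x y s T] T by auto
    then show "\<tau> \<le> h x \<and> norm (x - y) \<le> 30 * (L * s)"
      using unit T sL s \<tau> yp by (auto simp: height)
  qed
  have 4: "norm (average (cube (y + s *\<^sub>R e) ?t) H - average (tower y s) H) \<le> M * real J ^ CARD('n)"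
  proof -
    have in1: "cube (y + s *\<^sub>R e) ?t \<in> inner_cubes \<Omega>"
      using inner[of "y + s *\<^sub>R e"] \<tau> yp s sL unit by (simp add: height)
    have sub: "cube (y + s *\<^sub>R e) ?t \<subseteq> tower y s"
      unfolding tower_def using \<tau> ratio_pos by (intro cube_mono) auto
    have "norm (average (cube (y + s *\<^sub>R e) ?t) H - average (tower y s) H)
        \<le> M * measure lebesgue (tower y s) / measure lebesgue (cube (y + s *\<^sub>R e) ?t)"
      by (rule average_nested[OF H in1 tower_inner[OF y s] sub])
    also have "measure lebesgue (tower y s) = (2 * ratio * s) ^ CARD('n)"
      using s(1) by (rule measure_tower)
    also have "measure lebesgue (cube (y + s *\<^sub>R e) ?t) = (2 * ratio * \<tau>) ^ CARD('n)"
      using t by (subst measure_cube) (auto simp: mult.assoc)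
    also have "M * (2 * ratio * s) ^ CARD('n) / (2 * ratio * \<tau>) ^ CARD('n)
        = M * ((2 * ratio * s) / (2 * ratio * \<tau>)) ^ CARD('n)"
      by (simp only: power_divide times_divide_eq_right)
    also have "(2 * ratio * s) / (2 * ratio * \<tau>) = real J"
      using s J ratio_pos by (simp add: \<tau>_def)
    finally show ?thesis .
  qed
  have tri: "norm (a - d) \<le> norm (a - b) + norm (b - c) + norm (f - c) + norm (f - d)"
    for a b c d f :: 'b
    using norm_triangle_ineq[of "a - b" "b - c"] norm_triangle_ineq4[of "a - c" "f - c"]
      norm_triangle_ineq[of "a - f" "f - d"] by simp
  have "norm (average (cube z ?t) H - average (tower y s) H)
      \<le> ((10 * L + 1) * q + 2) * D + (10 * q + 2) * D + ((10 * L + 1) * q + 2) * D + M * real J ^ CARD('n)"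
    using tri[of "average (cube z ?t) H" "average (tower y s) H" "average (cube (z + T *\<^sub>R e) ?t) H"
        "average (cube (y + T *\<^sub>R e) ?t) H" "average (cube (y + s *\<^sub>R e) ?t) H"] 1 2 3 4 by linarith
  also have "\<dots> = ((20 * L + 12) * q + 6) * D + M * real J ^ CARD('n)"
    by (simp add: algebra_simps)
  finally show "norm (average (cube z (ratio * (s / real J))) H - average (tower y s) H)
     \<le> ((20 * L + 12) * real J / ratio + 6) * (2 * 2 ^ CARD('n) * M) + M * real J ^ CARD('n)"
    by (simp add: \<tau>_def q_def D_def)
qed

text \<open>One half of \<epsilon> pays for the layer below height s / J, the other for the points
  above it at which H is far from the average over a small cube nearby. Those averages differ from
  that over the tower by at most K, so K + \<beta> works for all H, y and s at once.\<close>

lemma oscillation_on_balls: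
  assumes "\<epsilon> > 0" "M > 0"
  shows "\<exists>B>0. \<forall>H :: real ^ 'n \<Rightarrow> 'b::euclidean_space. H \<in> bmo_ball \<Omega> M \<longrightarrow>
    (\<forall>y s. y \<in> \<Omega> \<longrightarrow> y \<in> ball p (\<rho> / 2) \<longrightarrow> 0 < s \<longrightarrow> 100 * L * s \<le> \<rho> / 2 \<longrightarrow>
      measure lebesgue {z \<in> \<Omega> \<inter> cball y (10 * s). B < norm (H z - average (tower y s) H)}
        \<le> \<epsilon> * s ^ CARD('n))"
proof -
  define n where "n = CARD('n)"
  define V where "V = measure lebesgue (ball (0 :: real ^ 'n) 1)"
  have V: "V > 0" by (simp add: V_def content_ball_pos)
  have ball: "measure lebesgue (cball x r) = r ^ n * V" if "r \<ge> 0" for x :: "real ^ 'n" and r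
    using content_ball_conv_unit_ball[OF that, of x] by (simp add: content_cball_conv_ball V_def n_def)
  \<comment> \<open>Large enough that the volume of a ball of radius 11 s, divided by J, is at most
    \<epsilon> s^n / 2.\<close>
  define J where "J = nat \<lceil>2 * (11 ^ n * V) / \<epsilon>\<rceil> + 1"
  have J: "J > 0" "2 * (11 ^ n * V) / \<epsilon> \<le> real J" unfolding J_def by (simp, linarith)
  define K where "K = ((20 * L + 12) * real J / ratio + 6) * (2 * 2 ^ n * M) + M * real J ^ n"
  \<comment> \<open>The factor 12^n comes from comparing a cube of half side t with a ball of radius
    t / 6, and 11^n from the volume of the ball of radius 11 s; Chebyshev's factor M / \<beta> then
    leaves \<epsilon> / 2.\<close>
  define \<beta> where "\<beta> = 2 * M * 12 ^ n * 11 ^ n / \<epsilon>"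
  have \<beta>: "\<beta> > 0" using assms by (simp add: \<beta>_def)
  have K: "K > 0"
    unfolding K_def using L ratio_pos assms J by (intro add_pos_pos mult_pos_pos) (auto intro!: add_nonneg_pos)
  show ?thesis
  proof (intro exI[of _ "K + \<beta>"] conjI allI impI)
    show "K + \<beta> > 0" using K \<beta> by simp
    fix H :: "real ^ 'n \<Rightarrow> 'b" and y s
    assume H: "H \<in> bmo_ball \<Omega> M" and y: "y \<in> \<Omega>" "y \<in> ball p (\<rho> / 2)"
      and s: "0 < s" "100 * L * s \<le> \<rho> / 2"
    define A where "A = average (tower y s) H"
    define S where "S = {z \<in> \<Omega>. K + \<beta> < norm (H z - A)}"
    let ?low = "{z \<in> \<Omega> \<inter> cball y (10 * s). h z < s / real J}"
    let ?D = "S \<inter> cball y (10 * s) \<inter> {z. h z \<ge> s / real J}"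
    let ?t = "ratio * (s / real J)"
    have t: "?t > 0" "?t \<le> s"
    proof -
      show "?t > 0" using ratio_pos s J by simp
      have "ratio * (s / real J) \<le> 1 * s"
        using ratio_pos ratio_le s J by (intro mult_mono) (auto simp: field_simps)
      then show "?t \<le> s" by simp
    qed
    have Sm: "S \<in> sets lebesgue"
      unfolding S_def using H open_domain by (intro L1_loc_superlevel) (auto simp: bmo_ball_def)
    have "closed {z. h z \<ge> s / real J}"
      using continuous_height[of UNIV] by (intro closed_Collect_le) (auto intro: continuous_intros)
    then have "S \<inter> {z. h z \<ge> s / real J} \<in> sets lebesgue"
      using Sm by auto
    then have "cball y (10 * s) \<inter> (S \<inter> {z. h z \<ge> s / real J}) \<in> lmeasurable"
      by (intro fmeasurable_Int_fmeasurable) auto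
    then have Dm: "?D \<in> lmeasurable" by (simp add: Int_ac)
    have low: "measure lebesgue ?low \<le> \<epsilon> / 2 * s ^ n"
    proof -
      have "real J * measure lebesgue ?low \<le> (11 * s) ^ n * V"
        using layer_measure(1)[OF y(2) s J(1)] ball[of "11 * s" y] s by simp
      also have "\<dots> = (11 ^ n * V) * s ^ n" by (simp add: power_mult_distrib)
      also have "\<dots> \<le> (real J * \<epsilon> / 2) * s ^ n"
        using J(2) assms s by (intro mult_right_mono) (auto simp: field_simps)
      finally have "real J * measure lebesgue ?low \<le> real J * (\<epsilon> / 2 * s ^ n)" by simp
      then show ?thesis using J(1) by (simp only: mult_le_cancel_left_pos of_nat_0_less_iff)
    qed
    have high: "measure lebesgue ?D \<le> (M / \<beta> * 12 ^ n / V) * measure lebesgue (cball y (11 * s))"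
    proof (rule measure_le_by_density_on_balls)
      show "?D \<in> sets lebesgue" using Dm by auto
      show "0 \<le> M / \<beta> * 12 ^ n / V" using assms \<beta> V by simp
      fix z assume "z \<in> ?D - {}"
      then have z: "z \<in> cball y (10 * s)" "h z \<ge> s / real J" by auto
      \<comment> \<open>The fivefold ball has radius 5 t / 6 < t and so fits into the open cube at
        z.\<close>
      let ?r = "?t / 6"
      have avg: "norm (average (cube z ?t) H - A) \<le> K" and inner: "cube z ?t \<in> inner_cubes \<Omega>"
        using average_at_height[OF H assms(2) y s J(1) z] unfolding A_def K_def n_def by auto
      let ?C = "{w \<in> cube z ?t. \<beta> \<le> norm (H w - average (cube z ?t) H)}"
      have "?D \<inter> cball z (5 * ?r) \<subseteq> ?C"
      proof
        fix w assume w: "w \<in> ?D \<inter> cball z (5 * ?r)"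
        have "w \<in> cube z ?t" using cball_subset_cube[of "5 * ?r" ?t z] w t(1) by auto
        moreover have "K + \<beta> < norm (H w - A)" using w by (simp add: S_def)
        moreover have "norm (H w - A) \<le> norm (H w - average (cube z ?t) H) + norm (average (cube z ?t) H - A)"
          using norm_triangle_ineq[of "H w - average (cube z ?t) H" "average (cube z ?t) H - A"] by simp
        ultimately show "w \<in> ?C" using avg by simp
      qed
      moreover have C: "?C \<in> lmeasurable" "measure lebesgue ?C \<le> M / \<beta> * measure lebesgue (cube z ?t)"
        using oscillation_Chebyshev[OF H assms(2) inner \<beta>] by auto
      moreover have "?D \<inter> cball z (5 * ?r) \<in> sets lebesgue" using Dm by auto
      ultimately have "measure lebesgue (?D \<inter> cball z (5 * ?r)) \<le> M / \<beta> * measure lebesgue (cube z ?t)"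
        by (meson measure_mono_fmeasurable order_trans)
      also have "\<dots> = M / \<beta> * (2 * ?t) ^ n"
        using t(1) by (simp only: measure_cube less_imp_le n_def)
      also have "2 * ?t = 12 * ?r" by simp
      also have "M / \<beta> * (12 * ?r) ^ n = (M / \<beta> * 12 ^ n / V) * (?r ^ n * V)"
        using V by (simp only: power_mult_distrib) simp
      also have "?r ^ n * V = measure lebesgue (cball z ?r)"
        using t(1) by (intro ball[symmetric]) simp
      \<comment> \<open>As z is within 10 s of y and t / 6 \<le> s, the ball of radius 11 s contains
        every ball of the covering.\<close>
      also have "cball z ?r = cball y (11 * s) \<inter> cball z ?r"
      proof -
        have "cball z ?r \<subseteq> cball y (11 * s)"
          using z(1) t by (simp add: cball_subset_cball_iff dist_commute)
        then show ?thesis by auto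
      qed
      finally show "\<exists>r>0. r \<le> s \<and> measure lebesgue (?D \<inter> cball z (5 * r))
          \<le> (M / \<beta> * 12 ^ n / V) * measure lebesgue (cball y (11 * s) \<inter> cball z r)"
        using t by (intro exI[of _ ?r]) auto
    qed auto
    also have "\<dots> = \<epsilon> / 2 * s ^ n"
    proof -
      have "measure lebesgue (cball y (11 * s)) = (11 * s) ^ n * V" using s by (intro ball) simp
      then show ?thesis
        using V assms s by (simp only: \<beta>_def power_mult_distrib) (simp add: field_simps)
    qed
    finally have high: "measure lebesgue ?D \<le> \<epsilon> / 2 * s ^ n" .
    have "measure lebesgue {z \<in> \<Omega> \<inter> cball y (10 * s). K + \<beta> < norm (H z - average (tower y s) H)}
        \<le> measure lebesgue (?low \<union> ?D)"
    proof (rule measure_mono_fmeasurable)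
      show "{z \<in> \<Omega> \<inter> cball y (10 * s). K + \<beta> < norm (H z - average (tower y s) H)} \<subseteq> ?low \<union> ?D"
        by (auto simp: S_def A_def)
      have "{z \<in> \<Omega> \<inter> cball y (10 * s). K + \<beta> < norm (H z - average (tower y s) H)} = S \<inter> cball y (10 * s)"
        by (auto simp: S_def A_def)
      then show "{z \<in> \<Omega> \<inter> cball y (10 * s). K + \<beta> < norm (H z - average (tower y s) H)} \<in> sets lebesgue"
        using Sm by auto
      show "?low \<union> ?D \<in> lmeasurable"
        using layer_measure(2)[OF y(2) s J(1)] Dm by (rule fmeasurable.Un)
    qed
    also have "\<dots> \<le> measure lebesgue ?low + measure lebesgue ?D"
      using layer_measure(2)[OF y(2) s J(1)] Dm by (intro measure_Un_le) auto
    also have "\<dots> \<le> \<epsilon> * s ^ n" using low high by (simp add: field_simps)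
    finally show "measure lebesgue {z \<in> \<Omega> \<inter> cball y (10 * s). K + \<beta> < norm (H z - average (tower y s) H)}
        \<le> \<epsilon> * s ^ CARD('n)" by (simp add: n_def)
  qed
qed

section \<open>Stopping argument and good-lambda inequality in one chart\<close>

text \<open>A tower of scale s misses y but fills the fixed proportion ratio^n / V of the ball of
  radius 2 s around y. If E fills at most half of it at every dyadic scale, its density in these
  balls is at most 1 - ratio^n / (2 V), which almost every point of E excludes.\<close>

lemma negligible_sparse_towers:
  assumes E: "E \<in> lmeasurable" and s0: "s0 > 0"
  shows "negligible {y \<in> E. \<forall>j. measure lebesgue (E \<inter> tower y (s0 / 2 ^ j)) \<le> measure lebesgue (tower y (s0 / 2 ^ j)) / 2}"
    (is "negligible ?Z")
proof -
  define V where "V = measure lebesgue (ball (0 :: real ^ 'n) 1)"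
  have V: "V > 0" by (simp add: V_def content_ball_pos)
  have ball: "measure lebesgue (cball x r) = r ^ CARD('n) * V" if "r \<ge> 0" for x :: "real ^ 'n" and r
    using content_ball_conv_unit_ball[OF that, of x] by (simp add: content_cball_conv_ball V_def)
  define \<kappa> where "\<kappa> = min 1 (ratio ^ CARD('n) / (2 * V))"
  show ?thesis
  proof (rule negligible_low_density[OF E])
    show "0 < \<kappa>" "\<kappa> \<le> 1" using ratio_pos V by (auto simp: \<kappa>_def)
    fix y :: "real ^ 'n" and d :: real assume y: "y \<in> ?Z" and "0 < d"
    obtain j :: nat where j: "(1 / 2) ^ j < d / (2 * s0)"
      using real_arch_pow_inv[of "d / (2 * s0)" "1 / 2"] \<open>0 < d\<close> s0 by auto
    define s where "s = s0 / 2 ^ j"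
    have s: "s > 0" "2 * s < d" using s0 j by (auto simp: s_def power_one_over field_simps)
    note sub = tower_subset_cball[OF s(1), of y]
    have tm: "tower y s \<in> lmeasurable" by (simp add: tower_def)
    have "measure lebesgue (E \<inter> cball y (2 * s))
        \<le> measure lebesgue ((E \<inter> tower y s) \<union> (cball y (2 * s) - tower y s))"
    proof (rule measure_mono_fmeasurable)
      show "(E \<inter> tower y s) \<union> (cball y (2 * s) - tower y s) \<in> lmeasurable"
        using fmeasurable.Un[OF fmeasurable.Int[OF E tm] fmeasurable.Diff[OF lmeasurable_cball tm]] .
    qed (use E in auto)
    also have "\<dots> \<le> measure lebesgue (E \<inter> tower y s) + measure lebesgue (cball y (2 * s) - tower y s)"
      using E tm by (intro measure_Un_le) auto
    also have "measure lebesgue (cball y (2 * s) - tower y s) = measure lebesgue (cball y (2 * s)) - measure lebesgue (tower y s)"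
      using sub tm by (intro measurable_measure_Diff) auto
    also have "measure lebesgue (E \<inter> tower y s) \<le> measure lebesgue (tower y s) / 2"
      using y unfolding s_def by blast
    finally have "measure lebesgue (E \<inter> cball y (2 * s)) \<le> measure lebesgue (cball y (2 * s)) - measure lebesgue (tower y s) / 2"
      by linarith
    also have "\<dots> = (2 * s) ^ CARD('n) * V - (2 * s) ^ CARD('n) * V * (ratio ^ CARD('n) / (2 * V))"
    proof -
      have "measure lebesgue (cball y (2 * s)) = (2 * s) ^ CARD('n) * V" using s by (intro ball) simp
      moreover have "measure lebesgue (tower y s) / 2 = (2 * s) ^ CARD('n) * V * (ratio ^ CARD('n) / (2 * V))"
        unfolding measure_tower[OF s(1)] using V by (simp add: power_mult_distrib)
      ultimately show ?thesis by simp
    qed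
    also have "\<dots> \<le> (1 - \<kappa>) * ((2 * s) ^ CARD('n) * V)"
    proof -
      have "(2 * s) ^ CARD('n) * V * \<kappa> \<le> (2 * s) ^ CARD('n) * V * (ratio ^ CARD('n) / (2 * V))"
        using s V by (intro mult_left_mono) (auto simp: \<kappa>_def)
      then show ?thesis by (simp add: left_diff_distrib mult.commute)
    qed
    also have "(2 * s) ^ CARD('n) * V = measure lebesgue (cball y (2 * s))"
      using s by (intro ball[symmetric]) simp
    finally show "\<exists>\<rho>>0. \<rho> < d \<and> measure lebesgue (E \<inter> cball y \<rho>) \<le> (1 - \<kappa>) * measure lebesgue (cball y \<rho>)"
      using s by (intro exI[of _ "2 * s"]) auto
  qed auto
qed

text \<open>A point of the superlevel set is a density point, so some tower over it meets the superlevel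
  set in more than half of its volume. At the last scale before this first happens the average is
  still controlled by the level, and the oscillation estimate applies.\<close>

lemma good_lambda_chart:
  assumes M: "M > 0" and s0: "s0 > 0" "100 * L * s0 \<le> \<rho> / 2" and \<epsilon>: "\<epsilon> > 0" and bdd: "bounded \<Omega>" and \<delta>: "\<delta> \<le> \<rho> / 2"
  shows "\<exists>B>0. \<forall>H :: real ^ 'n \<Rightarrow> 'b::euclidean_space. H \<in> bmo_ball \<Omega> M \<longrightarrow>
    (\<forall>\<Lambda>. (\<forall>y\<in>\<Omega> \<inter> ball p \<delta>. norm (average (tower y s0) H) \<le> \<Lambda>) \<longrightarrow>
      (\<forall>\<theta>\<ge>\<Lambda> + 2 * M. measure lebesgue {z \<in> \<Omega> \<inter> ball p \<delta>. \<theta> + B < norm (H z)}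
        \<le> \<epsilon> * measure lebesgue {z \<in> \<Omega>. \<theta> < norm (H z)}))"
proof -
  let ?n = "CARD('n)"
  \<comment> \<open>Chosen so that \<epsilon>' (2 s)^n equals \<epsilon> times half the volume of a
    tower of scale s.\<close>
  define \<epsilon>' where "\<epsilon>' = \<epsilon> * ratio ^ ?n / 2"
  have "\<epsilon>' > 0" using \<epsilon> ratio_pos by (simp add: \<epsilon>'_def)
  from oscillation_on_balls[OF this M, where 'b='b]
  obtain B where B: "B > 0" and osc: "\<forall>H :: real ^ 'n \<Rightarrow> 'b. H \<in> bmo_ball \<Omega> M \<longrightarrow>
    (\<forall>y s. y \<in> \<Omega> \<longrightarrow> y \<in> ball p (\<rho> / 2) \<longrightarrow> 0 < s \<longrightarrow> 100 * L * s \<le> \<rho> / 2 \<longrightarrow>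
      measure lebesgue {z \<in> \<Omega> \<inter> cball y (10 * s). B < norm (H z - average (tower y s) H)}
        \<le> \<epsilon>' * s ^ ?n)"
    by (elim exE conjE)
  have \<Omega>: "\<Omega> \<in> lmeasurable" using bdd open_domain by (rule lmeasurable_open)
  show ?thesis
  \<comment> \<open>The summand 3 M absorbs the bound \<theta> + 3 M for the average over a tower
    that is at most half filled.\<close>
  proof (intro exI[of _ "B + 3 * M"] conjI allI impI)
    show "B + 3 * M > 0" using B M by simp
    fix H :: "real ^ 'n \<Rightarrow> 'b" and \<Lambda> \<theta>
    assume H: "H \<in> bmo_ball \<Omega> M" and top: "\<forall>y\<in>\<Omega> \<inter> ball p \<delta>. norm (average (tower y s0) H) \<le> \<Lambda>"
      and \<theta>: "\<Lambda> + 2 * M \<le> \<theta>"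
    let ?E = "{z \<in> \<Omega>. \<theta> < norm (H z)}"
    let ?D = "{z \<in> \<Omega> \<inter> ball p \<delta>. \<theta> + (B + 3 * M) < norm (H z)}"
    let ?Z = "{y \<in> ?E. \<forall>j. measure lebesgue (?E \<inter> tower y (s0 / 2 ^ j)) \<le> measure lebesgue (tower y (s0 / 2 ^ j)) / 2}"
    have super: "{z \<in> \<Omega>. a < norm (H z - b)} \<in> lmeasurable" for a b
      using H open_domain \<Omega> by (intro fmeasurableI2[OF \<Omega>] L1_loc_superlevel) (auto simp: bmo_ball_def)
    have E: "?E \<in> lmeasurable" using super[of \<theta> 0] by simp
    have "?D = {z \<in> \<Omega>. \<theta> + (B + 3 * M) < norm (H z - 0)} \<inter> ball p \<delta>" by auto
    then have D: "?D \<in> lmeasurable"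
      using fmeasurable.Int[OF super[of "\<theta> + (B + 3 * M)" 0] lmeasurable_ball] by simp
    show "measure lebesgue ?D \<le> \<epsilon> * measure lebesgue ?E"
    proof (rule measure_le_by_density_on_balls)
      show "?D \<in> sets lebesgue" using D by (rule fmeasurableD)
      show "negligible ?Z" by (rule negligible_sparse_towers[OF E s0(1)])
      fix y assume yD: "y \<in> ?D - ?Z"
      then have y: "y \<in> \<Omega>" "y \<in> ball p (\<rho> / 2)" "\<theta> + (B + 3 * M) < norm (H y)"
        and y\<delta>: "y \<in> ball p \<delta>" using \<delta> by auto
      then have "y \<in> ?E" using B M by simp
      then have ex: "\<exists>j. \<not> measure lebesgue (?E \<inter> tower y (s0 / 2 ^ j)) \<le> measure lebesgue (tower y (s0 / 2 ^ j)) / 2"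
        using yD by blast
      define P where "P j \<longleftrightarrow> measure lebesgue (?E \<inter> tower y (s0 / 2 ^ j)) > measure lebesgue (tower y (s0 / 2 ^ j)) / 2" for j
      define j where "j = (LEAST j. P j)"
      have "\<exists>j. P j" using ex unfolding P_def not_le .
      then have Pj: "P j" unfolding j_def by (rule LeastI_ex)
      have scale: "0 < s0 / 2 ^ i" "100 * L * (s0 / 2 ^ i) \<le> \<rho> / 2" for i :: nat
      proof -
        show "0 < s0 / 2 ^ i" using s0 by simp
        have "s0 / 2 ^ i \<le> s0" using s0 by (intro divide_le_eq[THEN iffD2]) (simp add: mult_le_cancel_left1)
        then have "100 * L * (s0 / 2 ^ i) \<le> 100 * L * s0" using L by (intro mult_left_mono) auto
        then show "100 * L * (s0 / 2 ^ i) \<le> \<rho> / 2" using s0 by linarith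
      qed
      note inner = tower_inner[OF y(1,2) scale]
      have eq: "?E \<inter> tower y (s0 / 2 ^ i) = {z \<in> tower y (s0 / 2 ^ i). \<theta> < norm (H z)}" for i :: nat
        using inner_cube_subset_domain[OF inner[of i]] by auto
      \<comment> \<open>At the top scale the average is at most \<Lambda>, so by Chebyshev with
        threshold 2 M at most half of the tower lies above \<theta>. Hence the first filled scale
        has a predecessor.\<close>
      have "\<not> P 0"
      proof -
        let ?T = "tower y (s0 / 2 ^ 0)"
        have "norm (average ?T H) \<le> \<Lambda>" using top y(1) y\<delta> by simp
        have "{z \<in> ?T. \<theta> < norm (H z)} \<subseteq> {z \<in> ?T. 2 * M \<le> norm (H z - average ?T H)}"
        proof clarify
          fix z assume z: "z \<in> ?T" "\<theta> < norm (H z)"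
          have "norm (H z) \<le> norm (H z - average ?T H) + norm (average ?T H)"
            using norm_triangle_ineq[of "H z - average ?T H" "average ?T H"] by simp
          then show "2 * M \<le> norm (H z - average ?T H)"
            using z \<theta> \<open>norm (average ?T H) \<le> \<Lambda>\<close> by linarith
        qed
        moreover have "?E \<inter> ?T \<in> sets lebesgue" using E inner_cube_lmeasurable[OF inner[of 0]] by auto
        ultimately have "measure lebesgue (?E \<inter> ?T) \<le> measure lebesgue {z \<in> ?T. 2 * M \<le> norm (H z - average ?T H)}"
          unfolding eq using oscillation_Chebyshev(1)[OF H M inner[of 0], of "2 * M"] M
          by (intro measure_mono_fmeasurable) auto
        also have "\<dots> \<le> M / (2 * M) * measure lebesgue ?T"
          using M by (intro oscillation_Chebyshev(2)[OF H M inner]) simp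
        finally show ?thesis unfolding P_def using M by simp
      qed
      then have "j \<noteq> 0" using Pj by metis
      \<comment> \<open>The predecessor has scale 2 s and is at most half filled, which controls its
        average. The tower of scale s is more than half filled, so its volume is paid for by the
        superlevel set.\<close>
      then obtain i where i: "j = Suc i" using not0_implies_Suc by blast
      have nPi: "\<not> P i" using not_less_Least[of i P] i by (simp add: j_def)
      define s where "s = s0 / 2 ^ j"
      have s: "s > 0" "s0 / 2 ^ i = 2 * s" using s0 by (auto simp: s_def i)
      have "norm (average (tower y (2 * s)) H) \<le> \<theta> + 3 * M"
        using nPi eq[of i] unfolding P_def s(2)[symmetric]
        by (intro average_le_of_small_superlevel[OF H M inner]) simp
      then have "B < norm (H z - average (tower y (2 * s)) H)" if "\<theta> + (B + 3 * M) < norm (H z)" for z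
        using norm_triangle_ineq2[of "H z" "average (tower y (2 * s)) H"] that by linarith
      \<comment> \<open>Points of the higher superlevel set deviate by more than B from the average
        at scale 2 s, so the oscillation estimate at that scale applies; 2 s is also the radius
        handed to the covering argument.\<close>
      then have sub: "?D \<inter> cball y (5 * (2 * s)) \<subseteq> {z \<in> \<Omega> \<inter> cball y (10 * (2 * s)). B < norm (H z - average (tower y (2 * s)) H)}"
        using s(1) by (intro subsetI) (simp add: mult.assoc)
      have "measure lebesgue (?D \<inter> cball y (5 * (2 * s))) \<le> \<epsilon>' * (2 * s) ^ ?n"
      proof (rule order_trans[OF measure_mono_fmeasurable[OF sub]])
        show "?D \<inter> cball y (5 * (2 * s)) \<in> sets lebesgue" using fmeasurableD[OF fmeasurable.Int[OF D lmeasurable_cball]] .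
        have "{z \<in> \<Omega> \<inter> cball y (10 * (2 * s)). B < norm (H z - average (tower y (2 * s)) H)}
            = {z \<in> \<Omega>. B < norm (H z - average (tower y (2 * s)) H)} \<inter> cball y (10 * (2 * s))" by blast
        then show "{z \<in> \<Omega> \<inter> cball y (10 * (2 * s)). B < norm (H z - average (tower y (2 * s)) H)} \<in> lmeasurable"
          using fmeasurable.Int[OF super lmeasurable_cball] by simp
        show "measure lebesgue {z \<in> \<Omega> \<inter> cball y (10 * (2 * s)). B < norm (H z - average (tower y (2 * s)) H)} \<le> \<epsilon>' * (2 * s) ^ ?n"
          using osc[rule_format, OF H y(1,2), of "2 * s"] scale[of i] unfolding s(2) by blast
      qed
      also have "\<dots> = \<epsilon> * (measure lebesgue (tower y s) / 2)"
        using s(1) by (simp only: measure_tower) (simp add: \<epsilon>'_def power_mult_distrib)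
      also have "\<dots> \<le> \<epsilon> * measure lebesgue (?E \<inter> tower y s)"
        using Pj \<epsilon> unfolding P_def s_def[symmetric] by (intro mult_left_mono) auto
      also have "\<dots> \<le> \<epsilon> * measure lebesgue (?E \<inter> cball y (2 * s))"
      proof (intro mult_left_mono measure_mono_fmeasurable)
        show "?E \<inter> tower y s \<subseteq> ?E \<inter> cball y (2 * s)" using tower_subset_cball[OF s(1)] by blast
        show "?E \<inter> tower y s \<in> sets lebesgue"
          using fmeasurableD[OF fmeasurable.Int[OF E inner_cube_lmeasurable[OF inner[of j]]]] unfolding s_def .
        show "?E \<inter> cball y (2 * s) \<in> lmeasurable" using E by (rule fmeasurable.Int) simp
      qed (use \<epsilon> in simp)
      finally have le: "measure lebesgue (?D \<inter> cball y (5 * (2 * s))) \<le> \<epsilon> * measure lebesgue (?E \<inter> cball y (2 * s))" .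
      have "s \<le> s0" using s0 by (simp add: s_def divide_le_eq mult_le_cancel_left1)
      show "\<exists>r>0. r \<le> 2 * s0 \<and> measure lebesgue (?D \<inter> cball y (5 * r)) \<le> \<epsilon> * measure lebesgue (?E \<inter> cball y r)"
      proof (intro exI conjI)
        show "0 < 2 * s" "2 * s \<le> 2 * s0" using s(1) \<open>s \<le> s0\<close> by simp_all
      qed (rule le)
    qed (use E \<epsilon> in \<open>simp_all only: less_imp_le\<close>)
  qed
qed

end

text \<open>For y near p all towers of the top scale contain one common cube Q, so their averages
  are bounded through the average over Q. Here \<delta> and Q precede \<epsilon>, because \<epsilon>
  will depend on the size of a finite subcover and hence on \<delta>.\<close>

lemma (in graph_chart) good_lambda_near:
  assumes M: "M > 0" and bdd: "bounded \<Omega>" and p: "p \<in> closure \<Omega>"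
  shows "\<exists>\<delta>>0. \<exists>Q\<in>inner_cubes \<Omega>. \<forall>\<epsilon>>0. \<exists>B>0. \<forall>H :: real ^ 'n \<Rightarrow> 'b::euclidean_space. H \<in> bmo_ball \<Omega> M \<longrightarrow>
    (\<forall>\<theta>\<ge>norm (average Q H) + B. measure lebesgue {z \<in> \<Omega> \<inter> ball p \<delta>. \<theta> + B < norm (H z)}
        \<le> \<epsilon> * measure lebesgue {z \<in> \<Omega>. \<theta> < norm (H z)})"
proof -
  \<comment> \<open>The largest scale allowed in the chart: 100 L s = \<rho> / 2.\<close>
  define s where "s = \<rho> / (200 * L)"
  have s: "s > 0" "100 * L * s \<le> \<rho> / 2" using \<rho> L by (auto simp: s_def)
  \<comment> \<open>A displacement below ratio s / 2 plus the half side ratio s / 2 of Q stays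
    within the half side ratio s of a tower.\<close>
  define \<delta> where "\<delta> = min (\<rho> / 2) (ratio * s / 2)"
  have \<delta>: "\<delta> > 0" "\<delta> \<le> \<rho> / 2" "\<delta> \<le> ratio * s / 2" using s \<rho> ratio_pos by (auto simp: \<delta>_def)
  define Q where "Q = cube (p + s *\<^sub>R e) (ratio * s / 2)"
  have sub: "Q \<subseteq> tower y s" if "y \<in> ball p \<delta>" for y
    unfolding Q_def tower_def using that \<delta>(3) by (intro cube_mono) (auto simp: dist_norm)
  have tower: "tower y s \<in> inner_cubes \<Omega>" if "y \<in> \<Omega>" "y \<in> ball p \<delta>" for y
    using that \<delta>(2) by (intro tower_inner s) auto
  \<comment> \<open>Since p may be a boundary point, Q is recognised as an inner cube through the
    tower over a nearby point of the domain.\<close>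
  obtain y0 where y0: "y0 \<in> \<Omega>" "y0 \<in> ball p \<delta>"
    using p \<delta>(1) unfolding closure_approachable by (auto simp: dist_commute)
  have Q: "Q \<in> inner_cubes \<Omega>"
    using inner_cube_subset[OF tower[OF y0]] sub[OF y0(2)] s(1) ratio_pos unfolding Q_def by simp
  have Qm: "measure lebesgue Q = (ratio * s) ^ CARD('n)"
    unfolding Q_def using s(1) ratio_pos by (subst measure_cube) auto
  have top: "norm (average (tower y s) H) \<le> norm (average Q H) + M * 2 ^ CARD('n)"
    if H: "H \<in> bmo_ball \<Omega> M" and y: "y \<in> \<Omega> \<inter> ball p \<delta>" for y and H :: "real ^ 'n \<Rightarrow> 'b"
  proof -
    have "norm (average Q H - average (tower y s) H) \<le> M * measure lebesgue (tower y s) / measure lebesgue Q"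
      using y by (intro average_nested[OF H M Q] tower sub) auto
    also have "\<dots> = M * 2 ^ CARD('n)"
      unfolding measure_tower[OF s(1)] Qm using s(1) ratio_pos by (simp add: power_mult_distrib)
    finally show ?thesis
      using norm_triangle_ineq3[of "average (tower y s) H" "average Q H"] by (simp add: norm_minus_commute)
  qed
  show ?thesis
  proof (rule exI[of _ \<delta>], rule conjI[OF \<delta>(1)], rule bexI[OF _ Q], intro allI impI)
    fix \<epsilon> :: real assume "\<epsilon> > 0"
    from good_lambda_chart[OF M s this bdd \<delta>(2), where 'b='b]
    obtain B where B: "B > 0" and gl: "\<forall>H :: real ^ 'n \<Rightarrow> 'b. H \<in> bmo_ball \<Omega> M \<longrightarrow>
      (\<forall>\<Lambda>. (\<forall>y\<in>\<Omega> \<inter> ball p \<delta>. norm (average (tower y s) H) \<le> \<Lambda>) \<longrightarrow>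
      (\<forall>\<theta>\<ge>\<Lambda> + 2 * M. measure lebesgue {z \<in> \<Omega> \<inter> ball p \<delta>. \<theta> + B < norm (H z)}
        \<le> \<epsilon> * measure lebesgue {z \<in> \<Omega>. \<theta> < norm (H z)}))"
      by (elim exE conjE)
    let ?B = "B + M * 2 ^ CARD('n) + 2 * M"
    have B': "?B > 0" "B \<le> ?B" using B M by (simp_all add: add_pos_pos)
    show "\<exists>B>0. \<forall>H :: real ^ 'n \<Rightarrow> 'b. H \<in> bmo_ball \<Omega> M \<longrightarrow>
      (\<forall>\<theta>\<ge>norm (average Q H) + B. measure lebesgue {z \<in> \<Omega> \<inter> ball p \<delta>. \<theta> + B < norm (H z)}
        \<le> \<epsilon> * measure lebesgue {z \<in> \<Omega>. \<theta> < norm (H z)})"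
    proof (intro exI conjI allI impI)
      show "?B > 0" by fact
      fix H :: "real ^ 'n \<Rightarrow> 'b" and \<theta>
      assume H: "H \<in> bmo_ball \<Omega> M" and \<theta>: "norm (average Q H) + ?B \<le> \<theta>"
      have \<Omega>: "\<Omega> \<in> lmeasurable" using bdd open_domain by (rule lmeasurable_open)
      have meas: "{z \<in> \<Omega> \<inter> ball p \<delta>. a < norm (H z)} \<in> lmeasurable" for a
      proof -
        have "{z \<in> \<Omega>. a < norm (H z - 0)} \<in> sets lebesgue"
          using H open_domain by (intro L1_loc_superlevel) (auto simp: bmo_ball_def)
        then have "{z \<in> \<Omega>. a < norm (H z - 0)} \<in> lmeasurable"
          by (rule fmeasurableI2[OF \<Omega>, rotated]) blast
        moreover have "{z \<in> \<Omega> \<inter> ball p \<delta>. a < norm (H z)} = {z \<in> \<Omega>. a < norm (H z - 0)} \<inter> ball p \<delta>"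
          by auto
        ultimately show ?thesis using fmeasurable.Int[OF _ lmeasurable_ball] by simp
      qed
      have "measure lebesgue {z \<in> \<Omega> \<inter> ball p \<delta>. \<theta> + ?B < norm (H z)}
          \<le> measure lebesgue {z \<in> \<Omega> \<inter> ball p \<delta>. \<theta> + B < norm (H z)}"
        by (rule measure_mono_fmeasurable[OF _ fmeasurableD[OF meas] meas]) (use B'(2) in auto)
      also have "\<dots> \<le> \<epsilon> * measure lebesgue {z \<in> \<Omega>. \<theta> < norm (H z)}"
      proof (rule gl[rule_format, OF H])
        show "norm (average (tower y s) H) \<le> norm (average Q H) + M * 2 ^ CARD('n)" if "y \<in> \<Omega> \<inter> ball p \<delta>" for y
          by (rule top[OF H that])
        show "norm (average Q H) + M * 2 ^ CARD('n) + 2 * M \<le> \<theta>" using \<theta> B by linarith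
      qed
      finally show "measure lebesgue {z \<in> \<Omega> \<inter> ball p \<delta>. \<theta> + ?B < norm (H z)}
        \<le> \<epsilon> * measure lebesgue {z \<in> \<Omega>. \<theta> < norm (H z)}" .
    qed
  qed
qed

section \<open>From charts to the whole domain\<close>

text \<open>At an interior point an affine height serves that is positive on a small ball. At a
  boundary point the height is x \<bullet> e - g (\<pi> x); the projection is estimated with
  Lipschitz constant 2, which gives the slope 1 + 2 L.\<close>

lemma graph_chart_exists:
  fixes \<Omega> :: "(real ^ 'n) set"
  assumes \<Omega>: "lipschitz_domain \<Omega>" and p: "p \<in> closure \<Omega>"
  shows "\<exists>e h L \<rho>. graph_chart \<Omega> e h L \<rho> p"
proof (cases "p \<in> \<Omega>")
  case True
  have op: "open \<Omega>" using \<Omega> by (simp add: lipschitz_domain_def domain_set_def)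
  obtain r where r: "r > 0" "cball p r \<subseteq> \<Omega>" using op True open_contains_cball by blast
  obtain e :: "real ^ 'n" where e: "e \<in> Basis" using nonempty_Basis by blast
  let ?\<rho> = "min r (1 / 2)" and ?h = "\<lambda>x. (x - p) \<bullet> e + 1"
  have "graph_chart \<Omega> e ?h 1 ?\<rho> p"
  proof
    fix x y :: "real ^ 'n"
    have "?h x - ?h y = (x - y) \<bullet> e" by (simp add: inner_diff_left)
    then show "\<bar>?h x - ?h y\<bar> \<le> 1 * norm (x - y)"
      using Cauchy_Schwarz_ineq2[of "x - y" e] e by simp
  next
    fix x assume x: "x \<in> cball p ?\<rho>"
    have "\<bar>(x - p) \<bullet> e\<bar> \<le> norm (x - p)" using Cauchy_Schwarz_ineq2[of "x - p" e] e by simp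
    also have "\<dots> \<le> 1 / 2" using x by (simp add: dist_norm norm_minus_commute)
    finally show "x \<in> \<Omega> \<longleftrightarrow> ?h x > 0" using x r(2) by auto
  qed (use op e r in \<open>auto simp: algebra_simps inner_Basis\<close>)
  then show ?thesis by blast
next
  case False
  have op: "open \<Omega>" using \<Omega> by (simp add: lipschitz_domain_def domain_set_def)
  have "p \<in> frontier \<Omega>" using p False op by (simp add: frontier_def interior_open)
  then obtain U e g L where U: "open U" "p \<in> U" and e: "norm e = 1"
    and g: "L-lipschitz_on {y. y \<bullet> e = 0} g"
    and above: "\<Omega> \<inter> U = {x \<in> U. x \<bullet> e > g (x - (x \<bullet> e) *\<^sub>R e)}"
    using \<Omega> unfolding lipschitz_domain_def lipschitz_boundary_at_def by blast
  obtain r where r: "r > 0" "cball p r \<subseteq> U" using U open_contains_cball by blast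
  define \<pi> where "\<pi> x = x - (x \<bullet> e) *\<^sub>R e" for x
  have ee: "e \<bullet> e = 1" using e by (simp add: norm_eq_1)
  have \<pi>: "\<pi> x \<bullet> e = 0" for x by (simp add: \<pi>_def inner_diff_left ee)
  have L: "L \<ge> 0" using g by (rule lipschitz_on_nonneg)
  let ?h = "\<lambda>x. x \<bullet> e - g (\<pi> x)"
  have "graph_chart \<Omega> e ?h (1 + 2 * L) r p"
  proof
    fix x y :: "real ^ 'n"
    have ip: "\<bar>(x - y) \<bullet> e\<bar> \<le> norm (x - y)" using Cauchy_Schwarz_ineq2[of "x - y" e] e by simp
    have "\<pi> x - \<pi> y = (x - y) - ((x - y) \<bullet> e) *\<^sub>R e" by (simp add: \<pi>_def algebra_simps inner_diff_left)
    then have "norm (\<pi> x - \<pi> y) \<le> norm (x - y) + \<bar>(x - y) \<bullet> e\<bar>"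
      using norm_triangle_ineq4[of "x - y" "((x - y) \<bullet> e) *\<^sub>R e"] e by simp
    then have "norm (\<pi> x - \<pi> y) \<le> 2 * norm (x - y)" using ip by simp
    then have "L * norm (\<pi> x - \<pi> y) \<le> L * (2 * norm (x - y))" using L by (rule mult_left_mono)
    moreover have "\<bar>g (\<pi> x) - g (\<pi> y)\<bar> \<le> L * norm (\<pi> x - \<pi> y)"
      using lipschitz_onD[OF g, of "\<pi> x" "\<pi> y"] \<pi> by (simp add: dist_norm)
    ultimately show "\<bar>?h x - ?h y\<bar> \<le> (1 + 2 * L) * norm (x - y)"
      using ip by (simp add: inner_diff_left distrib_right)
  next
    fix x t
    have "\<pi> (x + t *\<^sub>R e) = \<pi> x" by (simp add: \<pi>_def inner_add_left ee algebra_simps)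
    then show "?h (x + t *\<^sub>R e) = ?h x + t" by (simp add: inner_add_left ee)
  next
    fix x assume "x \<in> cball p r"
    then have "x \<in> U" using r by blast
    then show "x \<in> \<Omega> \<longleftrightarrow> ?h x > 0" using above unfolding \<pi>_def by auto
  qed (use op e L r in auto)
  then show ?thesis by blast
qed

text \<open>Nested cubes are linked through the ratio of their volumes, and links compose. So the
  relation between centres holds locally, and connectedness spreads it over the domain. This makes
  the reference cubes of different charts interchangeable.\<close>

lemma average_inner_cubes_linked:
  fixes \<Omega> :: "(real ^ 'n) set"
  assumes \<Omega>: "open \<Omega>" "connected \<Omega>" and M: "M > 0" and Q: "Q \<in> inner_cubes \<Omega>" "Q' \<in> inner_cubes \<Omega>"
  shows "\<exists>C. \<forall>H :: real ^ 'n \<Rightarrow> 'b::euclidean_space. H \<in> bmo_ball \<Omega> M \<longrightarrow> norm (average Q H - average Q' H) \<le> C"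
proof -
  define linked where "linked A B \<longleftrightarrow> (\<exists>C. \<forall>H :: real ^ 'n \<Rightarrow> 'b. H \<in> bmo_ball \<Omega> M \<longrightarrow>
    norm (average A H - average B H) \<le> C)" for A B
  have sym: "linked B A" if "linked A B" for A B
    using that unfolding linked_def by (simp add: norm_minus_commute)
  have trans: "linked A D" if AB: "linked A B" and BD: "linked B D" for A B D
  proof -
    obtain C1 C2 where C: "\<forall>H :: real ^ 'n \<Rightarrow> 'b. H \<in> bmo_ball \<Omega> M \<longrightarrow> norm (average A H - average B H) \<le> C1"
      "\<forall>H :: real ^ 'n \<Rightarrow> 'b. H \<in> bmo_ball \<Omega> M \<longrightarrow> norm (average B H - average D H) \<le> C2"
      using AB BD unfolding linked_def by (elim exE)
    show ?thesis
      unfolding linked_def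
    proof (intro exI allI impI)
      fix H :: "real ^ 'n \<Rightarrow> 'b" assume H: "H \<in> bmo_ball \<Omega> M"
      show "norm (average A H - average D H) \<le> C1 + C2"
        using norm_triangle_ineq[of "average A H - average B H" "average B H - average D H"]
          C[rule_format, OF H] by simp
    qed
  qed
  have nested: "linked A B" if "A \<in> inner_cubes \<Omega>" "B \<in> inner_cubes \<Omega>" "A \<subseteq> B" for A B
    unfolding linked_def using average_nested[OF _ M that] by (intro exI allI impI)
  define R where "R x y \<longleftrightarrow> (\<forall>t t'. t > 0 \<longrightarrow> t' > 0 \<longrightarrow> cube x t \<in> inner_cubes \<Omega> \<longrightarrow> cube y t' \<in> inner_cubes \<Omega> \<longrightarrow>
    linked (cube x t) (cube y t'))" for x y
  have exists: "\<exists>t>0. cube x t \<in> inner_cubes \<Omega>" if x: "x \<in> \<Omega>" for x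
  proof -
    obtain r where r: "r > 0" "cball x r \<subseteq> \<Omega>" using \<Omega>(1) x open_contains_cball by blast
    have "cube x (r / real CARD('n)) \<in> inner_cubes \<Omega>" using r by (intro inner_cubeI) auto
    then show ?thesis using r(1) by (intro exI[of _ "r / real CARD('n)"]) auto
  qed
  have concentric: "linked (cube x t) (cube x t')"
    if t: "t > 0" "t' > 0" "cube x t \<in> inner_cubes \<Omega>" "cube x t' \<in> inner_cubes \<Omega>" for x t t'
  proof (cases "t \<le> t'")
    case True
    have "cube x t \<subseteq> cube x t'" using True by (intro cube_mono) simp
    then show ?thesis using nested t by blast
  next
    case False
    have "cube x t' \<subseteq> cube x t" using False by (intro cube_mono) simp
    then show ?thesis using nested t sym by blast
  qed
  have R: "R x y" if "x \<in> \<Omega>" "y \<in> \<Omega>" for x y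
  proof (rule connected_equivalence_relation[OF \<Omega>(2) that])
    show "R b a" if "R a b" for a b using that sym unfolding R_def by blast
    show "R a c" if ab: "R a b" and bc: "R b c" and "a \<in> \<Omega>" "b \<in> \<Omega>" "c \<in> \<Omega>" for a b c
    proof -
      obtain t where t: "t > 0" "cube b t \<in> inner_cubes \<Omega>" using exists \<open>b \<in> \<Omega>\<close> by blast
      show ?thesis
        unfolding R_def
      proof (intro allI impI)
        fix u u' assume u: "u > 0" "u' > 0" "cube a u \<in> inner_cubes \<Omega>" "cube c u' \<in> inner_cubes \<Omega>"
        have "linked (cube a u) (cube b t)" using ab t u unfolding R_def by blast
        moreover have "linked (cube b t) (cube c u')" using bc t u unfolding R_def by blast
        ultimately show "linked (cube a u) (cube c u')" by (rule trans)
      qed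
    qed
    fix a assume a: "a \<in> \<Omega>"
    obtain t0 where t0: "t0 > 0" "cube a t0 \<in> inner_cubes \<Omega>" using exists a by blast
    have "R a x" if x: "x \<in> cube a t0" for x
      unfolding R_def
    proof (intro allI impI)
      fix t t' assume t: "t > 0" "t' > 0" "cube a t \<in> inner_cubes \<Omega>" "cube x t' \<in> inner_cubes \<Omega>"
      obtain r where r: "r > 0" "cball x r \<subseteq> cube a t0"
        using open_cube[of a t0] x open_contains_cball by blast
      \<comment> \<open>Small enough for \<open>cube x t1\<close> to lie both in the concentric
        \<open>cube x t'\<close> and in \<open>cube a t0\<close>.\<close>
      define t1 where "t1 = min t' (r / real CARD('n))"
      have t1: "t1 > 0" "t1 \<le> t'" "real CARD('n) * t1 \<le> r"
        using t r by (auto simp: t1_def min_def field_simps)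
      have "cball x (real CARD('n) * t1) \<subseteq> cball x r" using t1(3) by (rule subset_cball)
      then have sub: "cube x t1 \<subseteq> cube a t0"
        using cube_subset_cball[of x t1] r(2) by blast
      have in1: "cube x t1 \<in> inner_cubes \<Omega>" by (rule inner_cube_subset[OF t0(2) sub t1(1)])
      have "linked (cube a t) (cube a t0)" using concentric t t0 by blast
      moreover have "linked (cube a t0) (cube x t1)" using nested[OF in1 t0(2) sub] by (rule sym)
      moreover have "linked (cube x t1) (cube x t')" using concentric t t1 in1 by blast
      ultimately show "linked (cube a t) (cube x t')" using trans by blast
    qed
    moreover have "openin (top_of_set \<Omega>) (cube a t0)"
      using open_subset[OF inner_cube_subset_domain[OF t0(2)] open_cube] .
    moreover have "a \<in> cube a t0" using t0(1) by (simp add: mem_cube)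
    ultimately show "\<exists>T. openin (top_of_set \<Omega>) T \<and> a \<in> T \<and> (\<forall>x\<in>T. R a x)" by blast
  qed
  obtain w t w' t' where wt: "Q = cube w t" "t > 0" "Q' = cube w' t'" "t' > 0"
    using Q unfolding inner_cube_iff by blast
  have "w \<in> Q" "w' \<in> Q'" using wt by (auto simp: mem_cube)
  then have "w \<in> \<Omega>" "w' \<in> \<Omega>" using Q inner_cube_subset_domain by blast+
  then have "linked Q Q'" using R[of w w'] Q wt unfolding R_def by blast
  then show ?thesis unfolding linked_def .
qed

text \<open>Constants have no oscillation, so the decay can only start above the average over some cube.\<close>

lemma good_lambda:
  fixes \<Omega> :: "(real ^ 'n) set"
  assumes \<Omega>: "lipschitz_domain \<Omega>" and M: "M > 0"
  shows "\<exists>Q\<in>inner_cubes \<Omega>. \<exists>B>0. \<forall>H :: real ^ 'n \<Rightarrow> 'b::euclidean_space. H \<in> bmo_ball \<Omega> M \<longrightarrow>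
    (\<forall>\<theta>\<ge>norm (average Q H) + B. measure lebesgue {z \<in> \<Omega>. \<theta> + B < norm (H z)}
        \<le> 1 / 2 * measure lebesgue {z \<in> \<Omega>. \<theta> < norm (H z)})"
proof -
  have op: "open \<Omega>" and con: "connected \<Omega>" and ne: "\<Omega> \<noteq> {}" and bdd: "bounded \<Omega>"
    using \<Omega> by (auto simp: lipschitz_domain_def domain_set_def)
  have lm: "\<Omega> \<in> lmeasurable" using bdd op by (rule lmeasurable_open)
  have "\<forall>p\<in>closure \<Omega>. \<exists>\<delta>>0. \<exists>Q\<in>inner_cubes \<Omega>. \<forall>\<epsilon>>0. \<exists>B>0. \<forall>H :: real ^ 'n \<Rightarrow> 'b. H \<in> bmo_ball \<Omega> M \<longrightarrow>
    (\<forall>\<theta>\<ge>norm (average Q H) + B. measure lebesgue {z \<in> \<Omega> \<inter> ball p \<delta>. \<theta> + B < norm (H z)}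
        \<le> \<epsilon> * measure lebesgue {z \<in> \<Omega>. \<theta> < norm (H z)})"
  proof
    fix p assume p: "p \<in> closure \<Omega>"
    obtain e h L \<rho> where "graph_chart \<Omega> e h L \<rho> p" using graph_chart_exists[OF \<Omega> p] by blast
    then interpret graph_chart \<Omega> e h L \<rho> p .
    show "\<exists>\<delta>>0. \<exists>Q\<in>inner_cubes \<Omega>. \<forall>\<epsilon>>0. \<exists>B>0. \<forall>H :: real ^ 'n \<Rightarrow> 'b. H \<in> bmo_ball \<Omega> M \<longrightarrow>
    (\<forall>\<theta>\<ge>norm (average Q H) + B. measure lebesgue {z \<in> \<Omega> \<inter> ball p \<delta>. \<theta> + B < norm (H z)}
        \<le> \<epsilon> * measure lebesgue {z \<in> \<Omega>. \<theta> < norm (H z)})"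
      by (rule good_lambda_near[OF M bdd p])
  qed
  then obtain \<delta> where "\<forall>p\<in>closure \<Omega>. \<delta> p > 0 \<and> (\<exists>Q\<in>inner_cubes \<Omega>. \<forall>\<epsilon>>0. \<exists>B>0. \<forall>H :: real ^ 'n \<Rightarrow> 'b. H \<in> bmo_ball \<Omega> M \<longrightarrow>
    (\<forall>\<theta>\<ge>norm (average Q H) + B. measure lebesgue {z \<in> \<Omega> \<inter> ball p (\<delta> p). \<theta> + B < norm (H z)}
        \<le> \<epsilon> * measure lebesgue {z \<in> \<Omega>. \<theta> < norm (H z)}))"
    unfolding bchoice_iff by (elim exE)
  then have \<delta>: "\<And>p. p \<in> closure \<Omega> \<Longrightarrow> \<delta> p > 0" and
    "\<forall>p\<in>closure \<Omega>. \<exists>Q. Q\<in>inner_cubes \<Omega> \<and> (\<forall>\<epsilon>>0. \<exists>B>0. \<forall>H :: real ^ 'n \<Rightarrow> 'b. H \<in> bmo_ball \<Omega> M \<longrightarrow>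
    (\<forall>\<theta>\<ge>norm (average Q H) + B. measure lebesgue {z \<in> \<Omega> \<inter> ball p (\<delta> p). \<theta> + B < norm (H z)}
        \<le> \<epsilon> * measure lebesgue {z \<in> \<Omega>. \<theta> < norm (H z)}))"
    by simp_all (simp add: Bex_def)
  then obtain Q where Q: "\<forall>p\<in>closure \<Omega>. Q p\<in>inner_cubes \<Omega> \<and> (\<forall>\<epsilon>>0. \<exists>B>0. \<forall>H :: real ^ 'n \<Rightarrow> 'b. H \<in> bmo_ball \<Omega> M \<longrightarrow>
    (\<forall>\<theta>\<ge>norm (average (Q p) H) + B. measure lebesgue {z \<in> \<Omega> \<inter> ball p (\<delta> p). \<theta> + B < norm (H z)}
        \<le> \<epsilon> * measure lebesgue {z \<in> \<Omega>. \<theta> < norm (H z)}))"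
    unfolding bchoice_iff by (elim exE)
  have cover: "closure \<Omega> \<subseteq> (\<Union>p\<in>closure \<Omega>. ball p (\<delta> p))" using \<delta> by force
  have "compact (closure \<Omega>)" using bdd by simp
  then obtain P where P: "P \<subseteq> closure \<Omega>" "finite P" "closure \<Omega> \<subseteq> (\<Union>p\<in>P. ball p (\<delta> p))"
    by (rule compactE_image[OF _ _ cover]) auto
  have Pne: "P \<noteq> {}" using P(3) ne by auto
  \<comment> \<open>The estimates on the card P balls are added, and the total factor has to be 1 /
    2.\<close>
  define \<epsilon> where "\<epsilon> = 1 / (2 * real (card P))"
  have \<epsilon>: "\<epsilon> > 0" using P(2) Pne by (simp add: \<epsilon>_def card_gt_0_iff)
  have "\<forall>p\<in>P. \<exists>B. B>0 \<and> (\<forall>H :: real ^ 'n \<Rightarrow> 'b. H \<in> bmo_ball \<Omega> M \<longrightarrow>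
    (\<forall>\<theta>\<ge>norm (average (Q p) H) + B. measure lebesgue {z \<in> \<Omega> \<inter> ball p (\<delta> p). \<theta> + B < norm (H z)}
        \<le> \<epsilon> * measure lebesgue {z \<in> \<Omega>. \<theta> < norm (H z)}))"
    using Q P(1) \<epsilon> by (meson subsetD)
  then obtain B where B: "\<forall>p\<in>P. B p>0 \<and> (\<forall>H :: real ^ 'n \<Rightarrow> 'b. H \<in> bmo_ball \<Omega> M \<longrightarrow>
    (\<forall>\<theta>\<ge>norm (average (Q p) H) + B p. measure lebesgue {z \<in> \<Omega> \<inter> ball p (\<delta> p). \<theta> + B p < norm (H z)}
        \<le> \<epsilon> * measure lebesgue {z \<in> \<Omega>. \<theta> < norm (H z)}))"
    unfolding bchoice_iff by (elim exE)
  obtain p0 where p0: "p0 \<in> P" using Pne by blast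
  have Q0: "Q p0 \<in> inner_cubes \<Omega>" using Q p0 P(1) by blast
  have "\<forall>p\<in>P. \<exists>C. \<forall>H :: real ^ 'n \<Rightarrow> 'b. H \<in> bmo_ball \<Omega> M \<longrightarrow> norm (average (Q p) H - average (Q p0) H) \<le> C"
    using average_inner_cubes_linked[OF op con M _ Q0] Q P(1) by (meson subsetD)
  then obtain C where C: "\<forall>p\<in>P. \<forall>H :: real ^ 'n \<Rightarrow> 'b. H \<in> bmo_ball \<Omega> M \<longrightarrow> norm (average (Q p) H - average (Q p0) H) \<le> C p"
    unfolding bchoice_iff by (elim exE)
  \<comment> \<open>D is at least \<open>B p\<close> and \<open>B p + C p\<close> for every p in P,
    so a level admissible for \<open>Q p0\<close> with D is admissible for each \<open>Q p\<close>
    with \<open>B p\<close>. The absolute value makes all summands nonnegative, so each is bounded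
    by the sum.\<close>
  define D where "D = (\<Sum>p\<in>P. B p + \<bar>C p\<bar>)"
  have D: "B p + C p \<le> D" "B p \<le> D" if "p \<in> P" for p
  proof -
    have "B p + \<bar>C p\<bar> \<le> D"
      unfolding D_def using P(2) that B by (intro member_le_sum) (auto intro: add_nonneg_nonneg less_imp_le)
    then show "B p + C p \<le> D" "B p \<le> D" by linarith+
  qed
  have D0: "D > 0" using D(2)[OF p0] B p0 by force
  show ?thesis
  proof (intro bexI[OF _ Q0] exI[of _ D] conjI allI impI D0)
    fix H :: "real ^ 'n \<Rightarrow> 'b" and \<theta> assume H: "H \<in> bmo_ball \<Omega> M" and \<theta>: "norm (average (Q p0) H) + D \<le> \<theta>"
    have meas: "{z \<in> \<Omega> \<inter> A. a < norm (H z)} \<in> lmeasurable" if "open A" for a A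
    proof -
      have "{z \<in> \<Omega>. a < norm (H z - 0)} \<in> sets lebesgue"
        using H op by (intro L1_loc_superlevel) (auto simp: bmo_ball_def)
      then have "{z \<in> \<Omega>. a < norm (H z - 0)} \<inter> A \<in> sets lebesgue" using that by auto
      then have "{z \<in> \<Omega>. a < norm (H z - 0)} \<inter> A \<in> lmeasurable"
        by (rule fmeasurableI2[OF lm, rotated]) blast
      moreover have "{z \<in> \<Omega> \<inter> A. a < norm (H z)} = {z \<in> \<Omega>. a < norm (H z - 0)} \<inter> A"
        by auto
      ultimately show ?thesis by simp
    qed
    note ball_meas = meas[OF open_ball]
    have "measure lebesgue {z \<in> \<Omega>. \<theta> + D < norm (H z)}
       \<le> measure lebesgue (\<Union>p\<in>P. {z \<in> \<Omega> \<inter> ball p (\<delta> p). \<theta> + D < norm (H z)})"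
    proof (rule measure_mono_fmeasurable)
      show "{z \<in> \<Omega>. \<theta> + D < norm (H z)} \<subseteq> (\<Union>p\<in>P. {z \<in> \<Omega> \<inter> ball p (\<delta> p). \<theta> + D < norm (H z)})"
        using P(3) closure_subset[of \<Omega>] by blast
      show "{z \<in> \<Omega>. \<theta> + D < norm (H z)} \<in> sets lebesgue"
        using fmeasurableD[OF meas[of UNIV "\<theta> + D"]] by simp
      show "(\<Union>p\<in>P. {z \<in> \<Omega> \<inter> ball p (\<delta> p). \<theta> + D < norm (H z)}) \<in> lmeasurable"
        using P(2) ball_meas by (intro fmeasurable.finite_UN)
    qed
    also have "\<dots> \<le> (\<Sum>p\<in>P. measure lebesgue {z \<in> \<Omega> \<inter> ball p (\<delta> p). \<theta> + D < norm (H z)})"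
      using ball_meas by (intro measure_UNION_le P(2) fmeasurableD)
    also have "\<dots> \<le> (\<Sum>p\<in>P. \<epsilon> * measure lebesgue {z \<in> \<Omega>. \<theta> < norm (H z)})"
    proof (rule sum_mono)
      fix p assume p: "p \<in> P"
      have "measure lebesgue {z \<in> \<Omega> \<inter> ball p (\<delta> p). \<theta> + D < norm (H z)}
          \<le> measure lebesgue {z \<in> \<Omega> \<inter> ball p (\<delta> p). \<theta> + B p < norm (H z)}"
        by (rule measure_mono_fmeasurable[OF _ fmeasurableD[OF meas] meas]) (use D(2)[OF p] in auto)
      also have "norm (average (Q p) H) + B p \<le> \<theta>"
        using C[rule_format, OF p H] D(1)[OF p] \<theta> norm_triangle_ineq2[of "average (Q p) H" "average (Q p0) H"]
        by linarith
      then have "measure lebesgue {z \<in> \<Omega> \<inter> ball p (\<delta> p). \<theta> + B p < norm (H z)} \<le> \<epsilon> * measure lebesgue {z \<in> \<Omega>. \<theta> < norm (H z)}"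
        using bspec[OF B p] H by blast
      finally show "measure lebesgue {z \<in> \<Omega> \<inter> ball p (\<delta> p). \<theta> + D < norm (H z)}
          \<le> \<epsilon> * measure lebesgue {z \<in> \<Omega>. \<theta> < norm (H z)}" .
    qed
    also have "\<dots> = 1 / 2 * measure lebesgue {z \<in> \<Omega>. \<theta> < norm (H z)}"
      using P(2) Pne by (simp add: \<epsilon>_def)
    finally show "measure lebesgue {z \<in> \<Omega>. \<theta> + D < norm (H z)} \<le> 1 / 2 * measure lebesgue {z \<in> \<Omega>. \<theta> < norm (H z)}" .
  qed
qed

section \<open>Interpolation between powers of a function of bounded mean oscillation\<close>

text \<open>Ratio test: the base grows at most by the factor 1 + 1 / (n + 1), whose q-th power is
  eventually below 3 / 2, and 3 / 2 times 1 / 2 is 3 / 4.\<close>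

lemma summable_powr_half_power:
  fixes a b q :: real
  assumes "a > 0" "b > 0" "q \<ge> 0"
  shows "summable (\<lambda>j. (a + real (Suc j) * b) powr q * (1 / 2) ^ j)"
proof -
  have "(\<lambda>n. (1 + 1 / real (Suc n)) powr q) \<longlonglongrightarrow> (1 + 0) powr q"
    using LIMSEQ_inverse_real_of_nat by (intro tendsto_intros) (simp_all add: inverse_eq_divide)
  then have "\<forall>\<^sub>F n in sequentially. (1 + 1 / real (Suc n)) powr q < 3 / 2"
    by (rule order_tendstoD) simp
  then obtain N where N: "\<And>n. n \<ge> N \<Longrightarrow> (1 + 1 / real (Suc n)) powr q < 3 / 2"
    unfolding eventually_sequentially by blast
  show ?thesis
  proof (rule summable_ratio_test[of "3 / 4" N])
    fix n assume "N \<le> n"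
    have "a + real (Suc (Suc n)) * b \<le> (a + real (Suc n) * b) * (1 + 1 / real (Suc n))"
    proof -
      have "(a + real (Suc n) * b) * (1 + 1 / real (Suc n)) = a + real (Suc n) * b + a / real (Suc n) + b"
        by (simp add: field_simps)
      moreover have "0 \<le> a / real (Suc n)" using assms by simp
      ultimately show ?thesis by (simp add: distrib_right)
    qed
    then have "(a + real (Suc (Suc n)) * b) powr q \<le> ((a + real (Suc n) * b) * (1 + 1 / real (Suc n))) powr q"
      using assms by (intro powr_mono2) (auto intro: add_nonneg_nonneg)
    also have "\<dots> = (a + real (Suc n) * b) powr q * (1 + 1 / real (Suc n)) powr q"
      using assms by (intro powr_mult)
    also have "\<dots> \<le> (a + real (Suc n) * b) powr q * (3 / 2)"
      using N[OF \<open>N \<le> n\<close>] by (intro mult_left_mono) auto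
    finally have "(a + real (Suc (Suc n)) * b) powr q * (1 / 2) ^ Suc n
        \<le> (a + real (Suc n) * b) powr q * (3 / 2) * (1 / 2) ^ Suc n"
      by (rule mult_right_mono) simp
    then show "norm ((a + real (Suc (Suc n)) * b) powr q * (1 / 2) ^ Suc n)
        \<le> 3 / 4 * norm ((a + real (Suc n) * b) powr q * (1 / 2) ^ n)"
      by (simp add: abs_mult)
  qed simp
qed

text \<open>A discrete layer cake formula: on the band from \<theta> + j B to \<theta> + (j + 1) B
  the function is bounded by the upper end, while the measure of the superlevel set at the lower end
  has been halved j times.\<close>

lemma nn_integral_superlevel_powr:
  fixes f :: "'a \<Rightarrow> real" and \<theta> B q :: real
  assumes f[measurable]: "f \<in> borel_measurable N" and pos: "\<theta> > 0" "B > 0" "q \<ge> 0"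
    and decay: "\<And>t. t \<ge> \<theta> \<Longrightarrow> emeasure N {x \<in> space N. t + B < f x} \<le> ennreal (1 / 2) * emeasure N {x \<in> space N. t < f x}"
  shows "(\<integral>\<^sup>+ x. ennreal (f x powr q) * indicator {x \<in> space N. \<theta> < f x} x \<partial>N)
    \<le> ennreal (\<Sum>j. (\<theta> + real (Suc j) * B) powr q * (1 / 2) ^ j) * emeasure N {x \<in> space N. \<theta> < f x}"
proof -
  define a where "a j = (\<theta> + real (Suc j) * B) powr q" for j
  define E where "E j = {x \<in> space N. \<theta> + real j * B < f x}" for j
  have E[measurable]: "E j \<in> sets N" for j unfolding E_def by measurable
  have meas: "emeasure N (E j) \<le> ennreal ((1 / 2) ^ j) * emeasure N (E 0)" for j
  proof (induction j)
    case (Suc j)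
    have "emeasure N (E (Suc j)) \<le> ennreal (1 / 2) * emeasure N (E j)"
      using decay[of "\<theta> + real j * B"] pos by (simp add: E_def algebra_simps)
    also have "\<dots> \<le> ennreal (1 / 2) * (ennreal ((1 / 2) ^ j) * emeasure N (E 0))"
      by (intro mult_left_mono Suc) simp
    also have "\<dots> = ennreal ((1 / 2) ^ Suc j) * emeasure N (E 0)"
      by (simp only: power_Suc, subst ennreal_mult) (simp_all only: mult.assoc, simp_all)
    finally show ?case .
  qed simp
  have point: "ennreal (f x powr q) * indicator (E 0) x \<le> (\<Sum>j. ennreal (a j) * indicator (E j) x)" if x: "x \<in> space N" for x
  proof (cases "\<theta> < f x")
    case True
    \<comment> \<open>Superlevel sets are strict, so the bands are open below and closed above;
      hence the ceiling minus 1.\<close>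
    define j where "j = nat (\<lceil>(f x - \<theta>) / B\<rceil> - 1)"
    have "(f x - \<theta>) / B > 0" using True pos by simp
    then have "\<lceil>(f x - \<theta>) / B\<rceil> \<ge> 1" by (simp add: le_ceiling_iff)
    then have "real j = of_int \<lceil>(f x - \<theta>) / B\<rceil> - 1" by (simp add: j_def)
    then have "real j < (f x - \<theta>) / B" "(f x - \<theta>) / B \<le> real j + 1" by linarith+
    then have j: "\<theta> + real j * B < f x" "f x \<le> \<theta> + real (Suc j) * B" using pos by (simp_all add: field_simps)
    have "f x powr q \<le> a j" unfolding a_def using j(2) True pos by (intro powr_mono2) auto
    then have "ennreal (f x powr q) * indicator (E 0) x \<le> ennreal (a j) * indicator (E j) x"
      using j(1) x True by (simp add: E_def ennreal_leI)
    also have "\<dots> \<le> (\<Sum>j. ennreal (a j) * indicator (E j) x)"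
      using sum_le_suminf[of "\<lambda>j. ennreal (a j) * indicator (E j) x" "{j}"] by (simp del: sum_mult_indicator)
    finally show ?thesis .
  qed (simp add: E_def)
  have a0: "a j \<ge> 0" for j by (simp add: a_def)
  have summ: "summable (\<lambda>j. a j * (1 / 2) ^ j)"
    unfolding a_def using pos by (rule summable_powr_half_power)
  have "(\<integral>\<^sup>+ x. ennreal (f x powr q) * indicator (E 0) x \<partial>N) \<le> (\<integral>\<^sup>+ x. (\<Sum>j. ennreal (a j) * indicator (E j) x) \<partial>N)"
    by (intro nn_integral_mono point)
  also have "\<dots> = (\<Sum>j. ennreal (a j) * emeasure N (E j))"
    by (subst nn_integral_suminf) (auto simp: nn_integral_cmult_indicator)
  also have "\<dots> \<le> (\<Sum>j. ennreal (a j * (1 / 2) ^ j) * emeasure N (E 0))"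
  proof (intro suminf_le)
    fix j
    have "ennreal (a j) * emeasure N (E j) \<le> ennreal (a j) * (ennreal ((1 / 2) ^ j) * emeasure N (E 0))"
      by (intro mult_left_mono meas) simp
    then show "ennreal (a j) * emeasure N (E j) \<le> ennreal (a j * (1 / 2) ^ j) * emeasure N (E 0)"
      using a0 by (simp add: ennreal_mult mult.assoc)
  qed auto
  also have "\<dots> = (\<Sum>j. ennreal (a j * (1 / 2) ^ j)) * emeasure N (E 0)"
    by simp
  also have "(\<Sum>j. ennreal (a j * (1 / 2) ^ j)) = ennreal (\<Sum>j. a j * (1 / 2) ^ j)"
    using a0 summ by (intro suminf_ennreal2) auto
  finally show ?thesis by (simp add: a_def E_def)
qed

text \<open>Allows the average over a reference cube to be normalised to 0.\<close>

lemma bmo_ball_diff_const: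
  assumes H: "H \<in> bmo_ball \<Omega> M" and M: "M > 0"
  shows "(\<lambda>x. H x - a) \<in> bmo_ball \<Omega> M"
proof -
  have L1: "H \<in> L1_loc \<Omega>" using H by (simp add: bmo_ball_def)
  have "(\<lambda>x. H x - a) \<in> L1_loc \<Omega>"
    unfolding L1_loc_def
  proof (intro CollectI conjI allI impI)
    show "(\<lambda>x. H x - a) \<in> borel_measurable (lebesgue_on \<Omega>)" using L1 by (auto simp: L1_loc_def)
    fix C assume C: "compact C \<and> C \<subseteq> \<Omega>"
    then have "finite_measure (lebesgue_on C)" by (intro finite_measure_lebesgue_on lmeasurable_compact) simp
    then show "integrable (lebesgue_on C) (\<lambda>x. H x - a)"
      using L1 C by (auto simp: L1_loc_def intro!: Bochner_Integration.integrable_diff finite_measure.integrable_const)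
  qed
  moreover have "bmo_seminorm \<Omega> (\<lambda>x. H x - a) = bmo_seminorm \<Omega> H"
    unfolding bmo_seminorm_def
  proof (intro SUP_cong refl)
    fix Q assume Q: "Q \<in> inner_cubes \<Omega>"
    have "average Q (\<lambda>x. H x - a) = average Q H - a"
      by (intro average_diff_const inner_cube_lmeasurable[OF Q] inner_cube_measure_pos[OF Q] bmo_ball_integrable[OF H M] Q)
    then show "ennreal (average Q (\<lambda>x. norm (H x - a - average Q (\<lambda>x. H x - a)))) = ennreal (average Q (\<lambda>x. norm (H x - average Q H)))"
      by simp
  qed
  ultimately show ?thesis using H by (simp add: bmo_ball_def)
qed

lemma superlevel_decay_lebesgue_on:
  fixes H :: "real ^ 'n \<Rightarrow> 'b::euclidean_space"
  assumes \<Omega>: "\<Omega> \<in> lmeasurable" and H: "H \<in> borel_measurable (lebesgue_on \<Omega>)"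
    and decay: "measure lebesgue {z \<in> \<Omega>. t + B < norm (H z)} \<le> 1 / 2 * measure lebesgue {z \<in> \<Omega>. t < norm (H z)}"
  shows "emeasure (lebesgue_on \<Omega>) {x \<in> space (lebesgue_on \<Omega>). t + B < norm (H x)}
    \<le> ennreal (1 / 2) * emeasure (lebesgue_on \<Omega>) {x \<in> space (lebesgue_on \<Omega>). t < norm (H x)}"
proof -
  have eq: "emeasure (lebesgue_on \<Omega>) {x \<in> space (lebesgue_on \<Omega>). s < norm (H x)} = ennreal (measure lebesgue {z \<in> \<Omega>. s < norm (H z)})" for s
  proof -
    have "{z \<in> space (lebesgue_on \<Omega>). s < norm (H z)} \<in> sets (lebesgue_on \<Omega>)"
      using H by measurable
    then have "{z \<in> \<Omega>. s < norm (H z)} \<in> lmeasurable" by (rule lmeasurable_Collect[OF \<Omega>])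
    moreover have "emeasure (lebesgue_on \<Omega>) {x \<in> space (lebesgue_on \<Omega>). s < norm (H x)} = emeasure lebesgue {z \<in> \<Omega>. s < norm (H z)}"
      using \<Omega> by (subst emeasure_restrict_space) auto
    ultimately show ?thesis by (simp only: emeasure_eq_measure2)
  qed
  show ?thesis
    unfolding eq ennreal_mult[symmetric, OF _ measure_nonneg, of "1 / 2", simplified]
    using decay by (subst ennreal_mult[symmetric]) (auto intro!: ennreal_leI)
qed

text \<open>Up to a level \<theta>, |H|^q \<le> \<theta>^(q-p) |H|^p; above it the layer cake gives
  a multiple of |{|H| > \<theta>}|, which Chebyshev bounds by \<theta>^(-p) times the integral of
  |H|^p. For \<theta> to be independent of H, the average over Q must be bounded, whereas the norm
  controls the average over \<Omega>. The decay itself, applied to H minus its average over Q,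
  bounds the difference of the two.\<close>

theorem bmo_interpolation:
  fixes \<Omega> :: "(real ^ 'n) set" and M p q :: real
  assumes \<Omega>: "lipschitz_domain \<Omega>" and M: "M > 0" and p: "p > 0" and q: "p \<le> q"
  shows "\<exists>C>0. \<forall>H :: real ^ 'n \<Rightarrow> 'b::euclidean_space. H \<in> L1_loc \<Omega> \<longrightarrow> bmo_norm \<Omega> H < ennreal M \<longrightarrow>
    integrable (lebesgue_on \<Omega>) (\<lambda>x. norm (H x) powr p) \<and>
    integrable (lebesgue_on \<Omega>) (\<lambda>x. norm (H x) powr q) \<and>
    (\<integral>x. norm (H x) powr q \<partial>lebesgue_on \<Omega>) \<le> C * (\<integral>x. norm (H x) powr p \<partial>lebesgue_on \<Omega>)"
proof -
  have op: "open \<Omega>" and bdd: "bounded \<Omega>"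
    using \<Omega> by (auto simp: lipschitz_domain_def domain_set_def)
  have lm: "\<Omega> \<in> lmeasurable" using bdd op by (rule lmeasurable_open)
  let ?N = "lebesgue_on \<Omega>"
  have fin: "finite_measure ?N" using lm by (rule finite_measure_lebesgue_on)
  obtain Q B where Q: "Q \<in> inner_cubes \<Omega>" and B: "B > 0"
    and gl: "\<forall>H :: real ^ 'n \<Rightarrow> 'b. H \<in> bmo_ball \<Omega> M \<longrightarrow>
    (\<forall>\<theta>\<ge>norm (average Q H) + B. measure lebesgue {z \<in> \<Omega>. \<theta> + B < norm (H z)}
        \<le> 1 / 2 * measure lebesgue {z \<in> \<Omega>. \<theta> < norm (H z)})"
    using good_lambda[OF \<Omega> M, where 'b='b] by (elim bexE exE conjE)
  have pos: "measure lebesgue \<Omega> > 0"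
    using inner_cube_measure_pos[OF Q] measure_mono_fmeasurable[OF inner_cube_subset_domain[OF Q] fmeasurableD[OF inner_cube_lmeasurable[OF Q]] lm]
    by linarith
  define S where "S \<theta> s = (\<Sum>j. (\<theta> + real (Suc j) * B) powr s * (1 / 2) ^ j)" for \<theta> s
  have S0: "S \<theta> s \<ge> 0" if "\<theta> > 0" "s \<ge> 0" for \<theta> s
    unfolding S_def using summable_powr_half_power[OF that(1) B that(2)] by (intro suminf_nonneg) auto
  have layer: "(\<integral>\<^sup>+ x. ennreal (norm (H x) powr s) * indicator {x \<in> space ?N. \<theta> < norm (H x)} x \<partial>?N)
      \<le> ennreal (S \<theta> s) * emeasure ?N {x \<in> space ?N. \<theta> < norm (H x)}"
    if H: "H \<in> bmo_ball \<Omega> M" and \<theta>: "norm (average Q H) + B \<le> \<theta>" and s: "s \<ge> 0" for \<theta> s and H :: "real ^ 'n \<Rightarrow> 'b"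
    unfolding S_def
  proof (rule nn_integral_superlevel_powr)
    show "(\<lambda>x. norm (H x)) \<in> borel_measurable ?N" using H by (auto simp: bmo_ball_def L1_loc_def)
    show "\<theta> > 0" using \<theta> B norm_ge_zero[of "average Q H"] by linarith
    show "emeasure ?N {x \<in> space ?N. t + B < norm (H x)} \<le> ennreal (1 / 2) * emeasure ?N {x \<in> space ?N. t < norm (H x)}"
      if "\<theta> \<le> t" for t
      using gl[rule_format, OF H, of t] \<theta> that H
      by (intro superlevel_decay_lebesgue_on[OF lm]) (auto simp: bmo_ball_def L1_loc_def)
  qed (use B s in auto)
  \<comment> \<open>Splitting at \<theta> shows that every nonnegative power is integrable over all
    of \<Omega>, although H is assumed integrable only locally.\<close>
  have finite_powr: "(\<integral>\<^sup>+ x. ennreal (norm (H x) powr s) \<partial>?N) \<le> ennreal ((\<theta> powr s + S \<theta> s) * measure lebesgue \<Omega>)"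
    if H: "H \<in> bmo_ball \<Omega> M" and \<theta>: "norm (average Q H) + B \<le> \<theta>" and s: "s \<ge> 0" for \<theta> s and H :: "real ^ 'n \<Rightarrow> 'b"
  proof -
    have [measurable]: "H \<in> borel_measurable ?N" using H by (auto simp: bmo_ball_def L1_loc_def)
    have \<theta>0: "\<theta> > 0" using \<theta> B norm_ge_zero[of "average Q H"] by linarith
    have em: "emeasure ?N (space ?N) = ennreal (measure lebesgue \<Omega>)"
      using lm by (subst emeasure_restrict_space) (auto simp: emeasure_eq_measure2)
    define E where "E = {x \<in> space ?N. \<theta> < norm (H x)}"
    have [measurable]: "E \<in> sets ?N" unfolding E_def by measurable
    have "(\<integral>\<^sup>+ x. ennreal (norm (H x) powr s) \<partial>?N)
       \<le> (\<integral>\<^sup>+ x. ennreal (\<theta> powr s) + ennreal (norm (H x) powr s) * indicator E x \<partial>?N)"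
      using s by (intro nn_integral_mono) (auto simp: E_def indicator_def intro!: ennreal_leI powr_mono2)
    also have "\<dots> = ennreal (\<theta> powr s) * emeasure ?N (space ?N) + (\<integral>\<^sup>+ x. ennreal (norm (H x) powr s) * indicator E x \<partial>?N)"
      by (subst nn_integral_add) auto
    also have "\<dots> \<le> ennreal (\<theta> powr s) * emeasure ?N (space ?N) + ennreal (S \<theta> s) * emeasure ?N E"
      unfolding E_def by (intro add_left_mono layer[OF H \<theta> s])
    also have "\<dots> \<le> ennreal (\<theta> powr s) * emeasure ?N (space ?N) + ennreal (S \<theta> s) * emeasure ?N (space ?N)"
      by (intro add_left_mono mult_left_mono emeasure_mono) (auto simp: E_def)
    also have "\<dots> = ennreal ((\<theta> powr s + S \<theta> s) * measure lebesgue \<Omega>)"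
      unfolding em using S0[OF \<theta>0 s] by (simp add: ennreal_mult ennreal_plus distrib_right[symmetric])
    finally show ?thesis .
  qed
  \<comment> \<open>A bound for the average over Q: M bounds the average over \<Omega>, and B + S B
    1 bounds the mean over \<Omega> of the normalised function, for which the decay starts at
    B.\<close>
  define \<Lambda> where "\<Lambda> = M + (B + S B 1)"
  define \<theta> where "\<theta> = \<Lambda> + B"
  have \<theta>0: "\<theta> > 0" using M B S0[OF B, of 1] by (simp add: \<theta>_def \<Lambda>_def)
  define C where "C = \<theta> powr (q - p) + S \<theta> q / \<theta> powr p"
  have C0: "C > 0" unfolding C_def using \<theta>0 S0[OF \<theta>0, of q] p q by (intro add_pos_nonneg) auto
  show ?thesis
  proof (intro exI[of _ C] conjI[OF C0] allI impI)
    fix H :: "real ^ 'n \<Rightarrow> 'b" assume L1: "H \<in> L1_loc \<Omega>" and norm: "bmo_norm \<Omega> H < ennreal M"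
    have [measurable]: "H \<in> borel_measurable ?N" using L1 by (auto simp: L1_loc_def)
    have "bmo_seminorm \<Omega> H \<le> bmo_norm \<Omega> H" by (simp add: bmo_norm_def)
    then have H: "H \<in> bmo_ball \<Omega> M" using L1 norm by (simp add: bmo_ball_def)
    have "ennreal (norm (average \<Omega> H)) \<le> bmo_norm \<Omega> H" by (simp add: bmo_norm_def)
    then have "ennreal (norm (average \<Omega> H)) < ennreal M" using norm by (rule le_less_trans)
    then have mean: "norm (average \<Omega> H) < M" by (simp add: ennreal_less_iff)
    define a where "a = average Q H"
    define H' where "H' x = H x - a" for x
    have H': "H' \<in> bmo_ball \<Omega> M" unfolding H'_def by (rule bmo_ball_diff_const[OF H M])
    have avg0: "average Q H' = 0"
      unfolding H'_def a_def
      using average_diff_const[OF inner_cube_lmeasurable[OF Q] inner_cube_measure_pos[OF Q] bmo_ball_integrable[OF H M Q], of "average Q H"] by simp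
    have nnH': "(\<integral>\<^sup>+ x. ennreal (norm (H' x)) \<partial>?N) \<le> ennreal ((B + S B 1) * measure lebesgue \<Omega>)"
      using finite_powr[OF H', of B 1] avg0 B by simp
    have intH': "integrable ?N H'"
      using nnH' unfolding H'_def by (intro integrableI_bounded) (auto intro: le_less_trans)
    have "integrable ?N (\<lambda>x. H' x + a)"
      using intH' finite_measure.integrable_const[OF fin] by (intro Bochner_Integration.integrable_add)
    \<comment> \<open>The hypothesis on the average over \<Omega> carries information only now: for
      a nonintegrable function that average would be 0 by convention.\<close>
    then have intH: "integrable ?N H" by (simp add: H'_def)
    have "norm (average \<Omega> H - a) \<le> average \<Omega> (\<lambda>x. norm (H' x))"
      unfolding H'_def by (rule norm_average_diff_le[OF lm pos intH])
    also have "\<dots> \<le> B + S B 1"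
    proof -
      have "ennreal (\<integral>x. norm (H' x) \<partial>?N) \<le> ennreal ((B + S B 1) * measure lebesgue \<Omega>)"
        using nnH' intH' by (subst nn_integral_eq_integral[symmetric]) auto
      then have "(\<integral>x. norm (H' x) \<partial>?N) \<le> (B + S B 1) * measure lebesgue \<Omega>"
        using B S0[OF B, of 1] by (subst (asm) ennreal_le_iff) auto
      then show ?thesis unfolding average_def using pos by (simp add: divide_le_eq)
    qed
    finally have "norm a \<le> \<Lambda>"
      using mean norm_triangle_ineq3[of "average \<Omega> H" a] unfolding \<Lambda>_def by linarith
    then have \<theta>: "norm (average Q H) + B \<le> \<theta>" by (simp add: \<theta>_def a_def)
    have int: "integrable ?N (\<lambda>x. norm (H x) powr s)" if "s \<ge> 0" for s
      using finite_powr[OF H \<theta> that] by (intro integrableI_bounded) (auto intro: le_less_trans)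
    define E where "E = {x \<in> space ?N. \<theta> < norm (H x)}"
    have E[measurable]: "E \<in> sets ?N" unfolding E_def by measurable
    have Cheb: "emeasure ?N E \<le> ennreal (1 / \<theta> powr p) * (\<integral>\<^sup>+ x. ennreal (norm (H x) powr p) \<partial>?N)"
    proof -
      have "emeasure ?N E = (\<integral>\<^sup>+ x. indicator E x \<partial>?N)" by simp
      also have "\<dots> \<le> (\<integral>\<^sup>+ x. ennreal (1 / \<theta> powr p) * ennreal (norm (H x) powr p) \<partial>?N)"
      proof (intro nn_integral_mono)
        fix x
        have "1 \<le> 1 / \<theta> powr p * norm (H x) powr p" if "\<theta> < norm (H x)"
          using that \<theta>0 p powr_mono2[of p \<theta> "norm (H x)"] by (simp add: le_divide_eq)
        then show "indicator E x \<le> ennreal (1 / \<theta> powr p) * ennreal (norm (H x) powr p)"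
          by (auto simp: E_def indicator_def ennreal_mult[symmetric] simp del: ennreal_1 simp flip: ennreal_1 intro!: ennreal_leI)
      qed
      also have "\<dots> = ennreal (1 / \<theta> powr p) * (\<integral>\<^sup>+ x. ennreal (norm (H x) powr p) \<partial>?N)"
        by (intro nn_integral_cmult) measurable
      finally show ?thesis .
    qed
    have "(\<integral>\<^sup>+ x. ennreal (norm (H x) powr q) \<partial>?N)
       \<le> (\<integral>\<^sup>+ x. ennreal (\<theta> powr (q - p)) * ennreal (norm (H x) powr p) + ennreal (norm (H x) powr q) * indicator E x \<partial>?N)"
    proof (intro nn_integral_mono)
      fix x assume x: "x \<in> space ?N"
      show "ennreal (norm (H x) powr q) \<le> ennreal (\<theta> powr (q - p)) * ennreal (norm (H x) powr p) + ennreal (norm (H x) powr q) * indicator E x"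
      proof (cases "\<theta> < norm (H x)")
        case False
        have "norm (H x) powr q = norm (H x) powr (q - p) * norm (H x) powr p"
          by (simp flip: powr_add)
        also have "\<dots> \<le> \<theta> powr (q - p) * norm (H x) powr p"
          using False q by (intro mult_right_mono powr_mono2) auto
        finally have "ennreal (norm (H x) powr q) \<le> ennreal (\<theta> powr (q - p)) * ennreal (norm (H x) powr p)"
          by (simp add: ennreal_leI flip: ennreal_mult)
        then show ?thesis using False by (simp add: E_def)
      qed (use x in \<open>simp add: E_def\<close>)
    qed
    also have "\<dots> = ennreal (\<theta> powr (q - p)) * (\<integral>\<^sup>+ x. ennreal (norm (H x) powr p) \<partial>?N)
       + (\<integral>\<^sup>+ x. ennreal (norm (H x) powr q) * indicator E x \<partial>?N)"
      by (subst nn_integral_add) (auto simp: nn_integral_cmult)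
    also have "\<dots> \<le> ennreal (\<theta> powr (q - p)) * (\<integral>\<^sup>+ x. ennreal (norm (H x) powr p) \<partial>?N)
       + ennreal (S \<theta> q) * (ennreal (1 / \<theta> powr p) * (\<integral>\<^sup>+ x. ennreal (norm (H x) powr p) \<partial>?N))"
      using layer[OF H \<theta>, of q] p q unfolding E_def[symmetric]
      by (intro add_left_mono order_trans[OF _ mult_left_mono[OF Cheb]]) auto
    also have "\<dots> = ennreal C * (\<integral>\<^sup>+ x. ennreal (norm (H x) powr p) \<partial>?N)"
    proof -
      have "ennreal C = ennreal (\<theta> powr (q - p)) + ennreal (S \<theta> q) * ennreal (1 / \<theta> powr p)"
        unfolding C_def using S0[OF \<theta>0, of q] p q
        by (subst ennreal_mult[symmetric]) (auto simp: ennreal_plus[symmetric] simp del: ennreal_plus)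
      then show ?thesis by (simp add: distrib_right mult.assoc)
    qed
    finally have "ennreal (\<integral>x. norm (H x) powr q \<partial>?N) \<le> ennreal C * ennreal (\<integral>x. norm (H x) powr p \<partial>?N)"
      using int[of p] int[of q] p q by (subst (asm) (1 2) nn_integral_eq_integral) auto
    then have "(\<integral>x. norm (H x) powr q \<partial>?N) \<le> C * (\<integral>x. norm (H x) powr p \<partial>?N)"
      using C0 by (subst (asm) ennreal_mult[symmetric]) (auto simp: ennreal_le_iff)
    then show "integrable ?N (\<lambda>x. norm (H x) powr p) \<and> integrable ?N (\<lambda>x. norm (H x) powr q) \<and>
      (\<integral>x. norm (H x) powr q \<partial>?N) \<le> C * (\<integral>x. norm (H x) powr p \<partial>?N)"
      using p q by (auto intro: int)
  qed
qed

section \<open>Taylor expansion\<close>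

lemma C_class_differentiable: "C_class k f \<Longrightarrow> length Hs < k \<Longrightarrow> Dn f Hs differentiable (at K)"
  by (simp add: C_class_def)

text \<open>The first slot holds the outermost derivative and is linear as such. For a later slot,
  the expansion is valid at all points and can be differentiated in the directions before it; the
  strict length bound ensures that these derivatives exist.\<close>

lemma Dn_slot_expand:
  assumes "C_class k f" "length Hs1 + length Hs2 < k"
  shows "Dn f (Hs1 @ H # Hs2) K = (\<Sum>b\<in>Basis. (H \<bullet> b) * Dn f (Hs1 @ b # Hs2) K)"
  using assms(2)
proof (induction Hs1 arbitrary: K)
  case Nil
  have lin: "linear (frechet_derivative (Dn f Hs2) (at K))"
    using C_class_differentiable[OF assms(1)] Nil by (intro linear_frechet_derivative) auto
  have "frechet_derivative (Dn f Hs2) (at K) H = frechet_derivative (Dn f Hs2) (at K) (\<Sum>b\<in>Basis. (H \<bullet> b) *\<^sub>R b)"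
    by (simp only: euclidean_representation)
  also have "\<dots> = (\<Sum>b\<in>Basis. (H \<bullet> b) * frechet_derivative (Dn f Hs2) (at K) b)"
    using lin by (simp add: linear_sum linear_scale)
  finally show ?case by simp
next
  case (Cons H1 Hs1)
  have diff: "Dn f (Hs1 @ b # Hs2) differentiable (at K)" for b
    using Cons.prems by (intro C_class_differentiable[OF assms(1)]) simp
  have eq: "Dn f (Hs1 @ H # Hs2) = (\<lambda>K. \<Sum>b\<in>Basis. (H \<bullet> b) * Dn f (Hs1 @ b # Hs2) K)"
    using Cons by (intro ext) simp
  have "((\<lambda>K. \<Sum>b\<in>Basis. (H \<bullet> b) * Dn f (Hs1 @ b # Hs2) K) has_derivative
      (\<lambda>h. \<Sum>b\<in>Basis. (H \<bullet> b) * frechet_derivative (Dn f (Hs1 @ b # Hs2)) (at K) h)) (at K)"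
    by (intro has_derivative_sum has_derivative_mult_right frechet_derivative_works[THEN iffD1] diff)
  then have "frechet_derivative (\<lambda>K. \<Sum>b\<in>Basis. (H \<bullet> b) * Dn f (Hs1 @ b # Hs2) K) (at K)
     = (\<lambda>h. \<Sum>b\<in>Basis. (H \<bullet> b) * frechet_derivative (Dn f (Hs1 @ b # Hs2)) (at K) h)"
    by (rule frechet_derivative_at[symmetric])
  then show ?case by (simp add: eq)
qed

text \<open>Needed because the supremum in \<open>multilinear_norm\<close> is meaningful only for a
  bounded set. There are finitely many lists of basis vectors, and freeing the slots one at a time
  costs a factor DIM('a) each.\<close>

lemma Dn_bounded_on_unit_vectors:
  fixes f :: "'a::euclidean_space \<Rightarrow> real"
  assumes f: "C_class k f"
  shows "\<exists>B. \<forall>Hs. length Hs = k \<and> (\<forall>H\<in>set Hs. norm H \<le> 1) \<longrightarrow> \<bar>Dn f Hs K\<bar> \<le> B"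
proof -
  have "\<exists>B\<ge>0. \<forall>Hs bs. length Hs = m \<and> length bs = k - m \<and> (\<forall>H\<in>set Hs. norm H \<le> 1) \<and> set bs \<subseteq> Basis
      \<longrightarrow> \<bar>Dn f (Hs @ bs) K\<bar> \<le> B" if "m \<le> k" for m
    using that
  proof (induction m)
    case 0
    have fin: "finite {bs :: 'a list. set bs \<subseteq> Basis \<and> length bs = k}"
      by (intro finite_lists_length_eq finite_Basis)
    have "\<bar>Dn f bs K\<bar> \<le> (\<Sum>bs\<in>{bs. set bs \<subseteq> Basis \<and> length bs = k}. \<bar>Dn f bs K\<bar>)"
      if "set bs \<subseteq> Basis" "length bs = k" for bs
      using that by (intro member_le_sum fin) auto
    then show ?case
      by (intro exI[of _ "\<Sum>bs\<in>{bs. set bs \<subseteq> Basis \<and> length bs = k}. \<bar>Dn f bs K\<bar>"]) (auto intro: sum_nonneg)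
  next
    case (Suc m)
    then obtain B where B: "B \<ge> 0" "\<And>Hs bs. length Hs = m \<Longrightarrow> length bs = k - m \<Longrightarrow> (\<forall>H\<in>set Hs. norm H \<le> 1) \<Longrightarrow>
        set bs \<subseteq> Basis \<Longrightarrow> \<bar>Dn f (Hs @ bs) K\<bar> \<le> B" by auto
    have "\<bar>Dn f (Hs @ bs) K\<bar> \<le> real DIM('a) * B"
      if Hs: "length Hs = Suc m" "length bs = k - Suc m" "\<forall>H\<in>set Hs. norm H \<le> 1" "set bs \<subseteq> Basis" for Hs bs
    proof -
      obtain Hs' H where split: "Hs = Hs' @ [H]" using Hs(1) by (metis length_Suc_conv_rev)
      have "length Hs' + length bs < k" using Hs split Suc.prems by simp
      then have "Dn f (Hs @ bs) K = (\<Sum>b\<in>Basis. (H \<bullet> b) * Dn f (Hs' @ b # bs) K)"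
        using Dn_slot_expand[OF f, of Hs' bs H K] split by simp
      also have "\<bar>\<dots>\<bar> \<le> (\<Sum>b\<in>(Basis :: 'a set). 1 * B)"
      proof (intro order_trans[OF sum_abs] sum_mono)
        fix b :: 'a assume b: "b \<in> Basis"
        have "\<bar>H \<bullet> b\<bar> \<le> 1" using Basis_le_norm[OF b, of H] Hs(3) split by simp
        moreover have "\<bar>Dn f (Hs' @ b # bs) K\<bar> \<le> B"
          using B(2)[of Hs' "b # bs"] Hs split b Suc.prems by simp
        ultimately show "\<bar>(H \<bullet> b) * Dn f (Hs' @ b # bs) K\<bar> \<le> 1 * B"
          unfolding abs_mult by (intro mult_mono) auto
      qed
      finally show ?thesis by simp
    qed
    then show ?case using B(1) by (intro exI[of _ "real DIM('a) * B"]) auto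
  qed
  from this[of k] obtain B where "\<forall>Hs bs. length Hs = k \<and> length bs = k - k \<and> (\<forall>H\<in>set Hs. norm H \<le> 1) \<and> set bs \<subseteq> Basis
      \<longrightarrow> \<bar>Dn f (Hs @ bs) K\<bar> \<le> B" by auto
  from this[THEN spec, THEN spec, of _ "[]"] show ?thesis by auto
qed

text \<open>The identity for j holds at every point; differentiating it in direction c H adds one
  factor c.\<close>

lemma Dn_replicate_scale:
  assumes "C_class k f" "j \<le> k"
  shows "Dn f (replicate j (c *\<^sub>R H)) K = c ^ j * Dn f (replicate j H) K"
  using assms(2)
proof (induction j arbitrary: K)
  case (Suc j)
  have diff: "Dn f (replicate j H) differentiable (at K)"
    using Suc.prems by (intro C_class_differentiable[OF assms(1)]) simp
  have eq: "Dn f (replicate j (c *\<^sub>R H)) = (\<lambda>K. c ^ j * Dn f (replicate j H) K)"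
    using Suc by (intro ext) simp
  have "((\<lambda>K. c ^ j * Dn f (replicate j H) K) has_derivative
     (\<lambda>h. c ^ j * frechet_derivative (Dn f (replicate j H)) (at K) h)) (at K)"
    by (intro has_derivative_mult_right frechet_derivative_works[THEN iffD1] diff)
  then have "frechet_derivative (\<lambda>K. c ^ j * Dn f (replicate j H) K) (at K)
     = (\<lambda>h. c ^ j * frechet_derivative (Dn f (replicate j H)) (at K) h)"
    by (rule frechet_derivative_at[symmetric])
  then show ?case
    using linear_scale[OF linear_frechet_derivative[OF diff], of c H] by (simp add: eq)
qed simp

lemma Dn_replicate_le_multilinear_norm:
  assumes f: "C_class k f"
  shows "\<bar>Dn f (replicate k H) K\<bar> \<le> multilinear_norm k (\<lambda>Hs. Dn f Hs K) * norm H ^ k"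
proof -
  \<comment> \<open>For H = 0 division by zero yields u = 0, and H = |H| u still holds.\<close>
  define u where "u = (1 / norm H) *\<^sub>R H"
  have u: "norm u \<le> 1" "H = norm H *\<^sub>R u" by (auto simp: u_def)
  obtain B where B: "\<forall>Hs. length Hs = k \<and> (\<forall>H\<in>set Hs. norm H \<le> 1) \<longrightarrow> \<bar>Dn f Hs K\<bar> \<le> B"
    using Dn_bounded_on_unit_vectors[OF f] by blast
  have "\<bar>Dn f (replicate k u) K\<bar> \<le> multilinear_norm k (\<lambda>Hs. Dn f Hs K)"
    unfolding multilinear_norm_def
  proof (rule cSUP_upper)
    show "replicate k u \<in> {Hs. length Hs = k \<and> (\<forall>H\<in>set Hs. norm H \<le> 1)}" using u(1) by simp
    show "bdd_above ((\<lambda>Hs. \<bar>Dn f Hs K\<bar>) ` {Hs. length Hs = k \<and> (\<forall>H\<in>set Hs. norm H \<le> 1)})"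
      using B by (auto intro!: bdd_aboveI[of _ B])
  qed
  moreover have "Dn f (replicate k H) K = norm H ^ k * Dn f (replicate k u) K"
    using Dn_replicate_scale[OF f order_refl, of "norm H" u K] u(2) by simp
  ultimately show ?thesis by (simp add: abs_mult mult.commute mult_left_mono)
qed

text \<open>The Maclaurin formula with Lagrange remainder for t \<mapsto> f (F + t H), evaluated at
  1.\<close>

lemma Dn_Taylor:
  assumes f: "C_class k f" and k: "k > 0"
  shows "\<exists>t. 0 < t \<and> t < 1 \<and> f (F + H) = (\<Sum>j<k. Dn f (replicate j H) F / fact j)
    + Dn f (replicate k H) (F + t *\<^sub>R H) / fact k"
proof -
  let ?d = "\<lambda>m t. Dn f (replicate m H) (F + t *\<^sub>R H)"
  have "\<exists>t>0. t < 1 \<and> ?d 0 1 = (\<Sum>m<k. ?d m 0 / fact m * 1 ^ m) + ?d k t / fact k * 1 ^ k"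
  proof (rule Maclaurin)
    show "\<forall>m t. m < k \<and> 0 \<le> t \<and> t \<le> 1 \<longrightarrow> (?d m has_real_derivative ?d (Suc m) t) (at t)"
    proof (intro allI impI)
      fix m and t :: real assume m: "m < k \<and> 0 \<le> t \<and> t \<le> 1"
      let ?g = "Dn f (replicate m H)"
      let ?D = "frechet_derivative ?g (at (F + t *\<^sub>R H))"
      have diff: "?g differentiable (at (F + t *\<^sub>R H))"
        using m by (intro C_class_differentiable[OF f]) simp
      have "((\<lambda>t. F + t *\<^sub>R H) has_derivative (\<lambda>s. s *\<^sub>R H)) (at t)"
        by (auto intro!: derivative_eq_intros)
      then have "((\<lambda>t. ?g (F + t *\<^sub>R H)) has_derivative (\<lambda>s. ?D (s *\<^sub>R H))) (at t)"
        using frechet_derivative_works[THEN iffD1, OF diff] by (rule has_derivative_compose)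
      then show "(?d m has_real_derivative ?d (Suc m) t) (at t)"
        unfolding has_field_derivative_def
        by (simp add: linear_scale[OF linear_frechet_derivative[OF diff]] mult.commute[of _ "?D H"])
    qed
  qed (use k in auto)
  then show ?thesis by auto
qed

text \<open>R + |H| is at most the maximum of 2 R and 2 |H|, so |F + t H|^r \<le> (2 R)^r + (2
  |H|)^r for every r > 0, whether below or above 1. Multiplication by |H|^k produces the two powers
  to be interpolated; the factor 1 / k! is estimated by 1.\<close>

lemma Taylor_remainder_bound:
  assumes f: "C_class k f" and k: "k > 0" and r: "r > 0" and c: "c > 0"
    and bound: "\<And>K. multilinear_norm k (\<lambda>Hs. Dn f Hs K) \<le> c * (1 + norm K powr r)"
    and F: "norm F \<le> R"
  shows "\<bar>f (F + H) - (\<Sum>j<k. 1 / fact j * Dn f (replicate j H) F)\<bar>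
    \<le> c * (1 + (2 * R) powr r) * norm H ^ k + c * 2 powr r * norm H powr (real k + r)"
proof -
  obtain t where t: "0 < t" "t < 1" and eq: "f (F + H) = (\<Sum>j<k. Dn f (replicate j H) F / fact j)
    + Dn f (replicate k H) (F + t *\<^sub>R H) / fact k"
    using Dn_Taylor[OF f k] by blast
  let ?K = "F + t *\<^sub>R H"
  have R: "R \<ge> 0" using F norm_ge_zero order_trans by blast
  have "norm ?K \<le> R + norm H"
  proof -
    have "norm ?K \<le> norm F + t * norm H" using norm_triangle_ineq[of F "t *\<^sub>R H"] t by simp
    moreover have "t * norm H \<le> 1 * norm H" using t by (intro mult_right_mono) auto
    ultimately show ?thesis using F by simp
  qed
  then have "norm ?K \<le> max (2 * R) (2 * norm H)" by simp
  then have "norm ?K powr r \<le> (max (2 * R) (2 * norm H)) powr r" using r by (intro powr_mono2) auto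
  also have "\<dots> \<le> (2 * R) powr r + (2 * norm H) powr r" by (auto simp: max_def)
  finally have K: "norm ?K powr r \<le> (2 * R) powr r + 2 powr r * norm H powr r"
    by (simp add: powr_mult)
  have "\<bar>f (F + H) - (\<Sum>j<k. 1 / fact j * Dn f (replicate j H) F)\<bar> = \<bar>Dn f (replicate k H) ?K\<bar> / fact k"
    unfolding eq by simp
  also have "\<dots> \<le> \<bar>Dn f (replicate k H) ?K\<bar> / 1"
    by (intro divide_left_mono) (auto simp: fact_ge_1)
  also have "\<dots> \<le> multilinear_norm k (\<lambda>Hs. Dn f Hs ?K) * norm H ^ k"
    using Dn_replicate_le_multilinear_norm[OF f] by simp
  also have "\<dots> \<le> c * (1 + ((2 * R) powr r + 2 powr r * norm H powr r)) * norm H ^ k"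
    using bound[of ?K] K c by (intro mult_right_mono) (auto intro: order_trans mult_left_mono)
  also have "\<dots> = c * (1 + (2 * R) powr r) * norm H ^ k + c * 2 powr r * (norm H powr r * norm H ^ k)"
    by (simp add: algebra_simps)
  also have "norm H powr r * norm H ^ k = norm H powr (real k + r)"
    using k by (simp add: powr_add powr_realpow')
  finally show ?thesis .
qed

section \<open>Superposition with a Caratheodory function\<close>

text \<open>Restricting Lebesgue measure to a measurable set keeps it complete, so changes on null
  sets preserve measurability.\<close>

lemma borel_measurable_lebesgue_on_AE_cong:
  fixes f g :: "'a::euclidean_space \<Rightarrow> 'b::topological_space"
  assumes \<Omega>: "\<Omega> \<in> sets lebesgue" and f: "f \<in> borel_measurable (lebesgue_on \<Omega>)"
    and eq: "AE x in lebesgue_on \<Omega>. f x = g x"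
  shows "g \<in> borel_measurable (lebesgue_on \<Omega>)"
proof -
  interpret complete_measure "lebesgue_on \<Omega>"
  proof
    fix A B assume "B \<subseteq> A" "A \<in> null_sets (lebesgue_on \<Omega>)"
    then have "A \<subseteq> \<Omega>" "A \<in> null_sets lebesgue" using \<Omega> by (auto simp: null_sets_restrict_space)
    then have "B \<in> sets lebesgue" using \<open>B \<subseteq> A\<close> completion.complete by blast
    then show "B \<in> sets (lebesgue_on \<Omega>)"
      using \<Omega> \<open>A \<subseteq> \<Omega>\<close> \<open>B \<subseteq> A\<close> by (simp add: sets_restrict_space_iff)
  qed
  show ?thesis
  proof (rule measurableI)
    fix A :: "'b set" assume A: "A \<in> sets borel"
    show "g -` A \<inter> space (lebesgue_on \<Omega>) \<in> sets (lebesgue_on \<Omega>)"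
    proof (rule in_sets_AE)
      show "f -` A \<inter> space (lebesgue_on \<Omega>) \<in> sets (lebesgue_on \<Omega>)"
        using f A by (rule measurable_sets)
      show "AE x in lebesgue_on \<Omega>. (x \<in> f -` A \<inter> space (lebesgue_on \<Omega>)) = (x \<in> g -` A \<inter> space (lebesgue_on \<Omega>))"
        using eq by eventually_elim auto
    qed simp
  qed simp
qed

text \<open>Joint Lebesgue measurability only controls almost every section, so the values on a countable
  dense set of good sections are extended to all of them by continuity.\<close>

lemma borel_measurable_superposition:
  fixes W :: "'a::euclidean_space \<Rightarrow> 'b::euclidean_space \<Rightarrow> real"
  assumes \<Omega>: "open \<Omega>" and W: "(\<lambda>(x, K). W x K) \<in> borel_measurable (lebesgue_on (\<Omega> \<times> UNIV))"
    and cont: "AE x in lebesgue_on \<Omega>. continuous_on UNIV (W x)"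
    and G: "G \<in> borel_measurable (lebesgue_on \<Omega>)"
  shows "(\<lambda>x. W x (G x)) \<in> borel_measurable (lebesgue_on \<Omega>)"
proof -
  have \<Omega>m: "\<Omega> \<in> sets lebesgue" using \<Omega> by auto
  define u where "u z = (if z \<in> \<Omega> \<times> UNIV then W (fst z) (snd z) else 0)" for z :: "'a \<times> 'b"
  have "\<Omega> \<times> (UNIV :: 'b set) \<in> sets lebesgue" using \<Omega> by (simp add: open_Times)
  then have "u \<in> borel_measurable lebesgue"
    using W unfolding u_def by (simp add: borel_measurable_if case_prod_unfold)
  \<comment> \<open>Sections of a Lebesgue measurable function may fail to be measurable; those of a
    Borel representative cannot.\<close>
  then obtain v where v[measurable]: "v \<in> borel_measurable lborel" and uv: "AE z in lborel. u z = v z"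
    using completion_ex_borel_measurable_real by blast
  obtain N where N: "{z \<in> space lborel. u z \<noteq> v z} \<subseteq> N" "emeasure lborel N = 0" "N \<in> sets lborel"
    using uv by (rule AE_E)
  have Np: "N \<in> sets (lborel \<Otimes>\<^sub>M lborel)" unfolding lborel_prod by (rule N(3))
  have "AE z in lborel \<Otimes>\<^sub>M lborel. z \<notin> N"
    unfolding lborel_prod by (rule AE_not_in[OF null_setsI[OF N(2,3)]])
  then have "AE x in lborel. AE K in lborel. (x, K) \<notin> N"
    by (rule lborel_pair.AE_pair)
  \<comment> \<open>Fubini's theorem for the null set N with the order of the variables exchanged,
    since sections at fixed K are needed.\<close>
  then have "AE K in lborel. AE x in lborel. (x, K) \<notin> N"
  proof (subst (asm) lborel_pair.AE_commute)
    have "{x \<in> space (lborel \<Otimes>\<^sub>M lborel). (fst x, snd x) \<notin> N} = space (lborel \<Otimes>\<^sub>M lborel) - N" by auto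
    then show "{x \<in> space (lborel \<Otimes>\<^sub>M lborel). (fst x, snd x) \<notin> N} \<in> sets (lborel \<Otimes>\<^sub>M lborel)"
      using sets.compl_sets[OF Np] by (simp only:)
  qed
  then have "AE K in lborel. AE x in lborel. u (x, K) = v (x, K)"
    by eventually_elim (use N(1) in \<open>auto elim!: eventually_mono\<close>)
  then have "AE K in lebesgue. AE x in lborel. u (x, K) = v (x, K)"
    by (rule AE_completion)
  then have neg: "negligible {K. \<not> (AE x in lborel. u (x, K) = v (x, K))}"
    by (simp add: negligible_iff_null_sets completion.AE_iff_null_sets)
  \<comment> \<open>The good sections. The complement of D is null and hence contains no ball, so D
    is dense.\<close>
  define D where "D = {K. AE x in lborel. u (x, K) = v (x, K)}"
  have dense: "K \<in> closure D" for K
  proof (rule ccontr)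
    assume "K \<notin> closure D"
    then obtain r where r: "r > 0" "ball K r \<subseteq> - closure D"
      using open_contains_ball[of "- closure D"] by (metis ComplI closed_closure open_Compl)
    then have "ball K r \<subseteq> {K. \<not> (AE x in lborel. u (x, K) = v (x, K))}"
      using closure_subset[of D] unfolding D_def by blast
    then have "negligible (ball K r)" using neg negligible_subset by blast
    then show False using r(1) open_not_negligible[of "ball K r"] by simp
  qed
  obtain T where T: "countable T" "T \<subseteq> D" "D \<subseteq> closure T"
    using separable[of D] by blast
  have denseT: "K \<in> closure T" for K using dense[of K] T(3) closure_minimal[OF T(3)] by auto
  then have Tne: "T \<noteq> {}" by auto
  define t where "t = from_nat_into T"
  have range_t: "range t = T" unfolding t_def using range_from_nat_into[OF Tne T(1)] .
  have near: "\<exists>i. dist (t i) K < 1 / real (Suc m)" for K m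
    using denseT[of K] unfolding closure_approachable range_t[symmetric] by auto
  \<comment> \<open>Taking the least index makes \<open>c m (G x)\<close> a measurable function of x
    with countably many values, so each approximation is patched together from sections at the
    points \<open>t i\<close>.\<close>
  define c where "c m K = (LEAST i. dist (t i) K < 1 / real (Suc m))" for m K
  have c_near: "dist (t (c m K)) K < 1 / real (Suc m)" for m K
    unfolding c_def using near by (rule LeastI_ex)
  have [measurable]: "G \<in> borel_measurable (lebesgue_on \<Omega>)" by (rule G)
  have id: "(\<lambda>x. x) \<in> borel_measurable (lebesgue_on \<Omega>)"
    by (intro measurable_restrict_space1 measurable_completion) simp
  have cG: "(\<lambda>x. c m (G x)) \<in> measurable (lebesgue_on \<Omega>) (count_space UNIV)" for m
    unfolding c_def by measurable
  have vm: "(\<lambda>x. v (x, t i)) \<in> borel_measurable (lebesgue_on \<Omega>)" for i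
  proof -
    have "(\<lambda>x. v (x, t i)) \<in> borel_measurable borel"
      using v by (simp add: measurable_lborel1) measurable
    then show ?thesis using id by (rule measurable_compose[rotated])
  qed
  have meas: "(\<lambda>x. v (x, t (c m (G x)))) \<in> borel_measurable (lebesgue_on \<Omega>)" for m
    using vm cG by (rule measurable_compose_countable)
  \<comment> \<open>Countability of T lets one null set serve all its points.\<close>
  have "AE x in lborel. \<forall>i. u (x, t i) = v (x, t i)"
    unfolding AE_all_countable using T(2) range_t by (auto simp: D_def)
  then have "AE x in lebesgue. \<forall>i. u (x, t i) = v (x, t i)" by (rule AE_completion)
  then have "AE x in lebesgue_on \<Omega>. \<forall>i. u (x, t i) = v (x, t i)"
    using \<Omega> by (subst AE_restrict_space_iff) auto
  moreover have "AE x in lebesgue_on \<Omega>. x \<in> \<Omega>" by (rule AE_I2) simp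
  ultimately have conv: "AE x in lebesgue_on \<Omega>. (\<lambda>m. v (x, t (c m (G x)))) \<longlonglongrightarrow> W x (G x)"
    using cont
  proof eventually_elim
    case (elim x)
    have "(\<lambda>m. dist (t (c m (G x))) (G x)) \<longlonglongrightarrow> 0"
    proof (rule tendsto_sandwich[OF _ _ tendsto_const])
      show "(\<lambda>m. 1 / real (Suc m)) \<longlonglongrightarrow> 0"
        using LIMSEQ_inverse_real_of_nat by (simp add: inverse_eq_divide)
      show "\<forall>\<^sub>F m in sequentially. dist (t (c m (G x))) (G x) \<le> 1 / real (Suc m)"
        by (intro always_eventually allI less_imp_le c_near)
    qed simp
    then have "(\<lambda>m. t (c m (G x))) \<longlonglongrightarrow> G x" by (rule tendsto_dist_iff[THEN iffD2])
    then have "(\<lambda>m. W x (t (c m (G x)))) \<longlonglongrightarrow> W x (G x)"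
      by (rule continuous_on_tendsto_compose[OF elim(3)]) auto
    moreover have "v (x, t i) = W x (t i)" for i
      using spec[OF elim(1), of i] elim(2) by (simp add: u_def)
    ultimately show ?case by simp
  qed
  have "(\<lambda>x. lim (\<lambda>m. v (x, t (c m (G x))))) \<in> borel_measurable (lebesgue_on \<Omega>)"
    using meas by (rule borel_measurable_lim_metric)
  moreover have "AE x in lebesgue_on \<Omega>. lim (\<lambda>m. v (x, t (c m (G x)))) = W x (G x)"
    using conv by eventually_elim (rule limI)
  ultimately show ?thesis
    by (rule borel_measurable_lebesgue_on_AE_cong[OF \<Omega>m])
qed

section \<open>Extended integrals\<close>

lemma ereal_sum_eq_MInfty:
  fixes f :: "'a \<Rightarrow> ereal"
  assumes "finite I" "i \<in> I" "f i = - \<infinity>" "\<And>j. j \<in> I \<Longrightarrow> f j \<noteq> \<infinity>"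
  shows "sum f I = - \<infinity>"
proof -
  have "sum f (I - {i}) \<noteq> \<infinity>" using assms by (simp add: sum_Pinfty)
  then show ?thesis using assms by (simp add: sum.remove[of I i])
qed

text \<open>Infinite integrals cannot be subtracted, so the pointwise bounds are first rearranged
  into inequalities between sums of nonnegative functions; the signs return only once finiteness is
  settled.\<close>

lemma ext_integral_sandwich:
  fixes T :: "nat \<Rightarrow> 'a \<Rightarrow> real" and a :: "nat \<Rightarrow> real" and w R :: "'a \<Rightarrow> real"
  assumes T: "integrals_summable N k T" and a: "\<And>j. a j > 0"
    and w[measurable]: "w \<in> borel_measurable N" and R: "integrable N R" "\<And>x. R x \<ge> 0"
    and bound: "AE x in N. \<bar>w x - (\<Sum>j<k. a j * T j x)\<bar> \<le> R x"
  shows "ext_integrable N w"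
    and "(\<Sum>j<k. ereal (a j) * ext_integral N (T j)) - ereal (\<integral>x. R x \<partial>N) \<le> ext_integral N w"
proof -
  have [measurable]: "T j \<in> borel_measurable N" if "j < k" for j
    using T that by (auto simp: integrals_summable_def ext_integrable_def)
  have [measurable]: "R \<in> borel_measurable N" using R by auto
  define P where "P j = (\<integral>\<^sup>+ x. ennreal (T j x) \<partial>N)" for j
  define Q where "Q j = (\<integral>\<^sup>+ x. ennreal (- T j x) \<partial>N)" for j
  define p where "p = (\<integral>\<^sup>+ x. ennreal (w x) \<partial>N)"
  define q where "q = (\<integral>\<^sup>+ x. ennreal (- w x) \<partial>N)"
  define \<rho> where "\<rho> = (\<integral>x. R x \<partial>N)"
  have \<rho>: "\<rho> \<ge> 0" "(\<integral>\<^sup>+ x. ennreal (R x) \<partial>N) = ennreal \<rho>"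
    unfolding \<rho>_def using R by (auto intro: integral_nonneg_AE nn_integral_eq_integral)
  have extT: "ext_integral N (T j) = enn2ereal (P j) - enn2ereal (Q j)" for j
    by (simp add: ext_integral_def P_def Q_def)
  have extw: "ext_integral N w = enn2ereal p - enn2ereal q"
    by (simp add: ext_integral_def p_def q_def)
  have emax: "ennreal y = ennreal (max 0 y)" for y by (simp add: ennreal_eq_0_iff max_def)
  have intsum: "(\<integral>\<^sup>+ x. (\<Sum>j<k. ennreal (a j) * ennreal (s * T j x)) \<partial>N) = (\<Sum>j<k. ennreal (a j) * (\<integral>\<^sup>+ x. ennreal (s * T j x) \<partial>N))" for s :: real
    by (subst nn_integral_sum) (auto simp: nn_integral_cmult)
  have esum: "(\<Sum>j<k. ennreal (a j) * ennreal (y j)) = ennreal (\<Sum>j<k. a j * max 0 (y j))" for y :: "nat \<Rightarrow> real"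
  proof -
    have "(\<Sum>j<k. ennreal (a j) * ennreal (y j)) = (\<Sum>j<k. ennreal (a j * max 0 (y j)))"
      using a by (intro sum.cong refl) (subst emax, simp add: ennreal_mult less_imp_le)
    also have "\<dots> = ennreal (\<Sum>j<k. a j * max 0 (y j))"
      using a by (intro sum_ennreal) (auto simp: less_imp_le)
    finally show ?thesis .
  qed
  have nonneg: "0 \<le> (\<Sum>j<k. a j * max 0 (y j))" for y :: "nat \<Rightarrow> real"
    using a by (intro sum_nonneg) (auto simp: less_imp_le)
  have split: "(\<Sum>j<k. a j * T j x) = (\<Sum>j<k. a j * max 0 (1 * T j x)) - (\<Sum>j<k. a j * max 0 (-1 * T j x))" for x
    unfolding sum_subtractf[symmetric] by (intro sum.cong refl) (auto simp: max_def)
  let ?SP = "\<Sum>j<k. ennreal (a j) * P j" and ?SQ = "\<Sum>j<k. ennreal (a j) * Q j"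
  have iP: "(\<integral>\<^sup>+ x. (\<Sum>j<k. ennreal (a j) * ennreal (1 * T j x)) \<partial>N) = ?SP"
    unfolding intsum P_def by simp
  have iQ: "(\<integral>\<^sup>+ x. (\<Sum>j<k. ennreal (a j) * ennreal (-1 * T j x)) \<partial>N) = ?SQ"
    unfolding intsum Q_def by simp
  have [measurable]: "(\<lambda>x. \<Sum>j<k. ennreal (a j) * ennreal (s * T j x)) \<in> borel_measurable N" for s :: real
    by (intro borel_measurable_sum) auto
  \<comment> \<open>Integrates the pointwise inequality: negative part of w plus weighted positive
    parts of the terms is at most positive part of w plus weighted negative parts of the terms plus
    R.\<close>
  have main: "q + ?SP \<le> p + ?SQ + ennreal \<rho>"
  proof -
    have "(\<integral>\<^sup>+ x. ennreal (- w x) + (\<Sum>j<k. ennreal (a j) * ennreal (1 * T j x)) \<partial>N)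
       \<le> (\<integral>\<^sup>+ x. ennreal (w x) + (\<Sum>j<k. ennreal (a j) * ennreal (-1 * T j x)) + ennreal (R x) \<partial>N)"
    proof (rule nn_integral_mono_AE, use bound in eventually_elim)
      case (elim x)
      have "max 0 (- w x) + (\<Sum>j<k. a j * max 0 (1 * T j x)) \<le> max 0 (w x) + (\<Sum>j<k. a j * max 0 (-1 * T j x)) + R x"
        using elim split[of x] by (auto simp: max_def)
      then show ?case
        unfolding esum emax[of "w x"] emax[of "- w x"]
        using nonneg R(2)[of x] by (simp add: ennreal_leI add_nonneg_nonneg flip: ennreal_plus)
    qed
    also have "\<dots> = (\<integral>\<^sup>+ x. ennreal (w x) + (\<Sum>j<k. ennreal (a j) * ennreal (-1 * T j x)) \<partial>N) + ennreal \<rho>"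
      unfolding \<rho>(2)[symmetric] by (rule nn_integral_add) measurable
    also have "(\<integral>\<^sup>+ x. ennreal (w x) + (\<Sum>j<k. ennreal (a j) * ennreal (-1 * T j x)) \<partial>N) = p + ?SQ"
      unfolding p_def iQ[symmetric] by (rule nn_integral_add) measurable
    also have "(\<integral>\<^sup>+ x. ennreal (- w x) + (\<Sum>j<k. ennreal (a j) * ennreal (1 * T j x)) \<partial>N) = q + ?SP"
      unfolding q_def iP[symmetric] by (rule nn_integral_add) measurable
    finally show ?thesis .
  qed
  have upper: "p \<le> ?SP + ennreal \<rho>"
  proof -
    have "p \<le> (\<integral>\<^sup>+ x. (\<Sum>j<k. ennreal (a j) * ennreal (1 * T j x)) + ennreal (R x) \<partial>N)"
      unfolding p_def
    proof (rule nn_integral_mono_AE, use bound in eventually_elim)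
      case (elim x)
      have "max 0 (w x) \<le> (\<Sum>j<k. a j * max 0 (1 * T j x)) + R x"
        using elim split[of x] nonneg[of "\<lambda>j. -1 * T j x"] nonneg[of "\<lambda>j. 1 * T j x"] R(2)[of x] by (auto simp: max_def)
      then show ?case
        unfolding esum emax[of "w x"]
        using nonneg R(2)[of x] by (simp add: ennreal_leI flip: ennreal_plus)
    qed
    also have "\<dots> = ?SP + ennreal \<rho>"
      by (subst nn_integral_add) (auto simp only: iP \<rho>, measurable)
    finally show ?thesis .
  qed
  have lower: "q \<le> ?SQ + ennreal \<rho>"
  proof -
    have "q \<le> (\<integral>\<^sup>+ x. (\<Sum>j<k. ennreal (a j) * ennreal (-1 * T j x)) + ennreal (R x) \<partial>N)"
      unfolding q_def
    proof (rule nn_integral_mono_AE, use bound in eventually_elim)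
      case (elim x)
      have "max 0 (- w x) \<le> (\<Sum>j<k. a j * max 0 (-1 * T j x)) + R x"
        using elim split[of x] nonneg[of "\<lambda>j. -1 * T j x"] nonneg[of "\<lambda>j. 1 * T j x"] R(2)[of x] by (auto simp: max_def)
      then show ?case
        unfolding esum emax[of "- w x"]
        using nonneg R(2)[of x] by (simp add: ennreal_leI flip: ennreal_plus)
    qed
    also have "\<dots> = ?SQ + ennreal \<rho>"
      by (subst nn_integral_add) (auto simp only: iQ \<rho>, measurable)
    finally show ?thesis .
  qed
  have fin_sum: "(\<Sum>j<k. ennreal (a j) * y j) < top" if "\<forall>j<k. y j < top" for y
    using that by (auto simp: ennreal_mult_less_top)
  have one: "P j < top \<or> Q j < top" if "j < k" for j
    using T that by (auto simp: integrals_summable_def ext_integrable_def P_def Q_def)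
  \<comment> \<open>With the convention \<infinity> - \<infinity> = \<infinity>, an infinite
    positive part always forces the value \<infinity>, but an infinite negative part forces
    -\<infinity> only when the positive part is finite; the second claim therefore uses
    \<open>one\<close>.\<close>
  have cases: "(\<forall>j<k. P j < top) \<or> (\<forall>j<k. Q j < top)"
  proof -
    have "P j < top" if "ext_integral N (T j) \<noteq> \<infinity>" for j
      using that unfolding extT by (cases "P j"; cases "Q j") auto
    moreover have "Q j < top" if "ext_integral N (T j) \<noteq> - \<infinity>" "j < k" for j
      using that one[of j] unfolding extT by (cases "P j"; cases "Q j") auto
    ultimately show ?thesis using T unfolding integrals_summable_def by blast
  qed
  show "ext_integrable N w"
  proof (cases "\<forall>j<k. P j < top")
    case True
    then have "p < top" using upper fin_sum[OF True] by (auto intro: le_less_trans)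
    then show ?thesis by (simp add: ext_integrable_def p_def)
  next
    case False
    then have "\<forall>j<k. Q j < top" using cases by blast
    then have "q < top" using lower fin_sum[of Q] by (auto intro: le_less_trans)
    then show ?thesis by (simp add: ext_integrable_def q_def)
  qed
  show "(\<Sum>j<k. ereal (a j) * ext_integral N (T j)) - ereal (\<integral>x. R x \<partial>N) \<le> ext_integral N w"
  \<comment> \<open>If some negative part is infinite, the left side is -\<infinity>. Otherwise q is
    finite: an infinite p makes the right side \<infinity>, and a finite p makes everything finite
    by \<open>main\<close>, so that real arithmetic applies.\<close>
  proof (cases "\<forall>j<k. Q j < top")
    case Q: True
    then have q: "q < top" using lower fin_sum[of Q] by (auto intro: le_less_trans)
    show ?thesis
    proof (cases "p = top")
      case True
      then show ?thesis using q unfolding extw by (cases q) auto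
    next
      case False
      have "p + ?SQ + ennreal \<rho> < top"
        using False fin_sum[OF Q] by (simp only: ennreal_add_less_top less_top ennreal_less_top simp_thms)
      then have "q + ?SP < top" using main by (rule le_less_trans[rotated])
      then have SP: "?SP < top" by (simp only: ennreal_add_less_top)
      have P: "\<forall>j<k. P j < top"
      proof (intro allI impI)
        fix j assume "j < k"
        then have "ennreal (a j) * P j \<le> ?SP" by (intro member_le_sum) auto
        then have "ennreal (a j) * P j < top" using SP by (rule le_less_trans)
        then show "P j < top" using a[of j] by (auto simp: ennreal_mult_less_top)
      qed
      define P' Q' p' q' where "P' = (\<lambda>j. enn2real (P j))" "Q' = (\<lambda>j. enn2real (Q j))" "p' = enn2real p" "q' = enn2real q"
      have eqs: "\<And>j. j < k \<Longrightarrow> P j = ennreal (P' j)" "\<And>j. j < k \<Longrightarrow> Q j = ennreal (Q' j)" "p = ennreal p'" "q = ennreal q'"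
        using P Q q False by (auto simp: P'_Q'_p'_q'_def less_top)
      have nn: "P' j \<ge> 0" "Q' j \<ge> 0" "p' \<ge> 0" "q' \<ge> 0" for j by (auto simp: P'_Q'_p'_q'_def)
      have sums: "?SP = ennreal (\<Sum>j<k. a j * P' j)" "?SQ = ennreal (\<Sum>j<k. a j * Q' j)"
        using a nn eqs by (auto simp: less_imp_le ennreal_mult[symmetric] sum_ennreal)
      have snn: "(\<Sum>j<k. a j * P' j) \<ge> 0" "(\<Sum>j<k. a j * Q' j) \<ge> 0"
        using a nn by (auto intro!: sum_nonneg simp: less_imp_le)
      have "q' + (\<Sum>j<k. a j * P' j) \<le> p' + (\<Sum>j<k. a j * Q' j) + \<rho>"
        using main nn snn \<rho> unfolding sums eqs(3,4) by (simp flip: ennreal_plus)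
      then have "(\<Sum>j<k. a j * (P' j - Q' j)) - \<rho> \<le> p' - q'"
        by (simp add: right_diff_distrib sum_subtractf)
      moreover have "(\<Sum>j<k. ereal (a j) * ext_integral N (T j)) = ereal (\<Sum>j<k. a j * (P' j - Q' j))"
        unfolding extT sum_ereal[symmetric] using eqs nn by (intro sum.cong) (auto simp: enn2ereal_ennreal)
      moreover have "ext_integral N w = ereal (p' - q')"
        unfolding extw eqs(3,4) using nn by (simp add: enn2ereal_ennreal)
      ultimately show ?thesis by (simp add: \<rho>_def)
    qed
  next
    case False
    then obtain j where j: "j < k" "Q j = top" by (auto simp: less_top[symmetric])
    have P: "\<forall>j<k. P j < top" using cases False by blast
    have nP: "ereal (a i) * ext_integral N (T i) \<noteq> \<infinity>" if "i < k" for i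
      unfolding extT using P that a[of i] by (cases "P i"; cases "Q i") (auto simp: enn2ereal_ennreal)
    have "ereal (a j) * ext_integral N (T j) = - \<infinity>"
      unfolding extT using P j a[of j] by (cases "P j") (auto simp: enn2ereal_ennreal)
    then have "(\<Sum>j<k. ereal (a j) * ext_integral N (T j)) = - \<infinity>"
      using j(1) nP by (intro ereal_sum_eq_MInfty[of _ j]) auto
    then show ?thesis by simp
  qed
qed

section \<open>The main estimate\<close>

lemma L_inf_AE_bound:
  assumes "F \<in> L_inf \<Omega>"
  shows "AE x in lebesgue_on \<Omega>. norm (F x) \<le> \<bar>real_of_ereal (linf_norm \<Omega> F)\<bar>"
proof -
  have lt: "linf_norm \<Omega> F < \<infinity>" using assms by (simp add: L_inf_def)
  have "AE x in lebesgue_on \<Omega>. ereal (norm (F x)) \<le> linf_norm \<Omega> F"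
    unfolding linf_norm_def by (rule esssup_AE)
  then show ?thesis
    by eventually_elim (use lt in \<open>cases "linf_norm \<Omega> F"; auto\<close>)
qed

lemma L_inf_subset_L1_loc:
  fixes \<Omega> :: "'a::euclidean_space set"
  assumes "open \<Omega>" "bounded \<Omega>" and F: "F \<in> L_inf \<Omega>"
  shows "F \<in> L1_loc \<Omega>"
proof -
  have lm: "\<Omega> \<in> lmeasurable" using assms by (intro lmeasurable_open)
  have int: "integrable (lebesgue_on \<Omega>) F"
    using F by (intro finite_measure.integrable_const_bound[OF finite_measure_lebesgue_on[OF lm] L_inf_AE_bound[OF F]])
      (simp add: L_inf_def)
  have "integrable (lebesgue_on C) F" if "compact C" "C \<subseteq> \<Omega>" for C
    using integrable_lebesgue_on_subset[OF int that(2) fmeasurableD[OF lmeasurable_compact[OF that(1)]] fmeasurableD[OF lm]] .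
  then show ?thesis
    using F by (simp add: L1_loc_def L_inf_def)
qed

lemma L1_loc_diff: "G \<in> L1_loc \<Omega> \<Longrightarrow> F \<in> L1_loc \<Omega> \<Longrightarrow> (\<lambda>x. G x - F x) \<in> L1_loc \<Omega>"
  unfolding L1_loc_def by (simp add: borel_measurable_diff)

text \<open>Choosing c as a function before M, F and G expresses that the constant depends on F only
  through its norm. The condition \<open>integrals_summable\<close> keeps \<infinity> and
  -\<infinity> from meeting in the Taylor sum.\<close>

theorem lemma3p3:
  fixes \<Omega> :: "(real ^ 'n) set"
    and W :: "real ^ 'n \<Rightarrow> real ^ 'n ^ 'N \<Rightarrow> real"
    and k :: nat
    and c\<^sub>k r :: real
  assumes "CARD('n) \<ge> 2" and "k \<ge> 2"
    and "lipschitz_domain \<Omega>"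
    and "AE x in lebesgue_on \<Omega>. C_class k (W x)"
    and "\<And>Hs. length Hs \<le> k \<Longrightarrow>
           (\<lambda>(x, K). Dn (W x) Hs K) \<in> borel_measurable (lebesgue_on (\<Omega> \<times> UNIV))"
    and "c\<^sub>k > 0" and "r > 0"
    and "AE x in lebesgue_on \<Omega>. \<forall>K.
           multilinear_norm k (\<lambda>Hs. Dn (W x) Hs K) \<le> c\<^sub>k * (1 + norm K powr r)"
  shows "\<exists>c :: real \<Rightarrow> real \<Rightarrow> real. \<forall>M > 0. \<forall>F \<in> L_inf \<Omega>.
    c M (real_of_ereal (linf_norm \<Omega> F)) > 0 \<and>
    (\<forall>G \<in> BMO \<Omega>. bmo_norm \<Omega> (\<lambda>x. G x - F x) < ennreal M \<longrightarrow>
      (let H = (\<lambda>x. G x - F x);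
           T = (\<lambda>j x. Dn (W x) (replicate j (H x)) (F x))
       in integrals_summable (lebesgue_on \<Omega>) k T \<longrightarrow>
            integrable (lebesgue_on \<Omega>) (\<lambda>x. norm (H x) ^ k) \<and>
            ext_integrable (lebesgue_on \<Omega>) (\<lambda>x. W x (G x)) \<and>
            ext_integral (lebesgue_on \<Omega>) (\<lambda>x. W x (G x))
              \<ge> ext_integral (lebesgue_on \<Omega>) (\<lambda>x. W x (F x))
                + (\<Sum>j = 1..k - 1. ereal (1 / fact j) * ext_integral (lebesgue_on \<Omega>) (T j))
                - ereal (c M (real_of_ereal (linf_norm \<Omega> F))
                         * (\<integral>x. norm (H x) ^ k \<partial>lebesgue_on \<Omega>))))"
proof -
  note k = assms(2) and \<Omega> = assms(3) and CW = assms(4) and measW = assms(5) and ck = assms(6) and r = assms(7)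
  note growth = assms(8)
  have op: "open \<Omega>" and bdd: "bounded \<Omega>"
    using \<Omega> by (auto simp: lipschitz_domain_def domain_set_def)
  let ?N = "lebesgue_on \<Omega>"
  \<comment> \<open>Interpolation between the exponents k and k + r; the constant is fixed as a
    function of M before F is introduced.\<close>
  have "\<forall>M>0. \<exists>C>0. \<forall>H :: real ^ 'n \<Rightarrow> real ^ 'n ^ 'N. H \<in> L1_loc \<Omega> \<longrightarrow> bmo_norm \<Omega> H < ennreal M \<longrightarrow>
    integrable ?N (\<lambda>x. norm (H x) powr real k) \<and> integrable ?N (\<lambda>x. norm (H x) powr (real k + r)) \<and>
    (\<integral>x. norm (H x) powr (real k + r) \<partial>?N) \<le> C * (\<integral>x. norm (H x) powr real k \<partial>?N)"
    using k r by (intro allI impI bmo_interpolation[OF \<Omega>]) auto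
  then have "\<exists>C. \<forall>M>0. C M > 0 \<and> (\<forall>H :: real ^ 'n \<Rightarrow> real ^ 'n ^ 'N. H \<in> L1_loc \<Omega> \<longrightarrow> bmo_norm \<Omega> H < ennreal M \<longrightarrow>
    integrable ?N (\<lambda>x. norm (H x) powr real k) \<and> integrable ?N (\<lambda>x. norm (H x) powr (real k + r)) \<and>
    (\<integral>x. norm (H x) powr (real k + r) \<partial>?N) \<le> C M * (\<integral>x. norm (H x) powr real k \<partial>?N))"
    by (intro choice) blast
  then obtain C where C: "\<And>M. M > 0 \<Longrightarrow> C M > 0"
    and interp: "\<And>M (H :: real ^ 'n \<Rightarrow> real ^ 'n ^ 'N). M > 0 \<Longrightarrow> H \<in> L1_loc \<Omega> \<Longrightarrow> bmo_norm \<Omega> H < ennreal M \<Longrightarrow>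
    integrable ?N (\<lambda>x. norm (H x) powr real k) \<and> integrable ?N (\<lambda>x. norm (H x) powr (real k + r)) \<and>
    (\<integral>x. norm (H x) powr (real k + r) \<partial>?N) \<le> C M * (\<integral>x. norm (H x) powr real k \<partial>?N)"
    by blast
  \<comment> \<open>Coefficients of |H|^k and |H|^(k+r) in the Taylor remainder when |F| \<le> |s|
    almost everywhere.\<close>
  define c1 where "c1 s = c\<^sub>k * (1 + (2 * \<bar>s\<bar>) powr r)" for s
  define c2 where "c2 = c\<^sub>k * 2 powr r"
  have c1: "c1 s > 0" for s unfolding c1_def using ck by (intro mult_pos_pos add_pos_nonneg) auto
  have c2: "c2 > 0" unfolding c2_def using ck by simp
  show ?thesis
  \<comment> \<open>The interpolation constant turns the term with |H|^(k+r) into one with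
    |H|^k.\<close>
  proof (intro exI[of _ "\<lambda>M s. c1 s + c2 * C M"] allI impI ballI conjI)
    fix M :: real and F :: "real ^ 'n \<Rightarrow> real ^ 'n ^ 'N" assume M: "M > 0" and F: "F \<in> L_inf \<Omega>"
    define s where "s = real_of_ereal (linf_norm \<Omega> F)"
    show "c1 (real_of_ereal (linf_norm \<Omega> F)) + c2 * C M > 0"
      using c1 c2 C[OF M] by (simp add: add_pos_pos)
    fix G assume G: "G \<in> BMO \<Omega>" and small: "bmo_norm \<Omega> (\<lambda>x. G x - F x) < ennreal M"
    define H where "H x = G x - F x" for x
    define T where "T j x = Dn (W x) (replicate j (H x)) (F x)" for j x
    define R where "R x = c1 s * norm (H x) ^ k + c2 * norm (H x) powr (real k + r)" for x
    have GL: "G \<in> L1_loc \<Omega>" using G by (simp add: BMO_def)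
    have HL: "H \<in> L1_loc \<Omega>"
      unfolding H_def by (intro L1_loc_diff GL L_inf_subset_L1_loc op bdd F)
    have small': "bmo_norm \<Omega> H < ennreal M" using small by (simp add: H_def[abs_def])
    have power: "norm (H x) powr real k = norm (H x) ^ k" for x
      using k by (intro powr_realpow') auto
    have Hk: "integrable ?N (\<lambda>x. norm (H x) ^ k)" and Hkr: "integrable ?N (\<lambda>x. norm (H x) powr (real k + r))"
      and le: "(\<integral>x. norm (H x) powr (real k + r) \<partial>?N) \<le> C M * (\<integral>x. norm (H x) ^ k \<partial>?N)"
      using interp[OF M HL small'] unfolding power by blast+
    have R: "integrable ?N R" "\<And>x. R x \<ge> 0"
      unfolding R_def using Hk Hkr c1[of s] c2 by auto
    have intR: "(\<integral>x. R x \<partial>?N) \<le> (c1 s + c2 * C M) * (\<integral>x. norm (H x) ^ k \<partial>?N)"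
    proof -
      have "(\<integral>x. R x \<partial>?N) = c1 s * (\<integral>x. norm (H x) ^ k \<partial>?N) + c2 * (\<integral>x. norm (H x) powr (real k + r) \<partial>?N)"
        unfolding R_def using Hk Hkr by simp
      also have "\<dots> \<le> c1 s * (\<integral>x. norm (H x) ^ k \<partial>?N) + c2 * (C M * (\<integral>x. norm (H x) ^ k \<partial>?N))"
        using le c2 by (intro add_left_mono mult_left_mono) auto
      finally show ?thesis by (simp add: distrib_right mult.assoc)
    qed
    have w: "(\<lambda>x. W x (G x)) \<in> borel_measurable ?N"
    proof (rule borel_measurable_superposition[where W = W and G = G, OF op])
      show "(\<lambda>(x, K). W x K) \<in> borel_measurable (lebesgue_on (\<Omega> \<times> UNIV))"
        using measW[of "[]"] by simp
      show "AE x in ?N. continuous_on UNIV (W x)"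
        using CW
      proof eventually_elim
        case (elim x)
        then have "continuous_on UNIV (Dn (W x) [])" unfolding C_class_def by (metis list.size(3) le0)
        then show ?case by simp
      qed
      show "G \<in> borel_measurable ?N" using GL by (simp add: L1_loc_def)
    qed
    have bound: "AE x in ?N. \<bar>W x (G x) - (\<Sum>j<k. 1 / fact j * T j x)\<bar> \<le> R x"
      using CW growth L_inf_AE_bound[OF F]
    proof eventually_elim
      case (elim x)
      have "\<bar>W x (F x + H x) - (\<Sum>j<k. 1 / fact j * Dn (W x) (replicate j (H x)) (F x))\<bar>
        \<le> c\<^sub>k * (1 + (2 * \<bar>s\<bar>) powr r) * norm (H x) ^ k + c\<^sub>k * 2 powr r * norm (H x) powr (real k + r)"
        using k elim(2,3) by (intro Taylor_remainder_bound[OF elim(1) _ r ck]) (auto simp: s_def)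
      then show ?case by (simp add: T_def R_def c1_def c2_def H_def)
    qed
    have main: "integrable ?N (\<lambda>x. norm (H x) ^ k) \<and> ext_integrable ?N (\<lambda>x. W x (G x)) \<and>
            ext_integral ?N (\<lambda>x. W x (G x))
              \<ge> ext_integral ?N (\<lambda>x. W x (F x)) + (\<Sum>j = 1..k - 1. ereal (1 / fact j) * ext_integral ?N (T j))
                - ereal ((c1 s + c2 * C M) * (\<integral>x. norm (H x) ^ k \<partial>?N))"
      if summable: "integrals_summable ?N k T"
    proof (intro conjI Hk)
      note sandwich = ext_integral_sandwich[OF summable _ w R bound]
      show "ext_integrable ?N (\<lambda>x. W x (G x))" by (rule sandwich(1)) simp
      \<comment> \<open>The term j = 0 has weight 1 / 0! = 1 and is the integral of W along F, which
        the claim lists separately.\<close>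
      have "{..<k} = insert 0 {1..k - 1}" using k by auto
      then have "(\<Sum>j<k. ereal (1 / fact j) * ext_integral ?N (T j))
          = ext_integral ?N (T 0) + (\<Sum>j = 1..k - 1. ereal (1 / fact j) * ext_integral ?N (T j))"
        by (simp add: one_ereal_def[symmetric])
      moreover have "T 0 = (\<lambda>x. W x (F x))" by (auto simp: T_def)
      ultimately have "ext_integral ?N (\<lambda>x. W x (F x)) + (\<Sum>j = 1..k - 1. ereal (1 / fact j) * ext_integral ?N (T j))
          - ereal (\<integral>x. R x \<partial>?N) \<le> ext_integral ?N (\<lambda>x. W x (G x))"
        using sandwich(2) by simp
      moreover have "X - ereal ((c1 s + c2 * C M) * (\<integral>x. norm (H x) ^ k \<partial>?N)) \<le> X - ereal (\<integral>x. R x \<partial>?N)" for X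
        using intR by (intro ereal_minus_mono) auto
      ultimately show "ext_integral ?N (\<lambda>x. W x (F x)) + (\<Sum>j = 1..k - 1. ereal (1 / fact j) * ext_integral ?N (T j))
                - ereal ((c1 s + c2 * C M) * (\<integral>x. norm (H x) ^ k \<partial>?N)) \<le> ext_integral ?N (\<lambda>x. W x (G x))"
        by (rule order_trans[rotated])
    qed
    show "let H = \<lambda>x. G x - F x; T = \<lambda>j x. Dn (W x) (replicate j (H x)) (F x)
      in integrals_summable ?N k T \<longrightarrow>
            integrable ?N (\<lambda>x. norm (H x) ^ k) \<and>
            ext_integrable ?N (\<lambda>x. W x (G x)) \<and>
            ext_integral ?N (\<lambda>x. W x (G x))
              \<ge> ext_integral ?N (\<lambda>x. W x (F x))
                + (\<Sum>j = 1..k - 1. ereal (1 / fact j) * ext_integral ?N (T j))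
                - ereal ((c1 (real_of_ereal (linf_norm \<Omega> F)) + c2 * C M)
                         * (\<integral>x. norm (H x) ^ k \<partial>lebesgue_on \<Omega>))"
      unfolding Let_def using main unfolding T_def[abs_def] H_def[abs_def] s_def by (rule impI)
  qed
qed

end
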